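(* Let $\theta_1,\theta_2$ be inner functions on the unit disc $\mathbb{D}$. The quotient module $H^2(\triangle_H)\ominus\theta_1(z/w)\theta_2(w)H^2(\triangle_H)$ is doubly commuting if and only if one of the following holds: (i) $\theta_1$ and $\theta_2$ are constant functions; (ii) $\theta_1$ is constant and $\theta_2(w)=c\,\dfrac{w-b}{1-\bar b w}$ for some $b\in\mathbb{D}$ and $c\in\mathbb{T}$; (iii) $\theta_2$ is constant and $\theta_1(z)=c_1z$ for some $c_1\in\mathbb{T}$; (iv) $\theta_1(z)=c_1z$ and $\theta_2(w)=c_2w$ for some $c_1,c_2\in\mathbb{T}$.
   Context: The Hartogs triangle is $\triangle_H=\{(z,w)\in\mathbb{C}^2: |z|<|w|<1\}$. The Hardy space $H^2(\triangle_H)$ is the Hilbert space of holomorphic $f$ on $\triangle_H$ with $\|f\|^2=\sup_{s,t\in(0,1)}\frac{1}{4\pi^2}\int_0^{2\pi}\int_0^{2\pi}|f(ste^{i\theta},te^{i\gamma})|^2\,st^2\,d\theta\,d\gamma<\infty$; the functions $\frac1w(\frac zw)^iw^j$, $i,j\ge0$, form an orthonormal basis. $M_z,M_w$ are multiplication by $z$ and $w$ on $H^2(\triangle_H)$. A quotient module is a closed subspace $\mathcal{Q}$ invariant under $M_z^*$ and $M_w^*$; put $Q_z=P_{\mathcal{Q}}M_z|_{\mathcal{Q}}$, $Q_w=P_{\mathcal{Q}}M_w|_{\mathcal{Q}}$, with $P_{\mathcal Q}$ the orthogonal projection onto $\mathcal{Q}$. $\mathcal{Q}$ is doubly commuting if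 $Q_z^*Q_w=Q_wQ_z^*$. $\mathcal{H}\ominus\mathcal{M}$ is the orthogonal complement of $\mathcal{M}$ in $\mathcal{H}$. Constant functions of modulus one are inner. $\theta_1(z/w)\theta_2(w)$ denotes the function $(z,w)\mapsto\theta_1(z/w)\theta_2(w)$ on $\triangle_H$. *)

theory Defs
  imports "HOL-Complex_Analysis.Complex_Analysis"
begin

section \<open>Inner functions on the unit disc\<close>

definition inner_function :: "(complex \<Rightarrow> complex) \<Rightarrow> bool" where
  "inner_function \<theta> \<longleftrightarrow>
     \<theta> holomorphic_on ball 0 1 \<and> bounded (\<theta> ` ball 0 1) \<and>
     (AE t in lebesgue_on {0..2*pi}.
        \<exists>l. norm l = 1 \<and> ((\<lambda>r. \<theta> (of_real r * cis t)) \<longlongrightarrow> l) (at_left 1))"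

section \<open>The Hardy space of the Hartogs triangle\<close>

definition hartogs_triangle :: "(complex \<times> complex) set" where
  "hartogs_triangle = {(z, w). norm z < norm w \<and> norm w < 1}"

text \<open>Holomorphy on an open subset of \<open>\<complex>\<^sup>2\<close>: the Frechet derivative exists
  and is complex linear at every point.\<close>

definition holomorphic2_on :: "(complex \<times> complex \<Rightarrow> complex) \<Rightarrow> (complex \<times> complex) set \<Rightarrow> bool" where
  "holomorphic2_on f S \<longleftrightarrow>
     (\<forall>p\<in>S. \<exists>a b. (f has_derivative (\<lambda>(h, k). a * h + b * k)) (at p))"

definition torus_mean :: "(complex \<times> complex \<Rightarrow> complex) \<Rightarrow> real \<Rightarrow> real \<Rightarrow> real" where
  "torus_mean f s t = 1 / (4 * pi\<^sup>2) *
     integral {0..2*pi} (\<lambda>\<gamma>. integral {0..2*pi} (\<lambda>\<theta>.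
       (norm (f (of_real (s * t) * cis \<theta>, of_real t * cis \<gamma>)))\<^sup>2 * (s * t\<^sup>2)))"

text \<open>Functions on the triangle are represented by total functions vanishing outside it, so that
  equality of elements of the Hardy space is equality in HOL.\<close>

definition hardy :: "(complex \<times> complex \<Rightarrow> complex) set" where
  "hardy = {f. holomorphic2_on f hartogs_triangle \<and> (\<forall>p. p \<notin> hartogs_triangle \<longrightarrow> f p = 0) \<and>
     bdd_above ((\<lambda>(s, t). torus_mean f s t) ` ({0<..<1} \<times> {0<..<1}))}"

definition hardy_norm :: "(complex \<times> complex \<Rightarrow> complex) \<Rightarrow> real" where
  "hardy_norm f = sqrt (SUP (s, t)\<in>{0<..<1} \<times> {0<..<1}. torus_mean f s t)"

text \<open>The inner product is the one belonging to the norm, recovered by polarization;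
  it is linear in the first and conjugate linear in the second argument.\<close>

definition hardy_inner ::
  "(complex \<times> complex \<Rightarrow> complex) \<Rightarrow> (complex \<times> complex \<Rightarrow> complex) \<Rightarrow> complex" where
  "hardy_inner f g =
     (\<Sum>k<4. \<i> ^ k * of_real ((hardy_norm (\<lambda>p. f p + \<i> ^ k * g p))\<^sup>2)) / 4"

definition closed_subspace :: "(complex \<times> complex \<Rightarrow> complex) set \<Rightarrow> bool" where
  "closed_subspace Q \<longleftrightarrow>
     Q \<subseteq> hardy \<and> (\<lambda>p. 0) \<in> Q \<and>
     (\<forall>f\<in>Q. \<forall>g\<in>Q. (\<lambda>p. f p + g p) \<in> Q) \<and>
     (\<forall>c. \<forall>f\<in>Q. (\<lambda>p. c * f p) \<in> Q) \<and>
     (\<forall>F. \<forall>g\<in>hardy. (\<forall>n. F n \<in> Q) \<and> (\<lambda>n. hardy_norm (\<lambda>p. F n p - g p)) \<longlonglongrightarrow> 0 \<longrightarrow> g \<in> Q)"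

definition orth_compl :: "(complex \<times> complex \<Rightarrow> complex) set \<Rightarrow> (complex \<times> complex \<Rightarrow> complex) set" where
  "orth_compl S = {f \<in> hardy. \<forall>g\<in>S. hardy_inner f g = 0}"

text \<open>The descriptions in the next two definitions are uniquely satisfied when \<open>Q\<close> is a closed
  subspace, \<open>f\<close> lies in the Hardy space, \<open>X\<close> is a closed subspace, \<open>T\<close> is a bounded operator on
  \<open>X\<close>, and \<open>g\<close> lies in \<open>X\<close>.\<close>

definition orth_proj ::
  "(complex \<times> complex \<Rightarrow> complex) set \<Rightarrow> (complex \<times> complex \<Rightarrow> complex) \<Rightarrow> (complex \<times> complex \<Rightarrow> complex)"
where
  "orth_proj Q f = (THE h. h \<in> Q \<and> (\<forall>g\<in>Q. hardy_inner (\<lambda>p. f p - h p) g = 0))"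

definition adjoint_on ::
  "(complex \<times> complex \<Rightarrow> complex) set \<Rightarrow>
   ((complex \<times> complex \<Rightarrow> complex) \<Rightarrow> (complex \<times> complex \<Rightarrow> complex)) \<Rightarrow>
   (complex \<times> complex \<Rightarrow> complex) \<Rightarrow> (complex \<times> complex \<Rightarrow> complex)" where
  "adjoint_on X T g = (THE h. h \<in> X \<and> (\<forall>f\<in>X. hardy_inner (T f) g = hardy_inner f h))"

section \<open>Quotient modules\<close>

definition mult_z :: "(complex \<times> complex \<Rightarrow> complex) \<Rightarrow> (complex \<times> complex \<Rightarrow> complex)" where
  "mult_z f = (\<lambda>p. fst p * f p)"

definition mult_w :: "(complex \<times> complex \<Rightarrow> complex) \<Rightarrow> (complex \<times> complex \<Rightarrow> complex)" where
  "mult_w f = (\<lambda>p. snd p * f p)"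

definition quotient_module :: "(complex \<times> complex \<Rightarrow> complex) set \<Rightarrow> bool" where
  "quotient_module Q \<longleftrightarrow> closed_subspace Q \<and>
     (\<forall>f\<in>Q. adjoint_on hardy mult_z f \<in> Q \<and> adjoint_on hardy mult_w f \<in> Q)"

definition compress_z ::
  "(complex \<times> complex \<Rightarrow> complex) set \<Rightarrow> (complex \<times> complex \<Rightarrow> complex) \<Rightarrow> (complex \<times> complex \<Rightarrow> complex)"
where
  "compress_z Q f = orth_proj Q (mult_z f)"

definition compress_w ::
  "(complex \<times> complex \<Rightarrow> complex) set \<Rightarrow> (complex \<times> complex \<Rightarrow> complex) \<Rightarrow> (complex \<times> complex \<Rightarrow> complex)"
where
  "compress_w Q f = orth_proj Q (mult_w f)"

definition doubly_commuting :: "(complex \<times> complex \<Rightarrow> complex) set \<Rightarrow> bool" where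
  "doubly_commuting Q \<longleftrightarrow>
     (\<forall>f\<in>Q. adjoint_on Q (compress_z Q) (compress_w Q f) = compress_w Q (adjoint_on Q (compress_z Q) f))"

text \<open>The submodule \<open>\<theta>\<^sub>1(z/w) \<theta>\<^sub>2(w) H\<^sup>2\<close>.\<close>

definition product_submodule ::
  "(complex \<Rightarrow> complex) \<Rightarrow> (complex \<Rightarrow> complex) \<Rightarrow> (complex \<times> complex \<Rightarrow> complex) set" where
  "product_submodule \<theta>1 \<theta>2 = (\<lambda>f. \<lambda>(z, w). \<theta>1 (z / w) * \<theta>2 w * f (z, w)) ` hardy"

end

theory Submission
  imports Defs
begin

text \<open>Write \<open>u = z/w\<close>. The Hartogs triangle is the image of \<open>{(u, w). |u| < 1, 0 < |w| < 1}\<close>, and a function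
\<open>f\<close> of the Hardy space has the expansion \<open>f(z, w) = (1/w) \<Sum> a(i, j) u\<^sup>i w\<^sup>j\<close> with square-summable coefficients, its norm
being that of \<open>a\<close>. The map \<open>of_seq\<close> sends \<open>a\<close> to \<open>f\<close>; that it is an isometry onto the Hardy space is
\<open>hardy_norm_of_seq\<close> together with \<open>hardy_eq_of_seq\<close>. In this picture the space is the tensor product of two
copies of \<open>H\<^sup>2\<close> of the disc, in the variables \<open>u\<close> and \<open>w\<close>. With the unilateral shifts \<open>A\<close> and \<open>B\<close> on the factors, \<open>M\<^sub>w\<close> becomes
\<open>1 \<otimes> B\<close>, \<open>M\<^sub>z\<close> becomes \<open>A \<otimes> B\<close>, and the submodule becomes the closed span of the vectors
\<open>u\<^sup>m \<theta>1 \<otimes> w\<^sup>n \<theta>2\<close>. That \<open>\<theta>\<close> is inner enters only through the orthonormality of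
\<open>\<theta>, w \<theta>, w\<^sup>2 \<theta>, \<dots>\<close> (\<open>inner_function_inner_seq\<close>), which is a statement about its Taylor coefficients and
makes the projection \<open>P\<close> onto the quotient module \<open>Q\<close> explicit.

Since \<open>Q\<close> is invariant under \<open>M\<^sub>z\<^sup>*\<close>, double commutation says \<open>M\<^sub>z\<^sup>* P M\<^sub>w f = P M\<^sub>w M\<^sub>z\<^sup>* f\<close> for
\<open>f\<close> in \<open>Q\<close>. The function \<open>f = A\<^sup>*\<theta>1 \<otimes> 1\<close>, where \<open>A\<^sup>*\<theta>1 = (\<theta>1 - \<theta>1(0))/u\<close>, lies in \<open>Q\<close>, and so does \<open>M\<^sub>w f\<close>, while \<open>M\<^sub>z\<^sup>* f = 0\<close>. The condition
for this \<open>f\<close> gives \<open>(A\<^sup>*)\<^sup>2 \<theta>1 = 0\<close>, so \<open>\<theta>1\<close> is affine, and \<open>\<theta>1 \<bottom> u \<theta>1\<close> leaves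
\<open>\<theta>1 = a u\<^sup>p\<close> with \<open>p = 0\<close> or \<open>p = 1\<close> and \<open>|a| = 1\<close> (\<open>seq_doubly_commuting_imp_c1_affine\<close>, \<open>inner_seq_affine\<close>).

For such \<open>\<theta>1\<close> the projection acts on each power of \<open>u\<close> separately: as the identity on the coefficient of \<open>u\<^sup>i\<close> if \<open>i < p\<close>,
and as the projection onto \<open>K = H\<^sup>2 \<ominus> \<theta>2 H\<^sup>2\<close> if \<open>i \<ge> p\<close>. With \<open>k = B\<^sup>*\<theta>2\<close> and the reproducing
kernel \<open>k\<^sub>0 = 1 - cnj (\<theta>2(0)) \<theta>2\<close> of \<open>K\<close> at \<open>0\<close>, double commutation becomes (\<open>seq_doubly_commuting_iff_rows\<close>)

  \<open>\<langle>h, k\<rangle> k = h(0) k\<^sub>0\<close>, and if \<open>p = 1\<close> also \<open>\<langle>h, k\<rangle> k = h(0)\<close>, for all \<open>h\<close> in \<open>K\<close>.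

As \<open>h(0) = \<langle>h, k\<^sub>0\<rangle>\<close>, and \<open>k\<close> and \<open>k\<^sub>0\<close> both have squared norm \<open>1 - |\<theta>2(0)|\<^sup>2\<close>, the first equation means
that \<open>k\<close> is a unimodular multiple of \<open>k\<^sub>0\<close>. Solving \<open>(\<theta>2 - \<theta>2(0))/w = g (1 - cnj (\<theta>2(0)) \<theta>2)\<close> for
\<open>\<theta>2\<close> yields a constant or a Moebius transformation. The second equation forces moreover \<open>k\<^sub>0 = 1\<close> unless \<open>\<theta>2\<close> is
constant, hence \<open>\<theta>2(0) = 0\<close> and \<open>\<theta>2 = g w\<close>.\<close>

section \<open>Square-summable families\<close>

definition ell2 :: "('i \<Rightarrow> complex) set" where
  "ell2 = {a. (\<lambda>i. (norm (a i))\<^sup>2) summable_on UNIV}"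

definition ip :: "('i \<Rightarrow> complex) \<Rightarrow> ('i \<Rightarrow> complex) \<Rightarrow> complex" where
  "ip a b = (\<Sum>\<^sub>\<infinity>i. a i * cnj (b i))"

definition sqnorm :: "('i \<Rightarrow> complex) \<Rightarrow> real" where
  "sqnorm a = (\<Sum>\<^sub>\<infinity>i. (norm (a i))\<^sup>2)"

definition unit_seq :: "'i \<Rightarrow> 'i \<Rightarrow> complex" where
  "unit_seq m i = (if i = m then 1 else 0)"

lemma ell2_abs_summable_product:
  assumes "a \<in> ell2" "b \<in> ell2"
  shows "(\<lambda>i. norm (a i * b i)) summable_on UNIV"
proof (rule Infinite_Sum.abs_summable_product)
  show "(\<lambda>i. norm (a i * a i)) summable_on UNIV" "(\<lambda>i. norm (b i * b i)) summable_on UNIV"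
    using assms by (simp_all add: ell2_def norm_mult power2_eq_square)
qed

lemma ell2_cnj: "a \<in> ell2 \<Longrightarrow> (\<lambda>i. cnj (a i)) \<in> ell2"
  by (simp add: ell2_def)

lemma ell2_summable_ip:
  assumes "a \<in> ell2" "b \<in> ell2"
  shows "(\<lambda>i. a i * cnj (b i)) summable_on UNIV"
  using abs_summable_summable[OF ell2_abs_summable_product[OF assms(1) ell2_cnj[OF assms(2)]]] .

lemma ell2_I_bounded:
  assumes "\<And>F. finite F \<Longrightarrow> (\<Sum>i\<in>F. (norm (a i))\<^sup>2) \<le> C"
  shows "a \<in> ell2"
  unfolding ell2_def mem_Collect_eq
  by (rule nonneg_bdd_above_summable_on) (auto intro!: bdd_aboveI2 assms)

lemma ell2_finite_le: "a \<in> ell2 \<Longrightarrow> finite F \<Longrightarrow> (\<Sum>i\<in>F. (norm (a i))\<^sup>2) \<le> sqnorm a"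
  unfolding ell2_def sqnorm_def by (rule finite_sum_le_infsum) auto

lemma sqnorm_le_bounded:
  assumes "\<And>F. finite F \<Longrightarrow> (\<Sum>i\<in>F. (norm (a i))\<^sup>2) \<le> C"
  shows "sqnorm a \<le> C"
  using ell2_I_bounded[OF assms] assms unfolding ell2_def sqnorm_def
  by (intro infsum_le_finite_sums) auto

lemma ell2_add:
  assumes "a \<in> ell2" "b \<in> ell2" shows "(\<lambda>i. a i + b i) \<in> ell2"
proof (rule ell2_I_bounded)
  fix F :: "'a set" assume F: "finite F"
  have "(norm (a i + b i))\<^sup>2 \<le> 2 * (norm (a i))\<^sup>2 + 2 * (norm (b i))\<^sup>2" for i
  proof -
    have "(norm (a i + b i))\<^sup>2 \<le> (norm (a i) + norm (b i))\<^sup>2"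
      by (intro power_mono norm_triangle_ineq) auto
    also have "\<dots> \<le> 2 * (norm (a i))\<^sup>2 + 2 * (norm (b i))\<^sup>2"
      using sum_squares_bound[of "norm (a i)" "norm (b i)"] by (simp add: power2_sum)
    finally show ?thesis .
  qed
  hence "(\<Sum>i\<in>F. (norm (a i + b i))\<^sup>2) \<le> (\<Sum>i\<in>F. 2 * (norm (a i))\<^sup>2 + 2 * (norm (b i))\<^sup>2)"
    by (intro sum_mono)
  also have "\<dots> = 2 * (\<Sum>i\<in>F. (norm (a i))\<^sup>2) + 2 * (\<Sum>i\<in>F. (norm (b i))\<^sup>2)"
    by (simp add: sum.distrib sum_distrib_left)
  also have "\<dots> \<le> 2 * sqnorm a + 2 * sqnorm b"
    using ell2_finite_le[OF assms(1) F] ell2_finite_le[OF assms(2) F] by simp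
  finally show "(\<Sum>i\<in>F. (norm (a i + b i))\<^sup>2) \<le> 2 * sqnorm a + 2 * sqnorm b" .
qed

lemma ell2_scale: "a \<in> ell2 \<Longrightarrow> (\<lambda>i. c * a i) \<in> ell2"
  unfolding ell2_def by (auto simp: norm_mult power_mult_distrib intro: summable_on_cmult_right)

lemma ell2_diff: "a \<in> ell2 \<Longrightarrow> b \<in> ell2 \<Longrightarrow> (\<lambda>i. a i - b i) \<in> ell2"
  using ell2_add[of a "\<lambda>i. (-1) * b i"] ell2_scale[of b "-1"] by simp

lemma ell2_zero: "(\<lambda>i. 0) \<in> ell2"
  by (simp add: ell2_def)

lemma ell2_finite_support:
  assumes "finite {i. a i \<noteq> 0}" shows "a \<in> ell2"
  unfolding ell2_def mem_Collect_eq
  by (rule finite_nonzero_values_imp_summable_on) (use assms in auto)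

lemma ell2_unit: "unit_seq m \<in> ell2"
  by (rule ell2_finite_support) (simp add: unit_seq_def)

lemma ell2_sum: "(\<And>m. m \<in> F \<Longrightarrow> v m \<in> ell2) \<Longrightarrow> (\<lambda>i. \<Sum>m\<in>F. v m i) \<in> ell2"
  by (induction F rule: infinite_finite_induct) (auto intro: ell2_add ell2_zero)

lemma ip_add_left:
  "a \<in> ell2 \<Longrightarrow> b \<in> ell2 \<Longrightarrow> h \<in> ell2 \<Longrightarrow> ip (\<lambda>i. a i + b i) h = ip a h + ip b h"
  unfolding ip_def by (simp add: distrib_right infsum_add ell2_summable_ip)

lemma ip_scale_left: "ip (\<lambda>i. c * a i) h = c * ip a h"
  unfolding ip_def by (simp add: mult.assoc infsum_cmult_right')

lemma ip_commute: "ip b a = cnj (ip a b)"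
  unfolding ip_def infsum_cnj[symmetric] by (simp add: mult.commute)

lemma ip_diff_left:
  "a \<in> ell2 \<Longrightarrow> b \<in> ell2 \<Longrightarrow> h \<in> ell2 \<Longrightarrow> ip (\<lambda>i. a i - b i) h = ip a h - ip b h"
  using ip_add_left[of a "\<lambda>i. (-1) * b i" h] ell2_scale[of b "-1"] ip_scale_left[of "-1" b h] by simp

lemma ip_add_right:
  "a \<in> ell2 \<Longrightarrow> b \<in> ell2 \<Longrightarrow> h \<in> ell2 \<Longrightarrow> ip h (\<lambda>i. a i + b i) = ip h a + ip h b"
  unfolding ip_commute[of h "\<lambda>i. a i + b i"] ip_commute[of h a] ip_commute[of h b]
  by (simp add: ip_add_left)

lemma ip_scale_right: "ip h (\<lambda>i. c * a i) = cnj c * ip h a"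
  unfolding ip_commute[of h "\<lambda>i. c * a i"] ip_commute[of h a] by (simp add: ip_scale_left)

lemma ip_diff_right:
  "a \<in> ell2 \<Longrightarrow> b \<in> ell2 \<Longrightarrow> h \<in> ell2 \<Longrightarrow> ip h (\<lambda>i. a i - b i) = ip h a - ip h b"
  unfolding ip_commute[of h "\<lambda>i. a i - b i"] ip_commute[of h a] ip_commute[of h b]
  by (simp add: ip_diff_left)

lemma ip_zero [simp]: "ip (\<lambda>i. 0) h = 0" "ip h (\<lambda>i. 0) = 0"
  by (simp_all add: ip_def)

lemma ip_sum_left:
  "(\<And>m. m \<in> F \<Longrightarrow> v m \<in> ell2) \<Longrightarrow> h \<in> ell2 \<Longrightarrow> ip (\<lambda>i. \<Sum>m\<in>F. v m i) h = (\<Sum>m\<in>F. ip (v m) h)"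
proof (induction F rule: infinite_finite_induct)
  case (insert x F)
  then show ?case using ip_add_left[of "v x" "\<lambda>i. \<Sum>m\<in>F. v m i" h] ell2_sum[of F v] by simp
qed auto

lemma ip_sum_right:
  "(\<And>m. m \<in> F \<Longrightarrow> v m \<in> ell2) \<Longrightarrow> h \<in> ell2 \<Longrightarrow> ip h (\<lambda>i. \<Sum>m\<in>F. v m i) = (\<Sum>m\<in>F. ip h (v m))"
  unfolding ip_commute[of h "\<lambda>i. \<Sum>m\<in>F. v m i"] by (simp add: ip_sum_left ip_commute[of h "v _"])

lemma ip_self: "ip a a = of_real (sqnorm a)"
  unfolding ip_def sqnorm_def
proof -
  have "(\<Sum>\<^sub>\<infinity>i. a i * cnj (a i)) = (\<Sum>\<^sub>\<infinity>i. complex_of_real ((norm (a i))\<^sup>2))"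
    by (simp only: complex_norm_square)
  also have "\<dots> = of_real (\<Sum>\<^sub>\<infinity>i. (norm (a i))\<^sup>2)"
  proof (cases "(\<lambda>i. (norm (a i))\<^sup>2) summable_on UNIV")
    case True
    thus ?thesis by (intro infsumI has_sum_of_real) auto
  next
    case False
    hence "\<not> (\<lambda>i. complex_of_real ((norm (a i))\<^sup>2)) summable_on UNIV"
      using summable_on_Re by force
    thus ?thesis using False by (simp add: infsum_not_exists)
  qed
  finally show "(\<Sum>\<^sub>\<infinity>i. a i * cnj (a i)) = of_real (\<Sum>\<^sub>\<infinity>i. (norm (a i))\<^sup>2)" .
qed

lemma sqnorm_nonneg: "sqnorm a \<ge> 0"
  unfolding sqnorm_def by (rule infsum_nonneg) auto

lemma ip_unit_right [simp]: "ip a (unit_seq m) = a m"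
proof -
  have "ip a (unit_seq m) = (\<Sum>\<^sub>\<infinity>i\<in>{m}. a i * cnj (unit_seq m i))"
    unfolding ip_def by (rule infsum_cong_neutral) (auto simp: unit_seq_def)
  thus ?thesis by (simp add: unit_seq_def)
qed

lemma sqnorm_coord_le: "a \<in> ell2 \<Longrightarrow> (norm (a i))\<^sup>2 \<le> sqnorm a"
  using ell2_finite_le[of a "{i}"] by simp

lemma unimodular_cnj: "norm g = 1 \<Longrightarrow> g * cnj g = 1" "norm g = 1 \<Longrightarrow> cnj g * g = 1" for g :: complex
  using complex_norm_square[of g] by (simp_all add: mult.commute)

lemma sqnorm_zero_iff: "a \<in> ell2 \<Longrightarrow> sqnorm a = 0 \<longleftrightarrow> a = (\<lambda>i. 0)"
  using sqnorm_coord_le[of a] by (auto simp: sqnorm_def intro!: ext)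

lemma ip_Cauchy_Schwarz:
  assumes "a \<in> ell2" "b \<in> ell2"
  shows "(norm (ip a b))\<^sup>2 \<le> sqnorm a * sqnorm b"
proof (cases "sqnorm b = 0")
  case True
  thus ?thesis using sqnorm_zero_iff[OF assms(2)] by simp
next
  case False
  define \<beta> where "\<beta> = sqnorm b"
  have \<beta>: "\<beta> > 0" using False sqnorm_nonneg[of b] by (simp add: \<beta>_def)
  define c where "c = ip a b"
  define h where "h = (\<lambda>i. of_real \<beta> * a i - c * b i)"
  have l: "(\<lambda>i. of_real \<beta> * a i) \<in> ell2" "(\<lambda>i. c * b i) \<in> ell2"
    using assms by (auto intro: ell2_scale)
  have hl: "h \<in> ell2" unfolding h_def by (rule ell2_diff[OF l])
  have hb: "ip h b = 0"
    unfolding h_def ip_diff_left[OF l assms(2)] ip_scale_left ip_self by (simp add: c_def \<beta>_def)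
  have ba: "ip b a = cnj c" unfolding c_def by (rule ip_commute)
  have "ip h h = ip h (\<lambda>i. of_real \<beta> * a i - c * b i)" by (simp add: h_def)
  also have "\<dots> = of_real \<beta> * ip h a"
    unfolding ip_diff_right[OF l hl] ip_scale_right hb by simp
  also have "ip h a = of_real (\<beta> * sqnorm a) - c * cnj c"
    unfolding h_def ip_diff_left[OF l assms(1)] ip_scale_left ip_self ba by simp
  also have "\<dots> = of_real (\<beta> * sqnorm a - (norm c)\<^sup>2)"
    by (simp add: complex_norm_square[symmetric])
  finally have "complex_of_real (sqnorm h) = of_real (\<beta> * (\<beta> * sqnorm a - (norm c)\<^sup>2))"
    by (simp add: ip_self)
  hence "\<beta> * (\<beta> * sqnorm a - (norm c)\<^sup>2) \<ge> 0"
    using sqnorm_nonneg[of h] unfolding of_real_eq_iff by simp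
  hence "\<beta> * sqnorm a - (norm c)\<^sup>2 \<ge> 0" using \<beta> by (simp add: zero_le_mult_iff)
  thus ?thesis by (simp add: c_def \<beta>_def mult.commute)
qed

text \<open>The inner product of the Hardy space is defined from its norm by this formula; the identity is what lets an
isometry of norms carry inner products along.\<close>
lemma sqnorm_polarization:
  assumes "a \<in> ell2" "b \<in> ell2"
  shows "(\<Sum>k<4. \<i> ^ k * of_real (sqnorm (\<lambda>i. a i + \<i> ^ k * b i))) / 4 = ip a b"
proof -
  have e: "complex_of_real (sqnorm (\<lambda>i. a i + c * b i)) =
      of_real (sqnorm a) + cnj c * ip a b + c * cnj (ip a b) + c * cnj c * of_real (sqnorm b)" for c
  proof -
    have l: "(\<lambda>i. c * b i) \<in> ell2" using assms by (auto intro: ell2_scale)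
    show ?thesis
      unfolding ip_self[symmetric] ip_add_left[OF assms(1) l ell2_add[OF assms(1) l]]
        ip_add_right[OF assms(1) l assms(1)] ip_add_right[OF assms(1) l l]
        ip_scale_left ip_scale_right ip_commute[of b a]
      by (simp add: algebra_simps)
  qed
  have 4: "{..<4::nat} = {0,1,2,3}" by auto
  have 3: "\<i> ^ 3 = - \<i>" by (simp add: eval_nat_numeral)
  show ?thesis unfolding e 4 by (simp add: 3 algebra_simps)
qed

lemma sum_reindex_le_sqnorm:
  assumes "f \<in> ell2" "inj k" "finite F"
  shows "(\<Sum>j\<in>F. (norm (f (k j)))\<^sup>2) \<le> sqnorm f"
proof -
  have "(\<Sum>j\<in>F. (norm (f (k j)))\<^sup>2) = (\<Sum>p\<in>k ` F. (norm (f p))\<^sup>2)"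
    by (subst sum.reindex[OF inj_on_subset[OF assms(2)]]) auto
  also have "\<dots> \<le> sqnorm f" using assms by (intro ell2_finite_le) auto
  finally show ?thesis .
qed

lemma ell2_reindex_inj: "f \<in> ell2 \<Longrightarrow> inj k \<Longrightarrow> (\<lambda>i. f (k i)) \<in> ell2"
  by (rule ell2_I_bounded) (rule sum_reindex_le_sqnorm)

lemma ell2_extend_inj:
  assumes "f \<in> ell2" "inj k" "\<And>i. g (k i) = f i" "\<And>p. p \<notin> range k \<Longrightarrow> g p = 0"
  shows "g \<in> ell2"
proof -
  have "(\<lambda>p. (norm (g p))\<^sup>2) summable_on range k"
    using assms(1) unfolding ell2_def
    by (subst summable_on_reindex[OF assms(2)]) (simp add: o_def assms(3))
  thus ?thesis unfolding ell2_def mem_Collect_eq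
    by (rule summable_on_cong_neutral[THEN iffD1, rotated 3]) (auto simp: assms(4))
qed

lemma ip_extend_inj:
  assumes "inj k" "\<And>i. g (k i) = f i" "\<And>p. p \<notin> range k \<Longrightarrow> g p = 0"
  shows "ip g h = ip f (\<lambda>i. h (k i))"
proof -
  have "ip g h = (\<Sum>\<^sub>\<infinity>p\<in>range k. g p * cnj (h p))"
    unfolding ip_def by (rule infsum_cong_neutral) (auto simp: assms(3))
  also have "\<dots> = (\<Sum>\<^sub>\<infinity>i. f i * cnj (h (k i)))"
    by (subst infsum_reindex[OF assms(1)]) (simp add: o_def assms(2))
  finally show ?thesis by (simp add: ip_def)
qed

definition restrict_seq :: "'i set \<Rightarrow> ('i \<Rightarrow> complex) \<Rightarrow> 'i \<Rightarrow> complex" where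
  "restrict_seq F x i = (if i \<in> F then x i else 0)"

lemma ell2_restrict: "x \<in> ell2 \<Longrightarrow> restrict_seq F x \<in> ell2"
  unfolding ell2_def mem_Collect_eq restrict_seq_def
  by (erule summable_on_comparison_test) auto

lemma sqnorm_restrict_compl:
  assumes "x \<in> ell2" "finite F"
  shows "sqnorm (\<lambda>i. x i - restrict_seq F x i) = sqnorm x - (\<Sum>i\<in>F. (norm (x i))\<^sup>2)"
proof -
  have 1: "sqnorm (\<lambda>i. x i - restrict_seq F x i) = (\<Sum>\<^sub>\<infinity>i\<in>-F. (norm (x i))\<^sup>2)"
    unfolding sqnorm_def by (rule infsum_cong_neutral) (auto simp: restrict_seq_def)
  have s: "(\<lambda>i. (norm (x i))\<^sup>2) summable_on UNIV" using assms by (simp add: ell2_def)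
  have "sqnorm x = (\<Sum>\<^sub>\<infinity>i\<in>F \<union> -F. (norm (x i))\<^sup>2)" by (simp add: sqnorm_def)
  also have "\<dots> = (\<Sum>\<^sub>\<infinity>i\<in>F. (norm (x i))\<^sup>2) + (\<Sum>\<^sub>\<infinity>i\<in>-F. (norm (x i))\<^sup>2)"
    by (rule infsum_Un_disjoint) (use assms s summable_on_subset in auto)
  finally show ?thesis using assms 1 by simp
qed

lemma ell2_small_remainder:
  assumes "x \<in> ell2" "e > 0"
  obtains F where "finite F" "sqnorm (\<lambda>i. x i - restrict_seq F x i) < e"
proof -
  have s: "(\<lambda>i. (norm (x i))\<^sup>2) summable_on UNIV" using assms by (simp add: ell2_def)
  obtain F where F: "finite F" "F \<subseteq> UNIV" "dist (sum (\<lambda>i. (norm (x i))\<^sup>2) F) (sqnorm x) \<le> e/2"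
    using infsum_finite_approximation[OF s, of "e/2"] assms(2) unfolding sqnorm_def by auto
  have "sqnorm x - (\<Sum>i\<in>F. (norm (x i))\<^sup>2) \<le> e/2"
    using F(3) unfolding dist_real_def by linarith
  with that[OF F(1)] sqnorm_restrict_compl[OF assms(1) F(1)] assms(2) show ?thesis by simp
qed

section \<open>Column-finite orthonormal families\<close>

text \<open>The vectors \<open>v m\<close> will be the coefficient sequences of the products of an inner function \<open>\<theta>\<close> with the monomials. Multiplication by
\<open>\<theta>\<close> then is the map \<open>synth\<close> below, an isometry whose adjoint is \<open>analysis\<close>, and the projection onto the complement
of its range is \<open>1 - synth \<circ> analysis\<close>. As only finitely many
\<open>v m\<close> charge a given coordinate, \<open>synth\<close> is defined pointwise by finite sums.\<close>
locale column_finite_orthonormal =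
  fixes v :: "'i \<Rightarrow> 'i \<Rightarrow> complex"
  assumes v_ell2: "\<And>m. v m \<in> ell2"
    and v_orthonormal: "\<And>m n. ip (v m) (v n) = (if m = n then 1 else 0)"
    and v_column_finite: "\<And>i. finite {m. v m i \<noteq> 0}"
begin

definition synth :: "('i \<Rightarrow> complex) \<Rightarrow> 'i \<Rightarrow> complex" where
  "synth x i = (\<Sum>m | v m i \<noteq> 0. x m * v m i)"

definition analysis :: "('i \<Rightarrow> complex) \<Rightarrow> 'i \<Rightarrow> complex" where
  "analysis y m = ip y (v m)"

definition proj_compl :: "('i \<Rightarrow> complex) \<Rightarrow> 'i \<Rightarrow> complex" where
  "proj_compl y i = y i - synth (analysis y) i"

definition compl :: "('i \<Rightarrow> complex) set" where
  "compl = {f \<in> ell2. \<forall>m. ip f (v m) = 0}"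

lemma synth_superset:
  assumes "finite G" "\<And>m. m \<notin> G \<Longrightarrow> x m * v m i = 0"
  shows "synth x i = (\<Sum>m\<in>G. x m * v m i)"
  unfolding synth_def using v_column_finite[of i] assms
  by (intro sum.mono_neutral_cong) auto

lemma synth_finite:
  assumes "finite F" "\<And>m. m \<notin> F \<Longrightarrow> x m = 0"
  shows "synth x = (\<lambda>i. \<Sum>m\<in>F. x m * v m i)"
  by (rule ext, rule synth_superset) (use assms in auto)

lemma synth_unit: "synth (unit_seq m) = v m"
  by (subst synth_finite[of "{m}"]) (auto simp: unit_seq_def)

lemma synth_zero [simp]: "synth (\<lambda>i. 0) = (\<lambda>i. 0)"
  by (simp add: synth_def fun_eq_iff)

lemma analysis_zero [simp]: "analysis (\<lambda>i. 0) = (\<lambda>i. 0)"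
  by (simp add: analysis_def fun_eq_iff)

lemma ip_finite_combination:
  assumes "finite F" "n \<in> F"
  shows "ip (\<lambda>i. \<Sum>m\<in>F. x m * v m i) (v n) = x n"
proof -
  have "ip (\<lambda>i. \<Sum>m\<in>F. x m * v m i) (v n) = (\<Sum>m\<in>F. x m * ip (v m) (v n))"
    by (subst ip_sum_left) (auto intro: ell2_scale v_ell2 simp: ip_scale_left)
  thus ?thesis using assms by (simp add: v_orthonormal if_distrib[of "(*) _"] cong: if_cong)
qed

lemma sqnorm_finite_combination:
  assumes "finite F"
  shows "sqnorm (\<lambda>i. \<Sum>m\<in>F. x m * v m i) = (\<Sum>m\<in>F. (norm (x m))\<^sup>2)"
proof -
  let ?g = "\<lambda>i. \<Sum>m\<in>F. x m * v m i"
  have l: "?g \<in> ell2" by (intro ell2_sum ell2_scale v_ell2)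
  have "ip ?g ?g = (\<Sum>n\<in>F. cnj (x n) * ip ?g (v n))"
    by (subst ip_sum_right[OF _ l]) (auto intro: ell2_scale v_ell2 simp: ip_scale_right)
  also have "\<dots> = (\<Sum>n\<in>F. cnj (x n) * x n)"
    using ip_finite_combination[OF assms] by (intro sum.cong) auto
  also have "\<dots> = of_real (\<Sum>m\<in>F. (norm (x m))\<^sup>2)"
    unfolding of_real_sum complex_norm_square by (simp add: mult.commute)
  finally show ?thesis unfolding ip_self of_real_eq_iff .
qed

text \<open>Bessel's inequality. It follows from the Cauchy-Schwarz inequality for \<open>y\<close> and the partial sum
\<open>\<Sum>m\<in>F. analysis y m * v m\<close>: their inner product and the squared norm of the sum both equal the left-hand side.\<close>
lemma bessel:
  assumes y: "y \<in> ell2" and F: "finite F"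
  shows "(\<Sum>m\<in>F. (norm (analysis y m))\<^sup>2) \<le> sqnorm y"
proof -
  let ?g = "\<lambda>i. \<Sum>m\<in>F. analysis y m * v m i"
  have l: "?g \<in> ell2" by (intro ell2_sum ell2_scale v_ell2)
  have "ip y ?g = (\<Sum>m\<in>F. cnj (analysis y m) * analysis y m)"
    by (subst ip_sum_right) (auto intro: ell2_scale v_ell2 y simp: ip_scale_right analysis_def)
  also have "\<dots> = of_real (\<Sum>m\<in>F. (norm (analysis y m))\<^sup>2)"
    unfolding of_real_sum complex_norm_square by (simp add: mult.commute)
  finally have yg: "ip y ?g = of_real (\<Sum>m\<in>F. (norm (analysis y m))\<^sup>2)" .
  have "(\<Sum>m\<in>F. (norm (analysis y m))\<^sup>2)\<^sup>2 \<le> sqnorm y * (\<Sum>m\<in>F. (norm (analysis y m))\<^sup>2)"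
    using ip_Cauchy_Schwarz[OF y l] unfolding yg sqnorm_finite_combination[OF F]
    by (simp flip: of_real_power add: sum_nonneg del: of_real_sum)
  moreover have "(\<Sum>m\<in>F. (norm (analysis y m))\<^sup>2) \<ge> 0" by (simp add: sum_nonneg)
  ultimately show ?thesis using sqnorm_nonneg[of y]
    by (cases "(\<Sum>m\<in>F. (norm (analysis y m))\<^sup>2) = 0") (auto simp: power2_eq_square)
qed

lemma analysis_ell2: "y \<in> ell2 \<Longrightarrow> analysis y \<in> ell2"
  using bessel by (rule ell2_I_bounded)

text \<open>Finitely many coordinates of \<open>synth x\<close> see only finitely many coefficients of \<open>x\<close>, for which the
norm is computed by orthonormality.\<close>
lemma synth_finite_le:
  assumes x: "x \<in> ell2" and I: "finite I"
  shows "(\<Sum>i\<in>I. (norm (synth x i))\<^sup>2) \<le> sqnorm x"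
proof -
  define F where "F = (\<Union>i\<in>I. {m. v m i \<noteq> 0})"
  have F: "finite F" unfolding F_def using I v_column_finite by auto
  let ?g = "\<lambda>i. \<Sum>m\<in>F. x m * v m i"
  have l: "?g \<in> ell2" by (intro ell2_sum ell2_scale v_ell2)
  have "(\<Sum>i\<in>I. (norm (synth x i))\<^sup>2) = (\<Sum>i\<in>I. (norm (?g i))\<^sup>2)"
    by (intro sum.cong refl arg_cong[where f = "\<lambda>z. (norm z)\<^sup>2"] synth_superset F)
       (auto simp: F_def)
  also have "\<dots> \<le> sqnorm ?g" by (rule ell2_finite_le[OF l I])
  also have "\<dots> = (\<Sum>m\<in>F. (norm (x m))\<^sup>2)" by (rule sqnorm_finite_combination[OF F])
  also have "\<dots> \<le> sqnorm x" by (rule ell2_finite_le[OF x F])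
  finally show ?thesis .
qed

lemma synth_ell2: "x \<in> ell2 \<Longrightarrow> synth x \<in> ell2"
  using synth_finite_le by (rule ell2_I_bounded)

lemma sqnorm_synth_le: "x \<in> ell2 \<Longrightarrow> sqnorm (synth x) \<le> sqnorm x"
  using synth_finite_le by (rule sqnorm_le_bounded)

lemma synth_diff: "synth (\<lambda>i. x i - y i) = (\<lambda>i. synth x i - synth y i)"
  unfolding synth_def by (simp add: sum_subtractf algebra_simps)

lemma ip_synth:
  assumes x: "x \<in> ell2" and y: "y \<in> ell2"
  shows "ip (synth x) y = ip x (analysis y)"
proof -
  have fin: "ip (synth (restrict_seq F x)) y = ip (restrict_seq F x) (analysis y)" if F: "finite F" for F
  proof -
    have "ip (synth (restrict_seq F x)) y = ip (\<lambda>i. \<Sum>m\<in>F. restrict_seq F x m * v m i) y"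
      by (subst synth_finite[OF F]) (auto simp: restrict_seq_def)
    also have "\<dots> = (\<Sum>m\<in>F. restrict_seq F x m * ip (v m) y)"
      by (subst ip_sum_left) (auto intro: ell2_scale v_ell2 y simp: ip_scale_left)
    also have "\<dots> = (\<Sum>m\<in>F. restrict_seq F x m * cnj (analysis y m))"
      by (simp add: analysis_def flip: ip_commute)
    also have "\<dots> = ip (restrict_seq F x) (analysis y)"
      unfolding ip_def using F
      by (subst infsum_finite[symmetric], simp, intro infsum_cong_neutral) (auto simp: restrict_seq_def)
    finally show ?thesis .
  qed
  have ay: "analysis y \<in> ell2" by (rule analysis_ell2[OF y])
  \<comment> \<open>The two sides agree on finitely supported sequences, and both depend continuously on x.\<close>
  have "norm (ip (synth x) y - ip x (analysis y)) \<le> e" if e: "e > 0" for e :: real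
  proof -
    define M where "M = sqnorm y + sqnorm (analysis y) + 1"
    have M: "M > 0" "sqnorm y \<le> M" "sqnorm (analysis y) \<le> M" unfolding M_def using sqnorm_nonneg[of y] sqnorm_nonneg[of "analysis y"] by auto
    obtain F where F: "finite F" "sqnorm (\<lambda>i. x i - restrict_seq F x i) < e\<^sup>2 / (4 * M)"
      using ell2_small_remainder[OF x, of "e\<^sup>2 / (4 * M)"] e M by auto
    define z where "z = (\<lambda>i. x i - restrict_seq F x i)"
    have z: "z \<in> ell2" unfolding z_def by (intro ell2_diff x ell2_restrict)
    have 1: "ip (synth x) y - ip (synth (restrict_seq F x)) y = ip (synth z) y"
      unfolding z_def synth_diff by (rule ip_diff_left[symmetric]) (intro synth_ell2 x ell2_restrict y)+
    have 2: "ip x (analysis y) - ip (restrict_seq F x) (analysis y) = ip z (analysis y)"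
      unfolding z_def by (rule ip_diff_left[symmetric]) (intro ay x ell2_restrict y)+
    have sz: "sqnorm z * M \<le> (e/2)\<^sup>2" using F(2) M by (simp add: z_def field_simps)
    have "(norm (ip (synth z) y))\<^sup>2 \<le> sqnorm z * M"
      by (rule order_trans[OF ip_Cauchy_Schwarz[OF synth_ell2[OF z] y]])
         (intro mult_mono sqnorm_synth_le z M sqnorm_nonneg)
    hence n1: "norm (ip (synth z) y) \<le> e/2" using sz e by (meson power2_le_imp_le order_trans half_gt_zero less_imp_le)
    have "(norm (ip z (analysis y)))\<^sup>2 \<le> sqnorm z * M"
      by (rule order_trans[OF ip_Cauchy_Schwarz[OF z ay]])
         (intro mult_left_mono M sqnorm_nonneg)
    hence n2: "norm (ip z (analysis y)) \<le> e/2" using sz e by (meson power2_le_imp_le order_trans half_gt_zero less_imp_le)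
    have "ip (synth x) y - ip x (analysis y) = ip (synth z) y - ip z (analysis y)"
      using 1 2 fin[OF F(1)] by (simp add: algebra_simps)
    thus ?thesis using n1 n2 norm_triangle_ineq4[of "ip (synth z) y" "ip z (analysis y)"] by simp
  qed
  hence "norm (ip (synth x) y - ip x (analysis y)) \<le> 0" by (rule field_le_epsilon) simp
  thus ?thesis by simp
qed

lemma analysis_synth: assumes "x \<in> ell2" shows "analysis (synth x) = x"
proof
  fix m
  have "analysis (v m) = unit_seq m"
    by (rule ext) (auto simp: analysis_def v_orthonormal unit_seq_def)
  thus "analysis (synth x) m = x m"
    using ip_synth[OF assms v_ell2[of m]] unfolding analysis_def[of "synth x"] by simp
qed

lemma compl_iff_analysis: "f \<in> compl \<longleftrightarrow> f \<in> ell2 \<and> analysis f = (\<lambda>m. 0)"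
  by (auto simp: compl_def analysis_def fun_eq_iff)

lemma compl_ortho_synth: "f \<in> compl \<Longrightarrow> x \<in> ell2 \<Longrightarrow> ip f (synth x) = 0"
  unfolding ip_commute[of f "synth x"] by (simp add: compl_iff_analysis ip_synth)

lemma compl_iff_synth: "f \<in> compl \<longleftrightarrow> f \<in> ell2 \<and> (\<forall>x\<in>ell2. ip f (synth x) = 0)"
proof safe
  assume f: "f \<in> ell2" "\<forall>x\<in>ell2. ip f (synth x) = 0"
  have "ip f (v m) = 0" for m
    using f(2) ell2_unit[of m] synth_unit[of m] by metis
  thus "f \<in> compl" using f(1) by (simp add: compl_def)
qed (auto simp: compl_def intro: compl_ortho_synth[unfolded compl_def])

text \<open>Because \<open>analysis\<close> inverts \<open>synth\<close> from the left, subtracting \<open>synth (analysis y)\<close> removes all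
coefficients of \<open>y\<close>.\<close>
lemma proj_compl_in: assumes "y \<in> ell2" shows "proj_compl y \<in> compl"
proof -
  have l: "synth (analysis y) \<in> ell2" by (intro synth_ell2 analysis_ell2 assms)
  have "analysis (proj_compl y) m = analysis y m - analysis (synth (analysis y)) m" for m
    unfolding analysis_def[of "proj_compl y"] analysis_def[of _ m] proj_compl_def ip_diff_left[OF assms l v_ell2] ..
  thus ?thesis using ell2_diff[OF assms l] unfolding compl_iff_analysis
    by (auto simp: analysis_synth[OF analysis_ell2[OF assms]] proj_compl_def[abs_def])
qed

lemma ip_proj_compl: assumes "y \<in> ell2" "f \<in> compl" shows "ip (proj_compl y) f = ip y f"
proof -
  have l: "synth (analysis y) \<in> ell2" by (intro synth_ell2 analysis_ell2 assms)
  have f: "f \<in> ell2" using assms by (simp add: compl_def)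
  have "ip (synth (analysis y)) f = 0"
    unfolding ip_commute[of "synth (analysis y)" f]
    by (simp add: compl_ortho_synth[OF assms(2) analysis_ell2[OF assms(1)]])
  thus ?thesis unfolding proj_compl_def ip_diff_left[OF assms(1) l f] by simp
qed

lemma proj_compl_eq: "y \<in> compl \<Longrightarrow> proj_compl y = y"
  by (simp add: proj_compl_def[abs_def] compl_iff_analysis)

lemma synth_scale: "synth (\<lambda>i. c * x i) = (\<lambda>i. c * synth x i)"
  unfolding synth_def by (simp add: sum_distrib_left mult.assoc)

lemma compl_ell2: "x \<in> compl \<Longrightarrow> x \<in> ell2"
  by (simp add: compl_def)

lemma compl_diff: "x \<in> compl \<Longrightarrow> y \<in> compl \<Longrightarrow> (\<lambda>i. x i - y i) \<in> compl"
  unfolding compl_def by (auto simp: ell2_diff ip_diff_left v_ell2)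

lemma compl_add: "x \<in> compl \<Longrightarrow> y \<in> compl \<Longrightarrow> (\<lambda>i. x i + y i) \<in> compl"
  unfolding compl_def by (auto simp: ell2_add ip_add_left v_ell2)

lemma compl_scale: "x \<in> compl \<Longrightarrow> (\<lambda>i. c * x i) \<in> compl"
  unfolding compl_def by (auto simp: ell2_scale ip_scale_left)

lemma compl_closed:
  assumes x: "\<And>n. x n \<in> compl" and y: "y \<in> ell2"
    and lim: "(\<lambda>n. sqrt (sqnorm (\<lambda>i. x n i - y i))) \<longlonglongrightarrow> 0"
  shows "y \<in> compl"
proof -
  have "ip y (v m) = 0" for m
  proof -
    have d: "(\<lambda>i. x n i - y i) \<in> ell2" for n by (intro ell2_diff compl_ell2 x y)
    have "norm (ip y (v m)) \<le> sqrt (sqnorm (\<lambda>i. x n i - y i))" for n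
    proof -
      have "ip (\<lambda>i. x n i - y i) (v m) = - ip y (v m)"
        using ip_diff_left[OF compl_ell2[OF x] y v_ell2, of n m] x[of n] by (simp add: compl_def)
      hence "(norm (ip y (v m)))\<^sup>2 \<le> sqnorm (\<lambda>i. x n i - y i) * sqnorm (v m)"
        using ip_Cauchy_Schwarz[OF d v_ell2, of n m] by simp
      also have "sqnorm (v m) = 1"
        using v_orthonormal[of m m] by (simp add: ip_self)
      finally show ?thesis by (intro real_le_rsqrt) simp
    qed
    hence "norm (ip y (v m)) \<le> 0" by (intro LIMSEQ_le_const[OF lim]) auto
    thus ?thesis by simp
  qed
  thus ?thesis using y by (simp add: compl_def)
qed

end

section \<open>Shifts, tensor products and inner sequences\<close>

definition shift :: "nat \<Rightarrow> (nat \<Rightarrow> complex) \<Rightarrow> nat \<Rightarrow> complex" where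
  "shift m c i = (if m \<le> i then c (i - m) else 0)"

definition unshift :: "(nat \<Rightarrow> complex) \<Rightarrow> nat \<Rightarrow> complex" where
  "unshift c i = c (Suc i)"

definition tensor :: "('i \<Rightarrow> complex) \<Rightarrow> ('j \<Rightarrow> complex) \<Rightarrow> 'i \<times> 'j \<Rightarrow> complex" where
  "tensor g h = (\<lambda>(i, j). g i * h j)"

definition row :: "('i \<times> 'j \<Rightarrow> complex) \<Rightarrow> 'i \<Rightarrow> 'j \<Rightarrow> complex" where
  "row f i = (\<lambda>j. f (i, j))"

text \<open>The coefficient sequence of an inner function \<open>\<theta>\<close>: the functions \<open>w\<^sup>m \<theta>\<close> are orthonormal in \<open>H\<^sup>2\<close> of
the disc.\<close>
definition inner_seq :: "(nat \<Rightarrow> complex) \<Rightarrow> bool" where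
  "inner_seq c \<longleftrightarrow> c \<in> ell2 \<and> (\<forall>m n. ip (shift m c) (shift n c) = (if m = n then 1 else 0))"

lemma ip_unit_left [simp]: "ip (unit_seq m) b = cnj (b m)"
  unfolding ip_commute[of "unit_seq m" b] by simp

lemma shift_0 [simp]: "shift 0 c = c"
  by (rule ext) (simp add: shift_def)

lemma shift_unit: "shift m (\<lambda>i. a * unit_seq p i) = (\<lambda>i. a * unit_seq (m + p) i)"
  by (rule ext) (auto simp: shift_def unit_seq_def)

lemma shift_range_add: "j \<notin> range (\<lambda>i. i + m) \<Longrightarrow> shift m c j = 0"
  unfolding shift_def by (auto simp: image_iff) (metis le_add_diff_inverse2)

lemma ell2_shift: assumes "c \<in> ell2" shows "shift m c \<in> ell2"
proof (rule ell2_extend_inj[OF assms])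
  show "inj (\<lambda>i. i + m)" by (simp add: inj_on_def)
  show "shift m c (i + m) = c i" for i by (simp add: shift_def)
qed (rule shift_range_add)

lemma ell2_unshift: "c \<in> ell2 \<Longrightarrow> unshift c \<in> ell2"
  unfolding unshift_def[abs_def] by (rule ell2_reindex_inj) simp_all

lemma ip_shift_left: "ip (shift 1 g) h = ip g (unshift h)"
proof -
  have "ip (shift 1 g) h = ip g (\<lambda>i. h (i + 1))"
  proof (rule ip_extend_inj)
    show "shift 1 g (i + 1) = g i" for i by (simp add: shift_def)
  qed (simp_all add: shift_range_add)
  thus ?thesis by (simp add: unshift_def[abs_def])
qed

lemma ip_unshift_left: "ip (unshift g) h = ip g (shift 1 h)"
  unfolding ip_commute[of "unshift g" h] ip_shift_left[symmetric] by (rule ip_commute[symmetric])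

lemma unshift_shift [simp]: "unshift (shift (Suc m) c) = shift m c"
  by (rule ext) (simp add: unshift_def shift_def)

lemma shift_1_shift: "shift 1 (shift m c) = shift (Suc m) c"
  by (rule ext) (auto simp: shift_def)

lemma ell2_I_rectangles:
  assumes "\<And>I J. finite I \<Longrightarrow> finite J \<Longrightarrow> (\<Sum>q\<in>I \<times> J. (norm (a q))\<^sup>2) \<le> C"
  shows "a \<in> ell2"
proof (rule ell2_I_bounded)
  fix F :: "('a \<times> 'b) set" assume F: "finite F"
  have "(\<Sum>q\<in>F. (norm (a q))\<^sup>2) \<le> (\<Sum>q\<in>fst ` F \<times> snd ` F. (norm (a q))\<^sup>2)"
    using F by (intro sum_mono2) (auto intro: rev_image_eqI)
  also have "\<dots> \<le> C" using F by (intro assms) auto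
  finally show "(\<Sum>q\<in>F. (norm (a q))\<^sup>2) \<le> C" .
qed

lemma ell2_tensor: assumes "g \<in> ell2" "h \<in> ell2" shows "tensor g h \<in> ell2"
proof (rule ell2_I_rectangles)
  fix I :: "'a set" and J :: "'b set" assume f: "finite I" "finite J"
  have "(\<Sum>p\<in>I \<times> J. (norm (tensor g h p))\<^sup>2) = (\<Sum>i\<in>I. (norm (g i))\<^sup>2) * (\<Sum>j\<in>J. (norm (h j))\<^sup>2)"
    unfolding sum_product sum.cartesian_product
    by (intro sum.cong) (auto simp: tensor_def norm_mult power_mult_distrib)
  also have "\<dots> \<le> sqnorm g * sqnorm h"
    using f by (intro mult_mono ell2_finite_le assms sqnorm_nonneg sum_nonneg) auto
  finally show "(\<Sum>p\<in>I \<times> J. (norm (tensor g h p))\<^sup>2) \<le> sqnorm g * sqnorm h" .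
qed

lemma ip_tensor:
  assumes "g \<in> ell2" "h \<in> ell2" "g' \<in> ell2" "h' \<in> ell2"
  shows "ip (tensor g h) (tensor g' h') = ip g g' * ip h h'"
proof -
  have e: "tensor g h p * cnj (tensor g' h' p) = (case p of (i, j) \<Rightarrow> (g i * cnj (g' i)) * (h j * cnj (h' j)))" for p
    by (cases p) (simp add: tensor_def)
  have s: "(\<lambda>(i, j). (g i * cnj (g' i)) * (h j * cnj (h' j))) summable_on UNIV \<times> UNIV"
    using ell2_summable_ip[OF ell2_tensor[OF assms(1,2)] ell2_tensor[OF assms(3,4)]] by (simp add: e)
  have "ip (tensor g h) (tensor g' h') = (\<Sum>\<^sub>\<infinity>i. \<Sum>\<^sub>\<infinity>j. (g i * cnj (g' i)) * (h j * cnj (h' j)))"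
    unfolding ip_def e UNIV_Times_UNIV[symmetric] by (rule infsum_Sigma'_banach[OF s, symmetric])
  thus ?thesis by (simp add: ip_def infsum_cmult_right' infsum_cmult_left')
qed

text \<open>A tensor supported on one row tests only that row; this is what later decouples the rows.\<close>
lemma ip_tensor_unit: "ip f (tensor (\<lambda>i. a * unit_seq m i) h) = cnj a * ip (row f m) h"
proof -
  have "ip f (tensor (\<lambda>i. a * unit_seq m i) h) =
      (\<Sum>\<^sub>\<infinity>p\<in>range (Pair m). f p * cnj (tensor (\<lambda>i. a * unit_seq m i) h p))"
    unfolding ip_def by (rule infsum_cong_neutral) (auto simp: tensor_def unit_seq_def image_iff)
  also have "\<dots> = (\<Sum>\<^sub>\<infinity>j. cnj a * (f (m, j) * cnj (h j)))"
    by (subst infsum_reindex) (auto simp: inj_on_def o_def tensor_def unit_seq_def mult_ac)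
  finally show ?thesis by (simp add: ip_def row_def infsum_cmult_right')
qed

lemma ell2_row: "f \<in> ell2 \<Longrightarrow> row f i \<in> ell2"
  unfolding row_def by (rule ell2_reindex_inj) (auto simp: inj_on_def)

text \<open>The four operators on coefficients that correspond to \<open>M\<^sub>z\<close>, \<open>M\<^sub>z\<^sup>*\<close>, \<open>M\<^sub>w\<close> and \<open>M\<^sub>w\<^sup>*\<close>. Multiplication by
\<open>z = u w\<close> raises both exponents.\<close>
definition zshift :: "(nat \<times> nat \<Rightarrow> complex) \<Rightarrow> nat \<times> nat \<Rightarrow> complex" where
  "zshift f = (\<lambda>(i, j). if i = 0 \<or> j = 0 then 0 else f (i - 1, j - 1))"

definition zunshift :: "(nat \<times> nat \<Rightarrow> complex) \<Rightarrow> nat \<times> nat \<Rightarrow> complex" where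
  "zunshift f = (\<lambda>(i, j). f (Suc i, Suc j))"

definition wshift :: "(nat \<times> nat \<Rightarrow> complex) \<Rightarrow> nat \<times> nat \<Rightarrow> complex" where
  "wshift f = (\<lambda>(i, j). if j = 0 then 0 else f (i, j - 1))"

definition wunshift :: "(nat \<times> nat \<Rightarrow> complex) \<Rightarrow> nat \<times> nat \<Rightarrow> complex" where
  "wunshift f = (\<lambda>(i, j). f (i, Suc j))"

lemma inj_zw: "inj (\<lambda>(i::nat, j::nat). (Suc i, Suc j))" "inj (\<lambda>(i::'a, j::nat). (i, Suc j))"
  by (auto simp: inj_on_def)

lemma zshift_extend:
  "zshift f ((\<lambda>(i, j). (Suc i, Suc j)) p) = f p"
  "p \<notin> range (\<lambda>(i::nat, j::nat). (Suc i, Suc j)) \<Longrightarrow> zshift f p = 0"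
   apply (cases p; simp add: zshift_def)
  apply (cases p; case_tac "fst p"; case_tac "snd p"; force simp: zshift_def image_iff)
  done

lemma wshift_extend:
  "wshift f ((\<lambda>(i, j). (i, Suc j)) p) = f p"
  "p \<notin> range (\<lambda>(i::nat, j::nat). (i, Suc j)) \<Longrightarrow> wshift f p = 0"
   apply (cases p; simp add: wshift_def)
  apply (cases p; case_tac "snd p"; force simp: wshift_def image_iff)
  done

lemma zunshift_alt: "zunshift f = (\<lambda>p. f ((\<lambda>(i, j). (Suc i, Suc j)) p))"
  by (auto simp: zunshift_def)

lemma wunshift_alt: "wunshift f = (\<lambda>p. f ((\<lambda>(i, j). (i, Suc j)) p))"
  by (auto simp: wunshift_def)

lemma ell2_zshift: "f \<in> ell2 \<Longrightarrow> zshift f \<in> ell2"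
  by (erule ell2_extend_inj[OF _ inj_zw(1)]) (rule zshift_extend, assumption?)+

lemma ell2_wshift: "f \<in> ell2 \<Longrightarrow> wshift f \<in> ell2"
  by (erule ell2_extend_inj[OF _ inj_zw(2)]) (rule wshift_extend, assumption?)+

lemma ell2_zunshift: "f \<in> ell2 \<Longrightarrow> zunshift f \<in> ell2"
  unfolding zunshift_alt by (rule ell2_reindex_inj[OF _ inj_zw(1)])

lemma ell2_wunshift: "f \<in> ell2 \<Longrightarrow> wunshift f \<in> ell2"
  unfolding wunshift_alt by (rule ell2_reindex_inj[OF _ inj_zw(2)])

lemma ip_zshift: "ip (zshift f) h = ip f (zunshift h)"
  unfolding zunshift_alt by (rule ip_extend_inj[OF inj_zw(1)]) (rule zshift_extend, assumption?)+

lemma ip_wshift: "ip (wshift f) h = ip f (wunshift h)"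
  unfolding wunshift_alt by (rule ip_extend_inj[OF inj_zw(2)]) (rule wshift_extend, assumption?)+

lemma zshift_tensor: "zshift (tensor g h) = tensor (shift 1 g) (shift 1 h)"
  by (auto simp: zshift_def tensor_def shift_def)

lemma wshift_tensor: "wshift (tensor g h) = tensor g (shift 1 h)"
  by (auto simp: wshift_def tensor_def shift_def)

lemma row_tensor: "row (tensor g h) i = (\<lambda>j. g i * h j)"
  by (simp add: row_def tensor_def)

lemma row_wshift: "row (wshift f) i = shift 1 (row f i)"
  by (auto simp: wshift_def row_def shift_def)

lemma column_finite_orthonormal_shifts:
  assumes "inner_seq c"
  shows "column_finite_orthonormal (\<lambda>m. shift m c)"
proof
  show "shift m c \<in> ell2" for m using assms by (simp add: inner_seq_def ell2_shift)
  show "ip (shift m c) (shift n c) = (if m = n then 1 else 0)" for m n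
    using assms by (simp add: inner_seq_def)
  show "finite {m. shift m c i \<noteq> 0}" for i
    by (rule finite_subset[of _ "{..i}"]) (auto simp: shift_def)
qed

definition pair_shifts :: "(nat \<Rightarrow> complex) \<Rightarrow> (nat \<Rightarrow> complex) \<Rightarrow> nat \<times> nat \<Rightarrow> nat \<times> nat \<Rightarrow> complex" where
  "pair_shifts c1 c2 = (\<lambda>(m, n). tensor (shift m c1) (shift n c2))"

lemma column_finite_orthonormal_pair_shifts:
  assumes "inner_seq c1" "inner_seq c2"
  shows "column_finite_orthonormal (pair_shifts c1 c2)"
proof
  have l: "shift m c1 \<in> ell2" "shift m c2 \<in> ell2" for m
    using assms by (auto simp: inner_seq_def intro: ell2_shift)
  show "pair_shifts c1 c2 m \<in> ell2" for m
    by (cases m) (auto simp: pair_shifts_def intro: ell2_tensor l)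
  show "ip (pair_shifts c1 c2 m) (pair_shifts c1 c2 n) = (if m = n then 1 else 0)" for m n
    using assms by (cases m; cases n) (auto simp: pair_shifts_def ip_tensor l inner_seq_def)
  show "finite {m. pair_shifts c1 c2 m p \<noteq> 0}" for p
  proof (cases p)
    case (Pair i j)
    show ?thesis unfolding Pair
      by (rule finite_subset[of _ "{..i} \<times> {..j}"])
         (auto simp: pair_shifts_def shift_def tensor_def split: if_splits)
  qed
qed

section \<open>Double commutation in the sequence space\<close>

locale inner_seq_pair =
  fixes c1 c2 :: "nat \<Rightarrow> complex"
  assumes inner1: "inner_seq c1" and inner2: "inner_seq c2"

text \<open>\<open>H.compl\<close> is the quotient module in coefficients, \<open>K.compl\<close> the one-variable space \<open>H\<^sup>2 \<ominus> \<theta>2 H\<^sup>2\<close>.\<close>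
sublocale inner_seq_pair \<subseteq> H: column_finite_orthonormal "pair_shifts c1 c2"
  by (rule column_finite_orthonormal_pair_shifts[OF inner1 inner2])

sublocale inner_seq_pair \<subseteq> K: column_finite_orthonormal "\<lambda>n. shift n c2"
  by (rule column_finite_orthonormal_shifts[OF inner2])

context inner_seq_pair
begin

definition seq_doubly_commuting :: bool where
  "seq_doubly_commuting \<longleftrightarrow>
     (\<forall>f\<in>H.compl. zunshift (H.proj_compl (wshift f)) = H.proj_compl (wshift (zunshift f)))"

lemma c_ell2: "c1 \<in> ell2" "c2 \<in> ell2"
  using inner1 inner2 by (auto simp: inner_seq_def)

lemma wshift_pair_shifts: "wshift (pair_shifts c1 c2 (m, n)) = pair_shifts c1 c2 (m, Suc n)"
  by (simp add: pair_shifts_def wshift_tensor shift_1_shift[unfolded One_nat_def])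

lemma zshift_pair_shifts: "zshift (pair_shifts c1 c2 (m, n)) = pair_shifts c1 c2 (Suc m, Suc n)"
  by (simp add: pair_shifts_def zshift_tensor shift_1_shift[unfolded One_nat_def])

lemma compl_zunshift: "f \<in> H.compl \<Longrightarrow> zunshift f \<in> H.compl"
  unfolding H.compl_def
  by (auto simp: ell2_zunshift ip_commute[of "zunshift f"] zshift_pair_shifts ip_commute[of f] simp flip: ip_zshift)

lemma compl_wunshift: "f \<in> H.compl \<Longrightarrow> wunshift f \<in> H.compl"
  unfolding H.compl_def
  by (auto simp: ell2_wunshift ip_commute[of "wunshift f"] wshift_pair_shifts ip_commute[of f] simp flip: ip_wshift)

text \<open>The vector \<open>unshift c1\<close>, i.e. \<open>(\<theta>1 - \<theta>1(0))/u\<close>, is orthogonal to all \<open>u\<^sup>m \<theta>1\<close>, because moving the backward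
shift to the other side turns this into \<open>\<theta>1 \<bottom> u\<^bsup>m + 1\<^esup> \<theta>1\<close>. A tensor with such a left factor is in the
quotient module whatever its right factor.\<close>
lemma tensor_unshift_compl:
  assumes h: "h \<in> ell2"
  shows "tensor (unshift c1) h \<in> H.compl"
proof -
  have l: "unshift c1 \<in> ell2" "shift m c1 \<in> ell2" "shift n c2 \<in> ell2" for m n
    using c_ell2 by (auto intro: ell2_unshift ell2_shift)
  have "ip (unshift c1) (shift m c1) = 0" for m
  proof -
    have "ip (unshift c1) (shift m c1) = ip (shift 0 c1) (shift (Suc m) c1)"
      by (simp add: ip_unshift_left shift_1_shift[unfolded One_nat_def])
    also have "\<dots> = 0" using inner1 unfolding inner_seq_def by (metis nat.distinct(1))
    finally show ?thesis .
  qed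
  thus ?thesis unfolding H.compl_def
    by (auto simp: pair_shifts_def ip_tensor l h intro: ell2_tensor)
qed

text \<open>The test vector has only the exponent \<open>0\<close> in \<open>w\<close>, so the adjoint of \<open>M\<^sub>z\<close> annihilates it; on the other
side of the commutation relation the projection does nothing, and what remains is the twofold backward shift of \<open>c1\<close>.\<close>
lemma seq_doubly_commuting_imp_c1_affine:
  assumes seq_doubly_commuting
  shows "c1 (Suc (Suc i)) = 0"
proof -
  let ?f = "tensor (unshift c1) (unit_seq 0)"
  have f: "?f \<in> H.compl" "wshift ?f \<in> H.compl"
    unfolding wshift_tensor by (intro tensor_unshift_compl ell2_shift ell2_unit)+
  have 1: "zunshift ?f = (\<lambda>p. 0)" by (auto simp: zunshift_def tensor_def unit_seq_def)
  have 2: "wshift (\<lambda>p. 0) = (\<lambda>p. 0)" by (auto simp: wshift_def)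
  have "zunshift (wshift ?f) = zunshift (H.proj_compl (wshift ?f))"
    by (simp only: H.proj_compl_eq[OF f(2)])
  also have "\<dots> = H.proj_compl (wshift (zunshift ?f))"
    using assms f(1) by (auto simp: seq_doubly_commuting_def)
  also have "\<dots> = (\<lambda>p. 0)" by (simp add: 1 2 H.proj_compl_def[abs_def])
  finally have "zunshift (wshift ?f) (i, 0) = 0" by simp
  thus ?thesis by (simp add: zunshift_def wshift_def tensor_def unit_seq_def unshift_def)
qed

end

lemma ip_finite_sum:
  assumes "finite F" "\<And>i. i \<notin> F \<Longrightarrow> a i * cnj (b i) = 0"
  shows "ip a b = (\<Sum>i\<in>F. a i * cnj (b i))"
  unfolding ip_def using assms by (subst infsum_finite[symmetric], simp, intro infsum_cong_neutral) auto

lemma inner_seq_sqnorm: "inner_seq c \<Longrightarrow> sqnorm c = 1"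
  unfolding inner_seq_def by (metis ip_self of_real_eq_1_iff shift_0)

text \<open>If \<open>\<theta> = c\<^sub>0 + c\<^sub>1 w\<close>, then \<open>\<theta> \<bottom> w \<theta>\<close> says \<open>c\<^sub>1 cnj c\<^sub>0 = 0\<close>.\<close>
lemma inner_seq_affine:
  assumes c: "inner_seq c" and 0: "\<And>i. c (Suc (Suc i)) = 0"
  obtains p a where "p \<le> 1" "norm a = 1" "c = (\<lambda>i. a * unit_seq p i)"
proof -
  have z: "c i = 0" if "i \<notin> {0, 1}" for i using that 0[of "i - 2"]
    by (cases i; cases "i - 1") auto
  have "ip (unshift c) (shift 0 c) = ip (shift 0 c) (shift 1 c)"
    by (simp add: ip_unshift_left)
  also have "\<dots> = 0" using c unfolding inner_seq_def by (metis zero_neq_one)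
  finally have p: "c 1 * cnj (c 0) = 0"
    by (subst (asm) ip_finite_sum[of "{0}"]) (use 0 in \<open>auto simp: unshift_def gr0_conv_Suc\<close>)
  have unimodular: "norm x = 1" if "x * cnj x = 1" for x :: complex
    using that complex_norm_square[of x] norm_ge_zero[of x]
    by (auto simp: power2_eq_1_iff simp flip: of_real_power simp del: of_real_power)
  have "ip c c = 1" using inner_seq_sqnorm[OF c] by (simp add: ip_self)
  hence n: "c 0 * cnj (c 0) + c 1 * cnj (c 1) = 1"
    by (subst (asm) ip_finite_sum[of "{0,1}"]) (use z in auto)
  show thesis
  proof (cases "c 0 = 0")
    case True
    hence "c 1 * cnj (c 1) = 1" using n by simp
    hence "norm (c 1) = 1" by (rule unimodular)
    moreover have "c i = c 1 * unit_seq 1 i" for i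
      using True z by (cases "i = 0") (auto simp: unit_seq_def)
    hence "c = (\<lambda>i. c 1 * unit_seq 1 i)" ..
    ultimately show ?thesis using that[of 1 "c 1"] by simp
  next
    case False
    hence 1: "c 1 = 0" using p by simp
    hence "c 0 * cnj (c 0) = 1" using n by simp
    hence "norm (c 0) = 1" by (rule unimodular)
    moreover have "c i = c 0 * unit_seq 0 i" for i
      using 1 z by (cases "i = 1") (auto simp: unit_seq_def)
    hence "c = (\<lambda>i. c 0 * unit_seq 0 i)" ..
    ultimately show ?thesis using that[of 0 "c 0"] by simp
  qed
qed

context inner_seq_pair
begin

text \<open>For \<open>h\<close> in \<open>K\<close> the shifted \<open>w h\<close> is orthogonal to \<open>w\<^sup>n \<theta>2\<close> for \<open>n \<ge> 1\<close>, so that projecting it subtracts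
only a multiple of \<open>\<theta>2\<close>; the multiple is \<open>\<langle>w h, \<theta>2\<rangle> = \<langle>h, unshift c2\<rangle>\<close>.\<close>
lemma K_proj_compl_shift:
  assumes h: "h \<in> K.compl"
  shows "K.proj_compl (shift 1 h) (Suc j) = h j - ip h (unshift c2) * c2 (Suc j)"
proof -
  have "K.analysis (shift 1 h) n = ip h (unshift c2) * unit_seq 0 n" for n
    using h by (cases n) (auto simp: K.analysis_def ip_shift_left[unfolded One_nat_def] unit_seq_def K.compl_def)
  hence "K.analysis (shift 1 h) = (\<lambda>n. ip h (unshift c2) * unit_seq 0 n)" by auto
  thus ?thesis by (simp add: K.proj_compl_def K.synth_scale K.synth_unit) (simp add: shift_def)
qed

text \<open>The argument is \<open>h - h(0)\<close>, that is \<open>B B\<^sup>* h\<close>; modulo \<open>K\<close> it is the constant \<open>- h(0)\<close>, which is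
orthogonal to \<open>w\<^sup>n \<theta>2\<close> for all \<open>n \<ge> 1\<close>.\<close>
lemma K_proj_compl_tail:
  assumes h: "h \<in> K.compl"
  shows "K.proj_compl (\<lambda>j. h j - h 0 * unit_seq 0 j) j = h j - h 0 * (unit_seq 0 j - cnj (c2 0) * c2 j)"
proof -
  have l: "h \<in> ell2" "(\<lambda>j. h 0 * unit_seq 0 j) \<in> ell2"
    using h by (auto simp: K.compl_def intro: ell2_scale ell2_unit)
  have "K.analysis (\<lambda>j. h j - h 0 * unit_seq 0 j) n = - (h 0 * cnj (c2 0)) * unit_seq 0 n" for n
    unfolding K.analysis_def ip_diff_left[OF l K.v_ell2] ip_scale_left ip_unit_left
    using h by (auto simp: K.compl_def shift_def unit_seq_def)
  hence "K.analysis (\<lambda>j. h j - h 0 * unit_seq 0 j) = (\<lambda>n. - (h 0 * cnj (c2 0)) * unit_seq 0 n)" by auto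
  thus ?thesis by (simp only: K.proj_compl_def K.synth_scale K.synth_unit) (simp add: algebra_simps)
qed

end

text \<open>The situation \<open>\<theta>1 = a u\<^sup>p\<close>, the only one in which double commutation can hold.\<close>
locale monomial_inner_seq_pair = inner_seq_pair +
  fixes p :: nat and a :: complex
  assumes monomial: "c1 = (\<lambda>i. a * unit_seq p i)" and unimodular: "norm a = 1" and degree: "p \<le> 1"
begin

lemma a_cnj: "a * cnj a = 1" "cnj a * a = 1"
  by (rule unimodular_cnj[OF unimodular])+

lemma pair_shifts_eq: "pair_shifts c1 c2 (m, n) = tensor (\<lambda>i. a * unit_seq (m + p) i) (shift n c2)"
  by (simp add: pair_shifts_def monomial shift_unit)

lemma H_analysis: "H.analysis y (m, n) = cnj a * K.analysis (row y (m + p)) n"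
  by (simp add: H.analysis_def K.analysis_def pair_shifts_eq ip_tensor_unit)

lemma H_synth: "H.synth x (i, j) = (if i < p then 0 else a * K.synth (row x (i - p)) j)"
proof -
  let ?N = "{n. shift n c2 j \<noteq> 0}"
  have "H.synth x (i, j) = (\<Sum>q\<in>{i - p} \<times> ?N. x q * pair_shifts c1 c2 q (i, j))"
    by (rule H.synth_superset)
       (use K.v_column_finite in \<open>auto simp: pair_shifts_eq tensor_def unit_seq_def split: if_splits\<close>)
  also have "\<dots> = (\<Sum>n\<in>?N. x (i - p, n) * pair_shifts c1 c2 (i - p, n) (i, j))"
    by (rule sum.reindex_bij_witness[of _ "Pair (i - p)" snd]) auto
  also have "\<dots> = (if i < p then 0 else a * K.synth (row x (i - p)) j)"
    by (auto simp: pair_shifts_eq tensor_def unit_seq_def K.synth_def row_def sum_distrib_left mult_ac)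
  finally show ?thesis .
qed

lemma H_proj_compl:
  "H.proj_compl y (i, j) = (if i < p then y (i, j) else K.proj_compl (row y i) j)"
proof (cases "i < p")
  case False
  have "row (H.analysis y) (i - p) = (\<lambda>n. cnj a * K.analysis (row y i) n)"
    using False by (auto simp: row_def[of "H.analysis y"] H_analysis)
  thus ?thesis using False a_cnj
    by (simp add: H.proj_compl_def K.proj_compl_def H_synth K.synth_scale mult.assoc[symmetric])
       (simp add: row_def)
qed (simp add: H.proj_compl_def H_synth)

lemma H_compl: "f \<in> H.compl \<longleftrightarrow> f \<in> ell2 \<and> (\<forall>i\<ge>p. row f i \<in> K.compl)"
proof -
  have "a \<noteq> 0" using unimodular by auto
  hence "(\<forall>m n. H.analysis f (m, n) = 0) \<longleftrightarrow> (\<forall>m n. K.analysis (row f (m + p)) n = 0)"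
    by (simp add: H_analysis)
  also have "\<dots> \<longleftrightarrow> (\<forall>i\<ge>p. \<forall>n. K.analysis (row f i) n = 0)"
    by (metis le_add2 le_add_diff_inverse2)
  finally show ?thesis
    by (auto simp: H.compl_iff_analysis K.compl_iff_analysis fun_eq_iff ell2_row)
qed

text \<open>Row \<open>i\<close> of either side of the commutation relation depends only on the row \<open>h\<close> of \<open>f\<close> with index \<open>i + 1\<close>. As
\<open>p \<le> 1\<close>, that row is always in \<open>K\<close>, whereas the projection acts on row \<open>i\<close> only if \<open>i \<ge> p\<close>; this is the source of the case
distinction. Conversely every \<open>h\<close> in \<open>K\<close> is a row of some \<open>f\<close> in the quotient module.\<close>
lemma seq_doubly_commuting_iff_rows:
  "seq_doubly_commuting \<longleftrightarrow>
     (\<forall>h\<in>K.compl. \<forall>i j. ip h (unshift c2) * c2 (Suc j) =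
        h 0 * (if i < p then unit_seq 0 j else unit_seq 0 j - cnj (c2 0) * c2 j))"
  (is "_ \<longleftrightarrow> (\<forall>h\<in>_. \<forall>i j. ?R h i j)")
proof -
  have key: "zunshift (H.proj_compl (wshift f)) (i, j) = H.proj_compl (wshift (zunshift f)) (i, j)
      \<longleftrightarrow> ?R (row f (Suc i)) i j" if f: "f \<in> H.compl" for f i j
  proof -
    define h where "h = row f (Suc i)"
    have h: "h \<in> K.compl" using f degree by (auto simp: H_compl h_def)
    have "zunshift (H.proj_compl (wshift f)) (i, j) = h j - ip h (unshift c2) * c2 (Suc j)"
      using degree K_proj_compl_shift[OF h] by (simp add: zunshift_def H_proj_compl row_wshift h_def)
    moreover have r: "row (wshift (zunshift f)) i = (\<lambda>j. h j - h 0 * unit_seq 0 j)"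
      by (auto simp: row_def wshift_def zunshift_def h_def unit_seq_def)
    hence "wshift (zunshift f) (i, j) = h j - h 0 * unit_seq 0 j" for j
      unfolding row_def by metis
    hence "H.proj_compl (wshift (zunshift f)) (i, j) =
        h j - h 0 * (if i < p then unit_seq 0 j else unit_seq 0 j - cnj (c2 0) * c2 j)"
      by (simp add: H_proj_compl r K_proj_compl_tail[OF h])
    ultimately show ?thesis by (auto simp: h_def[symmetric])
  qed
  show ?thesis
  proof
    assume dc: seq_doubly_commuting
    show "\<forall>h\<in>K.compl. \<forall>i j. ?R h i j"
    proof (intro ballI allI)
      fix h and i j :: nat assume h: "h \<in> K.compl"
      \<comment> \<open>Put \<open>h\<close> into row \<open>i + 1\<close>.\<close>
      define f where "f = tensor (unit_seq (Suc i)) h"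
      have hl: "h \<in> ell2" using h by (simp add: K.compl_def)
      have "row f k \<in> K.compl" for k
        using h by (auto simp: f_def row_tensor K.compl_def ip_scale_left intro: ell2_scale)
      hence f: "f \<in> H.compl" using hl by (auto simp: H_compl f_def intro: ell2_tensor ell2_unit)
      have "row f (Suc i) = h" by (simp add: f_def row_tensor unit_seq_def)
      with key[OF f, of i j] show "?R h i j" using dc f by (simp add: seq_doubly_commuting_def)
    qed
  next
    assume R: "\<forall>h\<in>K.compl. \<forall>i j. ?R h i j"
    show seq_doubly_commuting
      unfolding seq_doubly_commuting_def
    proof (intro ballI ext)
      fix f and q :: "nat \<times> nat" assume f: "f \<in> H.compl"
      obtain i j where q: "q = (i, j)" by (cases q)
      have "row f (Suc i) \<in> K.compl" using f degree by (auto simp: H_compl)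
      thus "zunshift (H.proj_compl (wshift f)) q = H.proj_compl (wshift (zunshift f)) q"
        using R key[OF f] by (simp add: q)
    qed
  qed
qed

end

definition const_seq :: "(nat \<Rightarrow> complex) \<Rightarrow> bool" where
  "const_seq c \<longleftrightarrow> (\<forall>n. c (Suc n) = 0)"

definition rotation_seq :: "(nat \<Rightarrow> complex) \<Rightarrow> bool" where
  "rotation_seq c \<longleftrightarrow> (\<exists>g. norm g = 1 \<and> c = (\<lambda>n. g * unit_seq 1 n))"

text \<open>Read with \<open>c\<close> as the Taylor coefficients of \<open>\<theta>\<close>, the recursion is
\<open>(\<theta> - \<theta>(0))/w = g (1 - cnj (\<theta>(0)) \<theta>)\<close>, an equation linear in \<open>\<theta>\<close> with a Moebius transformation as its solution.\<close>
definition moebius_seq :: "(nat \<Rightarrow> complex) \<Rightarrow> bool" where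
  "moebius_seq c \<longleftrightarrow> (\<exists>g. norm g = 1 \<and> (\<forall>n. c (Suc n) = g * (unit_seq 0 n - cnj (c 0) * c n)))"

context inner_seq_pair
begin

text \<open>The projection of the constant \<open>1\<close> onto \<open>K\<close>, hence its reproducing kernel at \<open>0\<close>.\<close>
definition kernel0 :: "nat \<Rightarrow> complex" where
  "kernel0 j = unit_seq 0 j - cnj (c2 0) * c2 j"

lemma kernel0_ell2: "kernel0 \<in> ell2"
  unfolding kernel0_def[abs_def] by (intro ell2_diff ell2_unit ell2_scale c_ell2)

lemma kernel0_compl: "kernel0 \<in> K.compl"
proof -
  have "ip kernel0 (shift n c2) = 0" for n
    unfolding kernel0_def[abs_def] ip_diff_left[OF ell2_unit ell2_scale[OF c_ell2(2)] K.v_ell2] ip_scale_left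
    using K.v_orthonormal[of 0 n] by (cases n) (auto simp: shift_def)
  thus ?thesis by (simp add: K.compl_def kernel0_ell2)
qed

lemma unshift_compl: "unshift c2 \<in> K.compl"
proof -
  have "ip (unshift c2) (shift n c2) = 0" for n
    using K.v_orthonormal[of 0 "Suc n"] by (simp add: ip_unshift_left shift_1_shift[unfolded One_nat_def])
  thus ?thesis using ell2_unshift c_ell2 by (simp add: K.compl_def)
qed

lemma ip_kernel0: "h \<in> K.compl \<Longrightarrow> ip h kernel0 = h 0"
  unfolding kernel0_def[abs_def] K.compl_def
  using ip_diff_right[OF ell2_unit ell2_scale[OF c_ell2(2)], of h 0 "cnj (c2 0)"]
  by (auto simp: ip_scale_right dest: spec[of _ 0])

lemma ip_unshift_self: "ip (unshift c2) (unshift c2) = kernel0 0"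
proof -
  have "shift 1 (unshift c2) = (\<lambda>n. c2 n - c2 0 * unit_seq 0 n)"
    by (rule ext) (auto simp: shift_def unshift_def unit_seq_def not_less_eq_eq)
  hence "ip (unshift c2) (unshift c2) = ip c2 (\<lambda>n. c2 n - c2 0 * unit_seq 0 n)"
    by (simp add: ip_unshift_left)
  also have "\<dots> = 1 - cnj (c2 0) * c2 0"
    unfolding ip_diff_right[OF c_ell2(2) ell2_scale[OF ell2_unit] c_ell2(2)] ip_scale_right
    using K.v_orthonormal[of 0 0] by simp
  finally show ?thesis by (simp add: kernel0_def unit_seq_def)
qed

lemma const_seq_if_kernel0: "kernel0 0 = 0 \<Longrightarrow> const_seq c2"
  using ip_unshift_self sqnorm_zero_iff[OF ell2_unshift[OF c_ell2(2)]]
  by (auto simp: ip_self const_seq_def unshift_def fun_eq_iff)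

text \<open>If \<open>\<theta>2\<close> is constant, then \<open>\<theta>2 H\<^sup>2\<close> is all of \<open>H\<^sup>2\<close> and \<open>K = 0\<close>.\<close>
lemma const_seq_compl:
  assumes "const_seq c2" "h \<in> K.compl"
  shows "h 0 = 0"
proof -
  have c: "c2 = (\<lambda>n. c2 0 * unit_seq 0 n)"
  proof
    show "c2 n = c2 0 * unit_seq 0 n" for n
      using assms(1) by (cases n) (auto simp: const_seq_def unit_seq_def)
  qed
  have "c2 0 \<noteq> 0"
  proof
    assume "c2 0 = 0"
    hence "c2 = (\<lambda>n. 0)" using c by simp
    thus False using inner_seq_sqnorm[OF inner2] by (simp add: sqnorm_def)
  qed
  moreover have "ip h c2 = cnj (c2 0) * h 0"
    by (subst c, subst ip_scale_right) simp
  moreover have "ip h c2 = 0" using assms(2) by (auto simp: K.compl_def dest: spec[of _ 0])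
  ultimately show ?thesis by simp
qed

text \<open>The equation for \<open>h = unshift c2\<close> makes \<open>unshift c2\<close> a multiple of \<open>kernel0\<close>, and the one for
\<open>h = kernel0\<close> then shows that the factor is unimodular.\<close>
lemma moebius_seq_iff:
  "(\<forall>h\<in>K.compl. \<forall>j. ip h (unshift c2) * c2 (Suc j) = h 0 * kernel0 j) \<longleftrightarrow> const_seq c2 \<or> moebius_seq c2"
proof
  assume R: "\<forall>h\<in>K.compl. \<forall>j. ip h (unshift c2) * c2 (Suc j) = h 0 * kernel0 j"
  show "const_seq c2 \<or> moebius_seq c2"
  proof (cases "kernel0 0 = 0")
    case False
    define g where "g = c2 1 / kernel0 0"
    have "kernel0 0 * c2 (Suc j) = c2 1 * kernel0 j" for j
      using R[rule_format, OF unshift_compl, of j] by (simp add: ip_unshift_self) (simp add: unshift_def)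
    hence g: "c2 (Suc j) = g * kernel0 j" for j using False by (simp add: g_def field_simps)
    have "ip kernel0 (unshift c2) = cnj (c2 1)"
      unfolding ip_commute[of kernel0] ip_kernel0[OF unshift_compl] by (simp add: unshift_def)
    hence "cnj (c2 1) * c2 1 = kernel0 0 * kernel0 0"
      using R[rule_format, OF kernel0_compl, of 0] by simp
    hence "norm (cnj (c2 1) * c2 1) = norm (kernel0 0 * kernel0 0)" by simp
    hence "norm (c2 1) = norm (kernel0 0)"
      by (simp add: norm_mult power2_eq_square[symmetric] norm_power power2_eq_iff_nonneg)
    hence "norm g = 1" using False by (simp add: g_def norm_divide)
    with g show ?thesis unfolding moebius_seq_def kernel0_def by blast
  qed (simp add: const_seq_if_kernel0)
next
  assume A: "const_seq c2 \<or> moebius_seq c2"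
  show "\<forall>h\<in>K.compl. \<forall>j. ip h (unshift c2) * c2 (Suc j) = h 0 * kernel0 j"
  proof (intro ballI allI)
    fix h j assume h: "h \<in> K.compl"
    show "ip h (unshift c2) * c2 (Suc j) = h 0 * kernel0 j"
    proof (cases "const_seq c2")
      case True
      thus ?thesis using const_seq_compl[OF True h] by (simp add: const_seq_def)
    next
      case False
      then obtain g where g: "norm g = 1" "\<And>n. c2 (Suc n) = g * kernel0 n"
        using A unfolding moebius_seq_def kernel0_def by blast
      have "unshift c2 = (\<lambda>n. g * kernel0 n)" using g(2) by (auto simp: unshift_def)
      hence "ip h (unshift c2) = cnj g * h 0" by (simp add: ip_scale_right ip_kernel0[OF h])
      moreover have "cnj g * g = 1" using g(1) by (rule unimodular_cnj)
      ultimately show ?thesis by (simp add: g(2) mult_ac)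
    qed
  qed
qed

text \<open>Comparing the two equations for \<open>h = kernel0\<close> gives \<open>kernel0 = 1\<close> unless \<open>kernel0 0 = 0\<close>.\<close>
lemma rotation_seq_iff:
  "(\<forall>h\<in>K.compl. \<forall>j. ip h (unshift c2) * c2 (Suc j) = h 0 * unit_seq 0 j) \<and>
   (\<forall>h\<in>K.compl. \<forall>j. ip h (unshift c2) * c2 (Suc j) = h 0 * kernel0 j) \<longleftrightarrow> const_seq c2 \<or> rotation_seq c2"
proof
  assume R: "(\<forall>h\<in>K.compl. \<forall>j. ip h (unshift c2) * c2 (Suc j) = h 0 * unit_seq 0 j) \<and>
   (\<forall>h\<in>K.compl. \<forall>j. ip h (unshift c2) * c2 (Suc j) = h 0 * kernel0 j)"
  have "rotation_seq c2" if nc: "\<not> const_seq c2"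
  proof -    have k: "kernel0 0 \<noteq> 0" using nc const_seq_if_kernel0 by blast
    have "kernel0 0 * unit_seq 0 j = kernel0 0 * kernel0 j" for j using R kernel0_compl by metis
    hence u: "kernel0 j = unit_seq 0 j" for j using k by simp
    have c0: "c2 0 = 0"  using u[of 0] by (simp add: kernel0_def)
    have "moebius_seq c2" using R nc moebius_seq_iff by blast
    then obtain g where "norm g = 1" "\<And>n. c2 (Suc n) = g * kernel0 n"
      unfolding moebius_seq_def kernel0_def by blast
    moreover have "c2 n = g * unit_seq 1 n" for n
      using calculation c0 by (cases n) (auto simp: u unit_seq_def)
    ultimately show ?thesis unfolding rotation_seq_def by blast
  qed
  thus "const_seq c2 \<or> rotation_seq c2" by blast
next
  assume A: "const_seq c2 \<or> rotation_seq c2"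
  have "ip h (unshift c2) * c2 (Suc j) = h 0 * unit_seq 0 j \<and>
        ip h (unshift c2) * c2 (Suc j) = h 0 * kernel0 j" if h: "h \<in> K.compl" for h j
  proof (cases "const_seq c2")
    case True
    thus ?thesis using const_seq_compl[OF True h] by (simp add: const_seq_def)
  next
    case False
    then obtain g where g: "norm g = 1" "c2 = (\<lambda>n. g * unit_seq 1 n)"
      using A unfolding rotation_seq_def by blast
    have "unshift c2 = (\<lambda>n. g * unit_seq 0 n)" by (auto simp: g(2) unshift_def unit_seq_def)
    hence "ip h (unshift c2) = cnj g * h 0" by (simp add: ip_scale_right)
    moreover have "cnj g * g = 1" using g(1) by (rule unimodular_cnj)
    moreover have "c2 (Suc j) = g * unit_seq 0 j" "kernel0 j = unit_seq 0 j"
      unfolding kernel0_def by (auto simp: g(2) unit_seq_def)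
    ultimately show ?thesis by (simp add: mult_ac)
  qed
  thus "(\<forall>h\<in>K.compl. \<forall>j. ip h (unshift c2) * c2 (Suc j) = h 0 * unit_seq 0 j) \<and>
   (\<forall>h\<in>K.compl. \<forall>j. ip h (unshift c2) * c2 (Suc j) = h 0 * kernel0 j)" by blast
qed

end

lemma inner_seq_const:
  assumes "inner_seq c" "const_seq c"
  shows "norm (c 0) = 1" "c = (\<lambda>n. c 0 * unit_seq 0 n)"
proof -
  show c: "c = (\<lambda>n. c 0 * unit_seq 0 n)"
  proof
    show "c n = c 0 * unit_seq 0 n" for n
      using assms(2) by (cases n) (auto simp: const_seq_def unit_seq_def)
  qed
  have "sqnorm c = (\<Sum>\<^sub>\<infinity>n\<in>{0}. (norm (c n))\<^sup>2)"
    unfolding sqnorm_def by (rule infsum_cong_neutral) (use assms(2) in \<open>auto simp: const_seq_def gr0_conv_Suc\<close>)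
  hence "(norm (c 0))\<^sup>2 = 1" using inner_seq_sqnorm[OF assms(1)] by simp
  thus "norm (c 0) = 1" using norm_ge_zero[of "c 0"] by (auto simp only: power2_eq_1_iff)
qed

theorem (in inner_seq_pair) seq_doubly_commuting_iff:
  "seq_doubly_commuting \<longleftrightarrow>
     const_seq c1 \<and> (const_seq c2 \<or> moebius_seq c2) \<or>
     rotation_seq c1 \<and> (const_seq c2 \<or> rotation_seq c2)"
proof -
  have const: "seq_doubly_commuting \<longleftrightarrow> const_seq c2 \<or> moebius_seq c2" if c: "const_seq c1"
  proof -
    interpret monomial_inner_seq_pair c1 c2 0 "c1 0"
      using inner_seq_const[OF inner1 c] by unfold_locales simp_all
    show ?thesis unfolding seq_doubly_commuting_iff_rows moebius_seq_iff[symmetric] kernel0_def by simp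
  qed
  have rot: "seq_doubly_commuting \<longleftrightarrow> const_seq c2 \<or> rotation_seq c2" if r: "rotation_seq c1"
  proof -
    obtain g where g: "norm g = 1" "c1 = (\<lambda>n. g * unit_seq 1 n)"
      using r unfolding rotation_seq_def by blast
    interpret monomial_inner_seq_pair c1 c2 1 g
      using g by unfold_locales simp_all
    have s: "(\<forall>i. P (if i < (1::nat) then (x::complex) else y)) \<longleftrightarrow> P x \<and> P y" for P x y
      by (metis less_numeral_extra(1) less_numeral_extra(4))
    show ?thesis unfolding seq_doubly_commuting_iff_rows rotation_seq_iff[symmetric] kernel0_def
      by (subst all_comm) (simp only: s[of "\<lambda>t. _ = _ * t"], blast)
  qed
  have "const_seq c1 \<or> rotation_seq c1" if dc: seq_doubly_commuting
  proof -
    obtain p a where pa: "p \<le> 1" "norm a = 1" "c1 = (\<lambda>i. a * unit_seq p i)"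
      using inner_seq_affine[OF inner1 seq_doubly_commuting_imp_c1_affine[OF dc]] .
    show ?thesis
    proof (cases "p = 0")
      case True thus ?thesis using pa by (simp add: const_seq_def unit_seq_def)
    next
      case False
      hence "p = 1" using pa by simp
      thus ?thesis using pa unfolding rotation_seq_def by blast
    qed
  qed
  with const rot show ?thesis by blast
qed

section \<open>Parseval's identity and inner functions\<close>

lemma has_integral_suminf:
  fixes f :: "nat \<Rightarrow> real \<Rightarrow> 'c::banach"
  assumes cont: "\<And>n. continuous_on {a..b} (f n)"
    and bound: "\<And>n t. t \<in> {a..b} \<Longrightarrow> norm (f n t) \<le> M n"
    and M: "summable M"
    and I: "\<And>n. (f n has_integral I n) {a..b}"
  shows "((\<lambda>t. \<Sum>n. f n t) has_integral (\<Sum>n. I n)) {a..b}" "summable I"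
proof -
  have u: "uniform_limit {a..b} (\<lambda>n t. \<Sum>i<n. f i t) (\<lambda>t. \<Sum>i. f i t) sequentially"
    by (rule Weierstrass_m_test[OF bound M])
  obtain J K where J: "\<And>n. ((\<lambda>t. \<Sum>i<n. f i t) has_integral J n) {a..b}"
      "((\<lambda>t. \<Sum>i. f i t) has_integral K) {a..b}" "J \<longlonglongrightarrow> K"
    by (rule uniform_limit_integral[OF u]) (auto intro!: continuous_intros cont)
  have "J n = (\<Sum>i<n. I i)" for n
    by (rule has_integral_unique[OF J(1)]) (intro has_integral_sum I, auto)
  hence "J = (\<lambda>n. \<Sum>i<n. I i)" by auto
  hence "I sums K" using J(3) by (simp add: sums_def)
  thus "summable I" "((\<lambda>t. \<Sum>n. f n t) has_integral (\<Sum>n. I n)) {a..b}"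
    using J(2) by (auto simp: sums_iff)
qed

lemma has_integral_cis_product:
  "((\<lambda>t. cis t ^ n * cnj (cis t ^ m)) has_integral (if n = m then 2 * pi else 0)) {0..2*pi}"
proof (cases "n = m")
  case True
  have "cis t ^ n * cnj (cis t ^ n) = 1" for t
    unfolding complex_norm_square[symmetric] by (simp add: norm_power)
  thus ?thesis using True has_integral_const_real[of "1::complex" 0 "2*pi"] by (simp add: scaleR_conv_of_real)
next
  case False
  define k where "k = real n - real m"
  have k: "k \<noteq> 0" using False by (simp add: k_def)
  have e: "cis t ^ n * cnj (cis t ^ m) = cis (k * t)" for t
    unfolding Complex.DeMoivre cis_cnj cis_mult by (simp add: k_def algebra_simps)
  have "((\<lambda>t. cis (k * t)) has_integral (cis (k * (2*pi)) / (\<i> * k) - cis (k * 0) / (\<i> * k))) {0..2*pi}"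
  proof (rule fundamental_theorem_of_calculus)
    fix t :: real
    have "((\<lambda>t. cis (k * t) / (\<i> * k)) has_vector_derivative (\<i> * k * cis (k * t)) / (\<i> * k)) (at t within {0..2*pi})"
      unfolding cis_conv_exp
      by (rule has_vector_derivative_real_field derivative_eq_intros refl | simp add: algebra_simps)+
    thus "((\<lambda>t. cis (k * t) / (\<i> * k)) has_vector_derivative cis (k * t)) (at t within {0..2*pi})"
      using k by simp
  qed simp
  moreover have "cis (k * (2*pi)) = 1"
  proof -
    have "cis (k * (2*pi)) = cis (2*pi*real n) / cis (2*pi*real m)"
      by (simp add: cis_divide k_def algebra_simps)
    thus ?thesis by (simp add: cis_multiple_2pi)
  qed
  ultimately show ?thesis using False unfolding e by simp
qed

text \<open>Both series converge absolutely, hence uniformly on the circle, and may be integrated term by term one after the other.\<close>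
lemma has_integral_parseval:
  fixes a b :: "nat \<Rightarrow> complex" and r :: real
  assumes r: "r \<ge> 0"
    and a: "summable (\<lambda>n. norm (a n) * r ^ n)" and b: "summable (\<lambda>n. norm (b n) * r ^ n)"
  shows "((\<lambda>t. (\<Sum>n. a n * (r * cis t) ^ n) * cnj (\<Sum>n. b n * (r * cis t) ^ n)) has_integral
           2 * pi * (\<Sum>n. a n * cnj (b n) * r ^ (2 * n))) {0..2*pi}"
proof -
  define A where "A t = (\<Sum>n. a n * (r * cis t) ^ n)" for t
  have na: "norm (a n * (r * cis t) ^ n) = norm (a n) * r ^ n" for n t
    using r by (simp add: norm_mult norm_power)
  have nb: "norm (b n * (r * cis t) ^ n) = norm (b n) * r ^ n" for n t
    using r by (simp add: norm_mult norm_power)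
  have uA: "uniform_limit {0..2*pi} (\<lambda>n t. \<Sum>i<n. a i * (r * cis t) ^ i) A sequentially"
    unfolding A_def by (rule Weierstrass_m_test[OF _ a]) (simp add: na)
  have contA: "continuous_on {0..2*pi} A"
    by (rule uniform_limit_theorem[OF _ uA]) (auto intro!: continuous_intros always_eventually)
  have Am: "((\<lambda>t. A t * cnj (cis t ^ m)) has_integral 2 * pi * (a m * r ^ m)) {0..2*pi}" for m
  proof -
    have "((\<lambda>t. \<Sum>n. (a n * (r * cis t) ^ n) * cnj (cis t ^ m)) has_integral
       (\<Sum>n. a n * r ^ n * (if n = m then 2 * pi else 0))) {0..2*pi}"
    proof (rule has_integral_suminf(1)[OF _ _ a])
      show "((\<lambda>t. a n * (r * cis t) ^ n * cnj (cis t ^ m)) has_integral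
            a n * r ^ n * (if n = m then 2 * pi else 0)) {0..2 * pi}" for n
        using has_integral_mult_right[OF has_integral_cis_product[of n m], of "a n * r ^ n"]
        by (simp add: power_mult_distrib mult_ac)
      show "norm (a n * (r * cis t) ^ n * cnj (cis t ^ m)) \<le> norm (a n) * r ^ n" for n t
        unfolding norm_mult[of _ "cnj _"] na by (simp add: norm_power)
    qed (intro continuous_intros)
    moreover have "(\<Sum>n. (a n * (r * cis t) ^ n) * cnj (cis t ^ m)) = A t * cnj (cis t ^ m)" for t
      unfolding A_def using a
      by (intro suminf_mult2[symmetric]) (rule summable_norm_cancel, simp add: na)
    moreover have "(\<Sum>n. a n * r ^ n * (if n = m then 2 * pi else 0)) = a m * r ^ m * (2 * pi)"
      by (subst suminf_finite[of "{m}"]) auto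
    ultimately show ?thesis by (simp add: mult_ac)
  qed
  obtain C where C: "\<And>t. t \<in> {0..2*pi} \<Longrightarrow> norm (A t) \<le> C"
    using compact_imp_bounded[OF compact_continuous_image[OF contA compact_Icc]]
    unfolding bounded_iff by blast
  have "((\<lambda>t. \<Sum>n. A t * cnj (b n * (r * cis t) ^ n)) has_integral
       (\<Sum>n. cnj (b n) * r ^ n * (2 * pi * (a n * r ^ n)))) {0..2*pi}"
  proof (rule has_integral_suminf(1))
    show "summable (\<lambda>n. C * (norm (b n) * r ^ n))" using b by (rule summable_mult)
    show "norm (A t * cnj (b n * (r * cis t) ^ n)) \<le> C * (norm (b n) * r ^ n)"
      if "t \<in> {0..2*pi}" for n t
      unfolding norm_mult[of "A t"] complex_mod_cnj nb using C[OF that] r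
      by (intro mult_right_mono) auto
    show "((\<lambda>t. A t * cnj (b n * (r * cis t) ^ n)) has_integral
          cnj (b n) * r ^ n * (2 * pi * (a n * r ^ n))) {0..2 * pi}" for n
      using has_integral_mult_right[OF Am[of n], of "cnj (b n) * r ^ n"]
      by (simp add: power_mult_distrib mult_ac)
  qed (intro continuous_intros contA)
  moreover have "(\<Sum>n. A t * cnj (b n * (r * cis t) ^ n)) = A t * cnj (\<Sum>n. b n * (r * cis t) ^ n)" for t
  proof -
    have "summable (\<lambda>n. b n * (r * cis t) ^ n)"
      using b by (rule_tac summable_norm_cancel) (simp add: nb)
    hence "(\<lambda>n. A t * cnj (b n * (r * cis t) ^ n)) sums (A t * cnj (\<Sum>n. b n * (r * cis t) ^ n))"
      by (intro sums_mult sums_cnj[THEN iffD2] summable_sums)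
    thus ?thesis by (simp add: sums_iff)
  qed
  moreover have "(\<Sum>n. cnj (b n) * r ^ n * (2 * pi * (a n * r ^ n))) = 2 * pi * (\<Sum>n. a n * cnj (b n) * r ^ (2 * n))"
  proof -
    obtain K where K: "\<And>n. norm (norm (a n) * r ^ n) \<le> K"
      using summable_imp_Bseq[OF a] unfolding Bseq_def by auto
    have s: "summable (\<lambda>n. a n * cnj (b n) * r ^ (2 * n))"
    proof (rule summable_comparison_test'[OF summable_mult[OF b]])
      fix n :: nat
      have "norm (a n * cnj (b n) * r ^ (2 * n)) = (norm (a n) * r ^ n) * (norm (b n) * r ^ n)"
        using r by (simp add: norm_mult norm_power power_add mult_2)
      also have "\<dots> \<le> K * (norm (b n) * r ^ n)"
        using K[of n] r by (intro mult_right_mono) auto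
      finally show "norm (a n * cnj (b n) * r ^ (2 * n)) \<le> K * (norm (b n) * r ^ n)" .
    qed
    have e: "cnj (b n) * r ^ n * (2 * pi * (a n * r ^ n)) = 2 * pi * (a n * cnj (b n) * r ^ (2 * n))" for n
      unfolding mult_2[of n] power_add by (simp add: mult_ac)
    show ?thesis unfolding e by (rule suminf_mult[OF s])
  qed
  ultimately show ?thesis by (simp add: A_def)
qed


lemma has_integral_parseval_self:
  fixes a :: "nat \<Rightarrow> complex" and r :: real
  assumes r: "r \<ge> 0" and a: "summable (\<lambda>n. norm (a n) * r ^ n)"
  shows "((\<lambda>t. (norm (\<Sum>n. a n * (r * cis t) ^ n))\<^sup>2) has_integral
           2 * pi * (\<Sum>n. (norm (a n))\<^sup>2 * r ^ (2 * n))) {0..2*pi}"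
    and "summable (\<lambda>n. (norm (a n))\<^sup>2 * r ^ (2 * n))"
proof -
  obtain K where K: "\<And>n. norm (norm (a n) * r ^ n) \<le> K"
    using summable_imp_Bseq[OF a] unfolding Bseq_def by auto
  have e: "(norm (a n))\<^sup>2 * r ^ (2 * n) = (norm (a n) * r ^ n) * (norm (a n) * r ^ n)" for n
    unfolding power_even_eq power2_eq_square by (simp add: mult_ac)
  show s: "summable (\<lambda>n. (norm (a n))\<^sup>2 * r ^ (2 * n))"
  proof (rule summable_comparison_test'[OF summable_mult[OF a]])
    show "norm ((norm (a n))\<^sup>2 * r ^ (2 * n)) \<le> K * (norm (a n) * r ^ n)" for n
    proof -
      have "norm ((norm (a n))\<^sup>2 * r ^ (2 * n)) = norm (norm (a n) * r ^ n) * (norm (a n) * r ^ n)"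
        unfolding e norm_mult[of "norm (a n) * r ^ n"] using r by simp
      also have "\<dots> \<le> K * (norm (a n) * r ^ n)"
        using r by (intro mult_right_mono K) auto
      finally show ?thesis .
    qed
  qed
  have "(\<Sum>n. a n * cnj (a n) * of_real (r ^ (2 * n))) = of_real (\<Sum>n. (norm (a n))\<^sup>2 * r ^ (2 * n))"
    unfolding suminf_of_real[OF s] of_real_mult complex_norm_square ..
  hence "((\<lambda>t. complex_of_real ((norm (\<Sum>n. a n * (r * cis t) ^ n))\<^sup>2)) has_integral
           of_real (2 * pi * (\<Sum>n. (norm (a n))\<^sup>2 * r ^ (2 * n)))) {0..2*pi}"
    using has_integral_parseval[OF r a a] by (simp only: complex_norm_square of_real_mult of_real_numeral)
  from has_integral_linear[OF this bounded_linear_Re]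
  show "((\<lambda>t. (norm (\<Sum>n. a n * (r * cis t) ^ n))\<^sup>2) has_integral
           2 * pi * (\<Sum>n. (norm (a n))\<^sup>2 * r ^ (2 * n))) {0..2*pi}"
    by (simp add: o_def)
qed

lemma disc_series_abs_summable:
  fixes c :: "nat \<Rightarrow> complex"
  assumes "\<And>w. norm w < R \<Longrightarrow> (\<lambda>n. c n * w ^ n) sums \<theta> w" "0 \<le> r" "r < R"
  shows "summable (\<lambda>n. norm (c n) * r ^ n)"
proof -
  define s where "s = (r + R) / 2"
  have s: "r < s" "s < R" using assms by (auto simp: s_def)
  have "summable (\<lambda>n. c n * of_real s ^ n)"
    using assms(1)[of "of_real s"] s assms(2) by (simp add: sums_iff)
  from powser_insidea[OF this, of "of_real r"] show ?thesis
    using s assms(2) by (simp add: norm_mult norm_power)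
qed

definition taylor_seq :: "(complex \<Rightarrow> complex) \<Rightarrow> nat \<Rightarrow> complex" where
  "taylor_seq \<theta> n = (deriv ^^ n) \<theta> 0 / fact n"

lemma taylor_seq_sums:
  "\<theta> holomorphic_on ball 0 R \<Longrightarrow> norm w < R \<Longrightarrow> (\<lambda>n. taylor_seq \<theta> n * w ^ n) sums \<theta> w"
  using holomorphic_power_series[of \<theta> 0 R w] by (simp add: taylor_seq_def)

text \<open>Lets the radius tend to \<open>1\<close> in bounds coming from Parseval's identity on smaller circles.\<close>
lemma sum_le_if_weighted_sums_le:
  fixes f :: "'i \<Rightarrow> real" and g :: "'i \<Rightarrow> nat"
  assumes "\<And>r. 0 < r \<Longrightarrow> r < 1 \<Longrightarrow> (\<Sum>n\<in>F. f n * r ^ g n) \<le> C"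
  shows "(\<Sum>n\<in>F. f n) \<le> C"
proof (rule tendsto_upperbound)
  have "((\<lambda>r. \<Sum>n\<in>F. f n * r ^ g n) \<longlongrightarrow> (\<Sum>n\<in>F. f n * 1 ^ g n)) (at_left (1::real))"
    by (intro tendsto_intros)
  thus "((\<lambda>r. \<Sum>n\<in>F. f n * r ^ g n) \<longlongrightarrow> (\<Sum>n\<in>F. f n)) (at_left (1::real))" by simp
  show "eventually (\<lambda>r. (\<Sum>n\<in>F. f n * r ^ g n) \<le> C) (at_left 1)"
    using eventually_at_left_real[of 0 1] by (auto elim!: eventually_mono intro: assms)
qed simp

text \<open>The mean of \<open>|\<theta>|\<^sup>2\<close> over each circle is at most \<open>B\<^sup>2\<close>.\<close>
lemma bounded_taylor_seq_ell2:
  assumes c: "\<And>w. norm w < 1 \<Longrightarrow> (\<lambda>n. c n * w ^ n) sums \<theta> w"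
    and B: "\<And>w. norm w < 1 \<Longrightarrow> norm (\<theta> w) \<le> B"
  shows "c \<in> ell2"
proof (rule ell2_I_bounded)
  fix F :: "nat set" assume F: "finite F"
  show "(\<Sum>n\<in>F. (norm (c n))\<^sup>2) \<le> B\<^sup>2"
  proof (rule sum_le_if_weighted_sums_le[where g = "\<lambda>n. 2 * n"])
    fix r :: real assume r: "0 < r" "r < 1"
    note s = disc_series_abs_summable[OF c _ r(2)]
    have "(\<Sum>n. c n * (r * cis t) ^ n) = \<theta> (r * cis t)" for t
      using c[of "r * cis t"] r by (simp add: sums_iff norm_mult)
    hence i: "((\<lambda>t. (norm (\<theta> (r * cis t)))\<^sup>2) has_integral
           2 * pi * (\<Sum>n. (norm (c n))\<^sup>2 * r ^ (2 * n))) {0..2*pi}"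
      using has_integral_parseval_self(1)[OF _ s] r by simp
    have "2 * pi * (\<Sum>n. (norm (c n))\<^sup>2 * r ^ (2 * n)) \<le> 2 * pi * B\<^sup>2"
    proof (rule has_integral_le[OF i])
      show "((\<lambda>t. B\<^sup>2) has_integral (2 * pi * B\<^sup>2)) {0..2*pi}"
        using has_integral_const_real[of "B\<^sup>2" 0 "2*pi"] by simp
      show "(norm (\<theta> (r * cis t)))\<^sup>2 \<le> B\<^sup>2" for t
        using B[of "r * cis t"] r by (intro power_mono) (auto simp: norm_mult)
    qed
    hence "(\<Sum>n. (norm (c n))\<^sup>2 * r ^ (2 * n)) \<le> B\<^sup>2" by simp
    moreover have "(\<Sum>n\<in>F. (norm (c n))\<^sup>2 * r ^ (2 * n)) \<le> (\<Sum>n. (norm (c n))\<^sup>2 * r ^ (2 * n))"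
      using F r by (intro sum_le_suminf has_integral_parseval_self(2) s) auto
    ultimately show "(\<Sum>n\<in>F. (norm (c n))\<^sup>2 * r ^ (2 * n)) \<le> B\<^sup>2" by simp
  qed
qed

lemma sums_shift:
  fixes c :: "nat \<Rightarrow> complex"
  assumes "(\<lambda>n. c n * w ^ n) sums S"
  shows "(\<lambda>n. shift m c n * w ^ n) sums (w ^ m * S)"
proof -
  have "(\<lambda>n. shift m c (n + m) * w ^ (n + m)) sums (w ^ m * S)"
    using sums_mult[OF assms, of "w ^ m"] by (simp add: shift_def power_add mult_ac)
  thus ?thesis using sums_iff_shift[of "\<lambda>n. shift m c n * w ^ n" m "w ^ m * S"]
    by (simp add: shift_def)
qed

text \<open>An Abelian limit: the products of square-summable sequences are absolutely summable and dominate the weighted terms.\<close>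
lemma suminf_tendsto_ip:
  fixes a b :: "nat \<Rightarrow> complex" and r :: "nat \<Rightarrow> real"
  assumes a: "a \<in> ell2" and b: "b \<in> ell2" and r: "\<And>k. 0 \<le> r k" "\<And>k. r k < 1" "r \<longlonglongrightarrow> 1"
  shows "(\<lambda>k. \<Sum>n. a n * cnj (b n) * r k ^ (2 * n)) \<longlonglongrightarrow> ip a b"
proof -
  have s: "(\<lambda>n. norm (a n * cnj (b n))) summable_on UNIV"
    by (rule ell2_abs_summable_product[OF a ell2_cnj[OF b]])
  have e: "ip a b = (\<Sum>n. a n * cnj (b n))"
    unfolding ip_def using has_sum_imp_sums[OF has_sum_infsum[OF ell2_summable_ip[OF a b]]] by (simp add: sums_iff)
  have "(\<lambda>k. \<Sum>n. a n * cnj (b n) * complex_of_real (r k ^ (2 * n))) \<longlonglongrightarrow> (\<Sum>n. a n * cnj (b n))"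
  proof (rule tannerys_theorem[THEN conjunct2, THEN conjunct2])
    show "(\<lambda>k. a n * cnj (b n) * complex_of_real (r k ^ (2 * n))) \<longlonglongrightarrow> a n * cnj (b n)" for n
    proof -
      have "(\<lambda>k. a n * cnj (b n) * complex_of_real (r k ^ (2 * n))) \<longlonglongrightarrow> a n * cnj (b n) * complex_of_real (1 ^ (2 * n))"
        by (intro tendsto_intros r)
      thus ?thesis by simp
    qed
    show "\<forall>\<^sub>F (n, k) in at_top \<times>\<^sub>F sequentially. norm (a n * cnj (b n) * complex_of_real (r k ^ (2 * n))) \<le> norm (a n * cnj (b n))"
    proof (rule always_eventually, clarify)
      fix n k
      have "norm (complex_of_real (r k ^ (2 * n))) \<le> 1" using r(1,2)[of k] by (simp add: norm_power power_le_one)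
      thus "norm (a n * cnj (b n) * complex_of_real (r k ^ (2 * n))) \<le> norm (a n * cnj (b n))"
        unfolding norm_mult[of "a n * cnj (b n)"] by (rule mult_left_le) simp
    qed
    show "summable (\<lambda>n. norm (a n * cnj (b n)))"
      by (rule summable_on_imp_summable[OF s])
  qed simp
  thus ?thesis by (simp add: e)
qed

text \<open>By Parseval, the mean of \<open>\<theta> * cnj (w\<^sup>m \<theta>)\<close> over the circle of radius \<open>r\<close> tends to \<open>\<langle>\<theta>, w\<^sup>m \<theta>\<rangle>\<close> as
\<open>r\<close> tends to \<open>1\<close>. By dominated convergence the limit is also the mean of \<open>cnj (w\<^sup>m)\<close> over the unit circle, since the
radial limits have modulus one almost everywhere.\<close>
lemma inner_function_inner_seq:
  assumes "inner_function \<theta>"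
  shows "inner_seq (taylor_seq \<theta>)"
proof -
  define c where "c = taylor_seq \<theta>"
  have hol: "\<theta> holomorphic_on ball 0 1" using assms by (simp add: inner_function_def)
  obtain B where "\<forall>w\<in>ball 0 1. norm (\<theta> w) \<le> B"
    using assms unfolding inner_function_def bounded_iff by blast
  hence B: "norm (\<theta> w) \<le> B" if "norm w < 1" for w using that by simp
  have B0: "0 \<le> B" using B[of 0] by (auto intro: order_trans[OF norm_ge_zero])
  have c: "(\<lambda>n. c n * w ^ n) sums \<theta> w" if "norm w < 1" for w
    using taylor_seq_sums[OF hol that] by (simp add: c_def)
  have l: "c \<in> ell2" by (rule bounded_taylor_seq_ell2[OF c B])
  \<comment> \<open>Dominated convergence is about sequences, so the radial limit is taken along one sequence of radii.\<close>
  define r where "r k = 1 - inverse (real (Suc k))" for k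
  have r: "0 \<le> r k" "r k < 1" for k by (auto simp: r_def inverse_le_1_iff)
  have rlim: "r \<longlonglongrightarrow> 1"
    using LIMSEQ_inverse_real_of_nat_add_minus[of 1] by (simp add: r_def[abs_def])
  have rleft: "filterlim r (at_left 1) sequentially"
    by (rule filterlim_at_withinI[OF rlim]) (use r in \<open>auto intro!: always_eventually simp: less_imp_neq\<close>)
  have key: "ip c (shift m c) = (if m = 0 then 1 else 0)" for m
  proof -
    let ?M = "lebesgue_on {0..2*pi}"
    define h where "h k t = \<theta> (r k * cis t) * cnj ((r k * cis t) ^ m * \<theta> (r k * cis t))" for k t
    have i: "(h k has_integral 2 * pi * (\<Sum>n. c n * cnj (shift m c n) * r k ^ (2 * n))) {0..2*pi}" for k
    proof -
      have sh: "(\<lambda>n. shift m c n * w ^ n) sums (w ^ m * \<theta> w)" if "norm w < 1" for w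
        by (rule sums_shift[OF c[OF that]])
      have "(\<Sum>n. c n * (r k * cis t) ^ n) = \<theta> (r k * cis t)"
           "(\<Sum>n. shift m c n * (r k * cis t) ^ n) = (r k * cis t) ^ m * \<theta> (r k * cis t)" for t
        using c[of "r k * cis t"] sh[of "r k * cis t"] r[of k] by (simp_all add: sums_iff norm_mult)
      thus ?thesis unfolding h_def
        using has_integral_parseval[OF r(1) disc_series_abs_summable[OF c r] disc_series_abs_summable[OF sh r], of k] by simp
    qed
    have ch: "continuous_on {0..2*pi} (h k)" for k
    proof -
      have ct: "continuous_on {0..2*pi} (\<lambda>t. \<theta> (r k * cis t))"
        by (rule continuous_on_compose2[OF holomorphic_on_imp_continuous_on[OF hol]])
           (use r[of k] in \<open>auto intro!: continuous_intros simp: norm_mult\<close>)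
      show ?thesis unfolding h_def by (intro continuous_intros ct)
    qed
    have "(\<lambda>k. integral\<^sup>L ?M (h k)) \<longlonglongrightarrow> integral\<^sup>L ?M (\<lambda>t. cnj (cis t ^ m))"
    proof (rule integral_dominated_convergence)
      show "(\<lambda>t. cnj (cis t ^ m)) \<in> borel_measurable ?M" "h k \<in> borel_measurable ?M" for k
        by (intro continuous_imp_measurable_on_sets_lebesgue continuous_intros ch; simp)+
      show "integrable ?M (\<lambda>t. B * B)" by simp
      show "AE t in ?M. norm (h k t) \<le> B * B" for k
      proof (rule AE_I2)
        fix t
        have n: "norm (r k * cis t) < 1" using r[of k] by (simp add: norm_mult)
        have "norm (r k * cis t) ^ m \<le> 1" using n by (intro power_le_one) auto
        hence "norm (r k * cis t) ^ m * norm (\<theta> (r k * cis t)) \<le> 1 * B"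
          using B[OF n] by (intro mult_mono) auto
        hence "norm (\<theta> (r k * cis t)) * (norm (r k * cis t) ^ m * norm (\<theta> (r k * cis t))) \<le> B * B"
          using B[OF n] B0 by (intro mult_mono) auto
        thus "norm (h k t) \<le> B * B" unfolding h_def norm_mult complex_mod_cnj norm_power .
      qed
      have "AE t in ?M. \<exists>l. norm l = 1 \<and> ((\<lambda>r. \<theta> (of_real r * cis t)) \<longlongrightarrow> l) (at_left 1)"
        using assms by (simp add: inner_function_def)
      thus "AE t in ?M. (\<lambda>k. h k t) \<longlonglongrightarrow> cnj (cis t ^ m)"
      proof (rule AE_mp, intro AE_I2 impI)
        fix t assume "\<exists>l. norm l = 1 \<and> ((\<lambda>r. \<theta> (of_real r * cis t)) \<longlongrightarrow> l) (at_left 1)"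
        then obtain l where l: "norm l = 1" "((\<lambda>r. \<theta> (of_real r * cis t)) \<longlongrightarrow> l) (at_left 1)" by blast
        have t: "(\<lambda>k. \<theta> (r k * cis t)) \<longlonglongrightarrow> l" by (rule filterlim_compose[OF l(2) rleft])
        have "(\<lambda>k. h k t) \<longlonglongrightarrow> l * cnj ((of_real 1 * cis t) ^ m * l)"
          unfolding h_def by (intro tendsto_intros t rlim)
        also have "l * cnj ((of_real 1 * cis t) ^ m * l) = cnj (cis t ^ m)"
          using unimodular_cnj(1)[OF l(1)] by simp
        finally show "(\<lambda>k. h k t) \<longlonglongrightarrow> cnj (cis t ^ m)" .
      qed
    qed
    moreover have "integral\<^sup>L ?M f = integral {0..2*pi} f" if "continuous_on {0..2*pi} f" for f :: "real \<Rightarrow> complex"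
      by (rule lebesgue_integral_eq_integral) (use that in \<open>auto intro: continuous_imp_integrable_real\<close>)
    ultimately have "(\<lambda>k. integral {0..2*pi} (h k)) \<longlonglongrightarrow> integral {0..2*pi} (\<lambda>t. cnj (cis t ^ m))"
      using ch by (simp add: continuous_intros)
    moreover have "integral {0..2*pi} (\<lambda>t. cnj (cis t ^ m)) = (if m = 0 then 2 * pi else 0)"
      using integral_unique[OF has_integral_cis_product[of 0 m]] by (cases "m = 0") auto
    moreover have "integral {0..2*pi} (h k) = 2 * pi * (\<Sum>n. c n * cnj (shift m c n) * r k ^ (2 * n))" for k
      by (rule integral_unique[OF i])
    ultimately have "(\<lambda>k. 2 * pi * (\<Sum>n. c n * cnj (shift m c n) * r k ^ (2 * n))) \<longlonglongrightarrow> (if m = 0 then 2 * pi else 0)"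
      by simp
    moreover have "(\<lambda>k. 2 * pi * (\<Sum>n. c n * cnj (shift m c n) * r k ^ (2 * n))) \<longlonglongrightarrow> 2 * pi * ip c (shift m c)"
      by (intro tendsto_mult_left suminf_tendsto_ip l ell2_shift r rlim)
    ultimately have "2 * pi * ip c (shift m c) = (if m = 0 then 2 * pi else 0)"
      by (rule LIMSEQ_unique[rotated])
    thus ?thesis by (auto split: if_splits)
  qed
  \<comment> \<open>The forward shift is an isometry, so it suffices to compare with the unshifted sequence.\<close>
  have le: "ip (shift m c) (shift (m + k) c) = (if k = 0 then 1 else 0)" for m k
  proof (induction m)
    case (Suc m)
    have "ip (shift (Suc m) c) (shift (Suc m + k) c) = ip (shift 1 (shift m c)) (shift (Suc (m + k)) c)"
      unfolding shift_1_shift by simp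
    also have "\<dots> = ip (shift m c) (shift (m + k) c)"
      unfolding ip_shift_left unshift_shift ..
    finally show ?case using Suc by simp
  qed (simp add: key)
  have "ip (shift m c) (shift n c) = (if m = n then 1 else 0)" for m n
  proof (cases "m \<le> n")
    case True thus ?thesis using le[of m "n - m"] by auto
  next
    case False thus ?thesis using le[of n "m - n"] ip_commute[of "shift m c" "shift n c"] by auto
  qed
  thus ?thesis using l unfolding inner_seq_def c_def by blast
qed

lemma powser_coeff_unique:
  fixes a b :: "nat \<Rightarrow> complex"
  assumes "\<And>w. norm w < 1 \<Longrightarrow> (\<lambda>n. a n * w ^ n) sums f w"
    and "\<And>w. norm w < 1 \<Longrightarrow> (\<lambda>n. b n * w ^ n) sums f w"
  shows "a = b"
proof -
  have d: "(\<lambda>n. (a n - b n) * w ^ n) sums 0" if "norm w < 1" for w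
    using sums_diff[OF assms(1)[OF that] assms(2)[OF that]] by (simp add: algebra_simps)
  have "((\<lambda>t. (norm (\<Sum>n. (a n - b n) * ((1/2::real) * cis t) ^ n))\<^sup>2) has_integral
           2 * pi * (\<Sum>n. (norm (a n - b n))\<^sup>2 * (1/2) ^ (2 * n))) {0..2*pi}"
    by (rule has_integral_parseval_self(1)) (use disc_series_abs_summable[OF d] in auto)
  moreover have "(\<Sum>n. (a n - b n) * ((1/2::real) * cis t) ^ n) = 0" for t
    using d[of "(1/2::real) * cis t"] by (simp add: sums_iff norm_mult)
  ultimately have "2 * pi * (\<Sum>n. (norm (a n - b n))\<^sup>2 * (1/2) ^ (2 * n)) = 0"
    by (simp add: has_integral_0_eq)
  hence "(\<Sum>n. (norm (a n - b n))\<^sup>2 * (1/2::real) ^ (2 * n)) = 0" by simp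
  hence "(norm (a n - b n))\<^sup>2 * (1/2::real) ^ (2 * n) = 0" for n
    by (subst (asm) suminf_eq_zero_iff)
       (auto intro!: has_integral_parseval_self(2) disc_series_abs_summable[OF d])
  thus ?thesis by (intro ext) simp
qed

section \<open>From square-summable sequences to the Hardy space\<close>

lemma summable_on_product:
  fixes x :: "'a \<Rightarrow> real" and y :: "'b \<Rightarrow> real"
  assumes "x summable_on UNIV" "y summable_on UNIV" "\<And>i. x i \<ge> 0" "\<And>j. y j \<ge> 0"
  shows "(\<lambda>(i, j). x i * y j) summable_on UNIV"
proof -
  have "(\<lambda>i. complex_of_real (sqrt (x i))) \<in> ell2" "(\<lambda>j. complex_of_real (sqrt (y j))) \<in> ell2"
    using assms by (simp_all add: ell2_def)
  from ell2_tensor[OF this] show ?thesis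
    using assms by (simp add: ell2_def tensor_def norm_mult power_mult_distrib case_prod_unfold)
qed

lemma summable_prod_decode:
  fixes M :: "nat \<times> nat \<Rightarrow> real"
  assumes "M summable_on UNIV"
  shows "summable (\<lambda>n. M (prod_decode n))"
  using summable_on_imp_summable summable_on_reindex_bij_betw[OF bij_prod_decode, of M] assms by blast

lemma nonneg_summable_on_UNIV_nat:
  fixes f :: "nat \<Rightarrow> real"
  shows "summable f \<Longrightarrow> (\<And>n. f n \<ge> 0) \<Longrightarrow> f summable_on UNIV"
  using summable_on_UNIV_nonneg_real_iff by blast

lemma summable_geometric_deriv:
  fixes r :: real
  assumes "0 \<le> r" "r < 1"
  shows "summable (\<lambda>n. real n * r ^ (n - 1))"
proof -
  have "summable (\<lambda>n. real (Suc n) * r ^ n)"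
    using geometric_deriv_sums[of r] assms by (simp add: sums_iff)
  thus ?thesis by (subst summable_Suc_iff[symmetric]) simp
qed

text \<open>The unordered sum over pairs is enumerated by \<open>prod_decode\<close>, so that the theorem on termwise differentiation of
series applies.\<close>
definition double_series :: "(nat \<times> nat \<Rightarrow> complex) \<Rightarrow> complex \<times> complex \<Rightarrow> complex" where
  "double_series a = (\<lambda>(u, w). \<Sum>n. case prod_decode n of (i, j) \<Rightarrow> a (i, j) * (u ^ i * w ^ j))"

text \<open>On a bidisc of radius \<open>r < 1\<close> the partial derivatives of the terms are dominated by the summable family
\<open>C (i + j) r\<^bsup>i + j - 1\<^esup>\<close>, so the series of derivatives converges uniformly, also in the direction of differentiation.\<close>
lemma double_series_has_derivative:
  assumes C: "\<And>q. norm (a q) \<le> C" and x: "norm (fst x) < 1" "norm (snd x) < 1"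
  shows "\<exists>P Q. (double_series a has_derivative (\<lambda>(h, k). P * h + Q * k)) (at x)"
proof -
  obtain r where r: "norm (fst x) < r" "norm (snd x) < r" "r < 1"
    using dense[of "max (norm (fst x)) (norm (snd x))" 1] x by auto
  have r0: "0 \<le> r" using r(1) norm_ge_zero[of "fst x"] by linarith
  have C0: "0 \<le> C" using C[of "(0,0)"] by (rule order_trans[OF norm_ge_zero])
  define S where "S = ball (0::complex) r \<times> ball (0::complex) r"
  have S: "convex S" "open S" "x \<in> S"
    unfolding S_def using r by (auto intro!: convex_Times open_Times simp: mem_Times_iff)
  define f where "f n = (\<lambda>(u, w). case prod_decode n of (i, j) \<Rightarrow> a (i, j) * (u ^ i * w ^ j))" for n
  define P where "P n x = (case prod_decode n of (i, j) \<Rightarrow> a (i, j) * (of_nat i * fst x ^ (i - 1) * snd x ^ j))" for n x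
  define Q where "Q n x = (case prod_decode n of (i, j) \<Rightarrow> a (i, j) * (fst x ^ i * (of_nat j * snd x ^ (j - 1))))" for n x
  define f' where "f' n x = (\<lambda>(h, k). P n x * h + Q n x * k)" for n x
  define M where "M n = (case prod_decode n of (i, j) \<Rightarrow> C * ((real i * r ^ (i - 1)) * r ^ j))
     + (case prod_decode n of (i, j) \<Rightarrow> C * (r ^ i * (real j * r ^ (j - 1))))" for n
  have sM: "summable M"
  proof -
    have 1: "(\<lambda>i. r ^ i) summable_on UNIV"
      using r0 r by (intro nonneg_summable_on_UNIV_nat summable_geometric) auto
    have nn: "0 \<le> real i * r ^ (i - 1)" for i
      by (intro mult_nonneg_nonneg of_nat_0_le_iff zero_le_power r0)
    have 2: "(\<lambda>i. real i * r ^ (i - 1)) summable_on UNIV"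
      by (rule nonneg_summable_on_UNIV_nat[OF summable_geometric_deriv[OF r0 r(3)] nn])
    have "(\<lambda>(i, j). (real i * r ^ (i - 1)) * r ^ j) summable_on UNIV"
         "(\<lambda>(i, j). r ^ i * (real j * r ^ (j - 1))) summable_on UNIV"
      by (intro summable_on_product 1 2 nn zero_le_power r0)+
    from this[THEN summable_prod_decode, THEN summable_mult[where c = C]] show ?thesis
      unfolding M_def by (intro summable_add) (simp_all add: case_prod_unfold)
  qed
  have PM: "norm (P n y) \<le> M n" and QM: "norm (Q n y) \<le> M n" if "y \<in> S" for n y
  proof -
    obtain i j where n: "prod_decode n = (i, j)" by (cases "prod_decode n")
    have y: "norm (fst y) \<le> r" "norm (snd y) \<le> r" using that by (auto simp: S_def)
    have "norm (P n y) \<le> C * ((real i * r ^ (i - 1)) * r ^ j)"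
      unfolding P_def n by (auto simp: norm_mult norm_power intro!: mult_mono mult_nonneg_nonneg zero_le_power C power_mono y r0 C0)
    moreover have "norm (Q n y) \<le> C * (r ^ i * (real j * r ^ (j - 1)))"
      unfolding Q_def n by (auto simp: norm_mult norm_power intro!: mult_mono mult_nonneg_nonneg zero_le_power C power_mono y r0 C0)
    moreover have "0 \<le> C * ((real i * r ^ (i - 1)) * r ^ j)" "0 \<le> C * (r ^ i * (real j * r ^ (j - 1)))"
      using C0 r0 by auto
    ultimately show "norm (P n y) \<le> M n" "norm (Q n y) \<le> M n" unfolding M_def n by auto
  qed
  have sP: "summable (\<lambda>n. P n y)" "summable (\<lambda>n. Q n y)" if "y \<in> S" for y
    using summable_comparison_test'[OF sM PM[OF that]] summable_comparison_test'[OF sM QM[OF that]] by auto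
  define g' where "g' x = (\<lambda>(h, k). (\<Sum>n. P n x) * h + (\<Sum>n. Q n x) * k)" for x
  have fS: "(\<lambda>n. f n y) sums double_series a y" if "y \<in> S" for y
  proof -
    have 1: "(\<lambda>i. r ^ i) summable_on UNIV"
      using r0 r by (auto intro!: nonneg_summable_on_UNIV_nat summable_geometric)
    have "(\<lambda>(i, j). r ^ i * r ^ j) summable_on (UNIV :: (nat \<times> nat) set)"
      by (rule summable_on_product; use 1 r0 in simp)
    from summable_prod_decode[OF this, THEN summable_mult[where c = C]]
    have "summable (\<lambda>n. f n y)"
    proof (rule summable_comparison_test')
      fix n :: nat
      obtain i j where n: "prod_decode n = (i, j)" by (cases "prod_decode n")
      have y: "norm (fst y) \<le> r" "norm (snd y) \<le> r" using that by (auto simp: S_def)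
      show "norm (f n y) \<le> C * (case prod_decode n of (i, j) \<Rightarrow> r ^ i * r ^ j)"
        unfolding f_def n by (auto simp: case_prod_unfold norm_mult norm_power intro!: mult_mono mult_nonneg_nonneg zero_le_power C power_mono y r0 C0)
    qed
    moreover have "double_series a y = (\<Sum>n. f n y)"
      by (simp add: double_series_def f_def case_prod_unfold)
    ultimately show ?thesis by (simp add: summable_sums)
  qed
  have "\<exists>g. \<forall>y\<in>S. (\<lambda>n. f n y) sums (g y) \<and> (g has_derivative g' y) (at y within S)"
  proof (rule has_derivative_series[where f = f and f' = f' and g' = g' and S = S and x = x and l = "double_series a x"])
    show "convex S" "x \<in> S" "(\<lambda>n. f n x) sums double_series a x" by (intro S fS)+
  next
    fix n y assume "y \<in> S"
    obtain i j where n: "prod_decode n = (i, j)" by (cases "prod_decode n")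
    show "(f n has_derivative f' n y) (at y within S)"
      unfolding f_def f'_def P_def Q_def n case_prod_unfold prod.case fst_conv snd_conv
      by (rule derivative_eq_intros refl | simp add: algebra_simps)+
  next
    fix e :: real assume e: "e > 0"
    obtain N where N: "\<And>n. n \<ge> N \<Longrightarrow> norm (\<Sum>i. M (i + n)) < e / 2"
      using suminf_exist_split[OF half_gt_zero[OF e] sM] by auto
    show "\<forall>\<^sub>F n in sequentially. \<forall>y\<in>S. \<forall>h. norm ((\<Sum>i<n. f' i y h) - g' y h) \<le> e * norm h"
      unfolding eventually_sequentially
    proof (intro exI allI impI ballI)
      fix n y and H :: "complex \<times> complex" assume n: "N \<le> n" and y: "y \<in> S"
      obtain h k where H: "H = (h, k)" by (cases H)
      have tail: "norm ((\<Sum>i. p i) - (\<Sum>i<n. p i)) \<le> e / 2" if p: "\<And>i. norm (p i) \<le> M i" for p :: "nat \<Rightarrow> complex"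
      proof -
        have s: "summable p" by (rule summable_comparison_test'[OF sM p])
        have "(\<Sum>i. p i) - (\<Sum>i<n. p i) = (\<Sum>i. p (i + n))"
          using suminf_minus_initial_segment[OF s, of n] by simp
        also have "norm \<dots> \<le> (\<Sum>i. M (i + n))"
          by (rule norm_suminf_le) (use p sM in \<open>auto simp: summable_iff_shift\<close>)
        also have "\<dots> \<le> e / 2" using N[OF n] by simp
        finally show ?thesis .
      qed
      have "(\<Sum>i<n. f' i y H) - g' y H = ((\<Sum>i<n. P i y) - (\<Sum>i. P i y)) * h + ((\<Sum>i<n. Q i y) - (\<Sum>i. Q i y)) * k"
        unfolding H f'_def g'_def by (simp add: sum.distrib sum_distrib_left algebra_simps)
      also have "norm \<dots> \<le> norm ((\<Sum>i<n. P i y) - (\<Sum>i. P i y)) * norm h + norm ((\<Sum>i<n. Q i y) - (\<Sum>i. Q i y)) * norm k"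
        by (rule order_trans[OF norm_triangle_ineq]) (simp add: norm_mult)
      also have "\<dots> \<le> e / 2 * norm H + e / 2 * norm H"
        unfolding norm_minus_commute[of "\<Sum>i<n. _ i"]
        by (intro add_mono mult_mono tail PM QM y)
           (use e in \<open>auto simp: H norm_Pair intro: real_sqrt_sum_squares_ge1 real_sqrt_sum_squares_ge2\<close>)
      finally show "norm ((\<Sum>i<n. f' i y H) - g' y H) \<le> e * norm H" by simp
    qed
  qed
  then obtain g where g: "\<And>y. y \<in> S \<Longrightarrow> (\<lambda>n. f n y) sums (g y)" "\<And>y. y \<in> S \<Longrightarrow> (g has_derivative g' y) (at y within S)"
    by blast
  have "(double_series a has_derivative g' x) (at x within S)"
    by (rule has_derivative_transform[OF S(3) _ g(2)[OF S(3)]]) (rule sums_unique2[OF fS g(1)])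
  hence "(double_series a has_derivative g' x) (at x)"
    by (simp only: at_within_open[OF S(3,2)])
  thus ?thesis unfolding g'_def by blast
qed

definition geo :: "complex \<Rightarrow> nat \<Rightarrow> complex" where
  "geo u i = cnj (u ^ i)"

text \<open>The reproducing kernel: evaluation at \<open>(z, w)\<close> is the inner product with \<open>cnj (u\<^sup>i w\<^sup>j / w)\<close>. Defining the isomorphism
through it makes the effect of an operator on functions computable from its adjoint on sequences.\<close>
definition hartogs_kernel :: "complex \<times> complex \<Rightarrow> nat \<times> nat \<Rightarrow> complex" where
  "hartogs_kernel p = (case p of (z, w) \<Rightarrow> (\<lambda>q. cnj (1 / w) * tensor (geo (z / w)) (geo w) q))"

definition of_seq :: "(nat \<times> nat \<Rightarrow> complex) \<Rightarrow> complex \<times> complex \<Rightarrow> complex" where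
  "of_seq a p = (if p \<in> hartogs_triangle then ip a (hartogs_kernel p) else 0)"

lemma geo_ell2: assumes "norm u < 1" shows "geo u \<in> ell2"
proof -
  have e: "(norm (geo u n))\<^sup>2 = ((norm u)\<^sup>2) ^ n" for n
    by (simp add: geo_def norm_power flip: power_mult) (simp add: mult.commute)
  have "(norm u)\<^sup>2 < 1" using assms by (simp add: power_less_one_iff)
  hence "(\<lambda>n. ((norm u)\<^sup>2) ^ n) summable_on UNIV"
    by (intro nonneg_summable_on_UNIV_nat summable_geometric) auto
  thus ?thesis unfolding ell2_def e mem_Collect_eq .
qed

lemma hartogs_triangleD:
  assumes "(z, w) \<in> hartogs_triangle"
  shows "w \<noteq> 0" "norm (z / w) < 1" "norm w < 1" "norm z < norm w"
  using assms by (auto simp: hartogs_triangle_def norm_divide divide_less_eq_1)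

lemma hartogs_kernel_ell2: "p \<in> hartogs_triangle \<Longrightarrow> hartogs_kernel p \<in> ell2"
  unfolding hartogs_kernel_def
  by (cases p, simp only: prod.case) (intro ell2_scale ell2_tensor geo_ell2 hartogs_triangleD)

lemma of_seq_eq_double_series:
  assumes a: "a \<in> ell2" and p: "(z, w) \<in> hartogs_triangle"
  shows "of_seq a (z, w) = 1 / w * double_series a (z / w, w)"
proof -
  note d = hartogs_triangleD[OF p]
  have l: "tensor (geo (z / w)) (geo w) \<in> ell2" by (intro ell2_tensor geo_ell2 d)
  have "of_seq a (z, w) = 1 / w * ip a (tensor (geo (z / w)) (geo w))"
    using p by (simp only: of_seq_def hartogs_kernel_def prod.case ip_scale_right if_True complex_cnj_cnj)
  also have "ip a (tensor (geo (z / w)) (geo w)) = (\<Sum>\<^sub>\<infinity>q. a q * (case q of (i, j) \<Rightarrow> (z / w) ^ i * w ^ j))"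
    unfolding ip_def by (intro infsum_cong) (auto simp: tensor_def geo_def case_prod_unfold)
  also have "\<dots> = double_series a (z / w, w)"
  proof -
    let ?g = "\<lambda>q. a q * (case q of (i, j) \<Rightarrow> (z / w) ^ i * w ^ j)"
    have "?g summable_on UNIV"
      using ell2_summable_ip[OF a l] by (simp add: tensor_def geo_def case_prod_unfold)
    hence "((\<lambda>n. ?g (prod_decode n)) has_sum (\<Sum>\<^sub>\<infinity>q. ?g q)) UNIV"
      by (subst has_sum_reindex_bij_betw[OF bij_prod_decode, of ?g]) simp
    hence "(\<lambda>n. ?g (prod_decode n)) sums (\<Sum>\<^sub>\<infinity>q. ?g q)" by (rule has_sum_imp_sums)
    thus ?thesis by (simp add: double_series_def sums_iff case_prod_unfold)
  qed
  finally show ?thesis .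
qed

lemma open_hartogs_triangle: "open hartogs_triangle"
proof -
  have "hartogs_triangle = {p. norm (fst p) < norm (snd p)} \<inter> {p. norm (snd p) < 1}"
    by (auto simp: hartogs_triangle_def)
  moreover have "open ({p. norm (fst p) < norm (snd p)} \<inter> {p. norm (snd p) < 1} :: (complex \<times> complex) set)"
    by (intro open_Int open_Collect_less continuous_intros)
  ultimately show ?thesis by simp
qed

lemma of_seq_holomorphic:
  assumes a: "a \<in> ell2"
  shows "holomorphic2_on (of_seq a) hartogs_triangle"
  unfolding holomorphic2_on_def
proof
  fix p assume p: "p \<in> hartogs_triangle"
  obtain z w where zw: "p = (z, w)" by (cases p)
  note d = hartogs_triangleD[OF p[unfolded zw]]
  have C: "norm (a q) \<le> sqrt (sqnorm a)" for q
    using sqnorm_coord_le[OF a, of q] by (rule real_le_rsqrt)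
  obtain P Q where PQ: "(double_series a has_derivative (\<lambda>(h, k). P * h + Q * k)) (at (z / w, w))"
    using double_series_has_derivative[where a = a and C = "sqrt (sqnorm a)" and x = "(z / w, w)", OF C] d by auto
  define G where "G = (\<lambda>x :: complex \<times> complex. (fst x / snd x, snd x))"
  have G: "(G has_derivative (\<lambda>(h, k). ((h * w - z * k) / (w * w), k))) (at (z, w))"
    unfolding G_def case_prod_unfold using d(1)
    by (auto intro!: derivative_eq_intros simp: fun_eq_iff field_simps)
  have "((\<lambda>x. double_series a (G x)) has_derivative (\<lambda>x. (\<lambda>(h, k). P * h + Q * k) ((\<lambda>(h, k). ((h * w - z * k) / (w * w), k)) x))) (at (z, w))"
    by (rule has_derivative_compose[OF G]) (use PQ in \<open>simp add: G_def\<close>)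
  hence "((\<lambda>x. 1 / snd x * double_series a (G x)) has_derivative
     (\<lambda>x. 1 / w * (\<lambda>(h, k). P * h + Q * k) ((\<lambda>(h, k). ((h * w - z * k) / (w * w), k)) x) +
        (- snd x / (w * w)) * double_series a (z / w, w))) (at (z, w))"
    using d(1) by (auto intro!: derivative_eq_intros simp: fun_eq_iff field_simps G_def)
  also have "(\<lambda>x. 1 / w * (\<lambda>(h, k). P * h + Q * k) ((\<lambda>(h, k). ((h * w - z * k) / (w * w), k)) x) +
        (- snd x / (w * w)) * double_series a (z / w, w)) =
     (\<lambda>(h, k). (P / (w * w)) * h + (Q / w - P * z / (w * w * w) - double_series a (z / w, w) / (w * w)) * k)"
    (is "_ = ?D")
    using d(1) by (auto simp: fun_eq_iff field_simps)
  finally have "((\<lambda>x. 1 / snd x * double_series a (G x)) has_derivative ?D) (at p)"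
    by (simp add: zw)
  hence "(of_seq a has_derivative ?D) (at p)"
    by (rule has_derivative_transform_within_open[OF _ open_hartogs_triangle p])
       (auto simp: of_seq_eq_double_series[OF a] G_def)
  thus "\<exists>A B. (of_seq a has_derivative (\<lambda>(h, k). A * h + B * k)) (at p)" by blast
qed


lemma sqnorm_row_le: "a \<in> ell2 \<Longrightarrow> sqnorm (row a i) \<le> sqnorm a"
  unfolding row_def by (rule sqnorm_le_bounded, rule sum_reindex_le_sqnorm) (auto simp: inj_on_def)

lemma sqnorm_sums:
  fixes a :: "nat \<Rightarrow> complex"
  assumes "a \<in> ell2" shows "(\<lambda>n. (norm (a n))\<^sup>2) sums sqnorm a"
  using assms unfolding ell2_def sqnorm_def by (intro has_sum_imp_sums has_sum_infsum) simp

lemma sqnorm_rows: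
  fixes a :: "nat \<times> nat \<Rightarrow> complex"
  assumes a: "a \<in> ell2"
  shows "(\<lambda>i. sqnorm (row a i)) sums sqnorm a"
proof (rule has_sum_imp_sums, rule has_sum_SigmaD)
  show "((\<lambda>q. (norm (a q))\<^sup>2) has_sum sqnorm a) (UNIV \<times> UNIV)"
    using a unfolding ell2_def sqnorm_def by simp
qed (use ell2_row[OF a] in \<open>auto simp: ell2_def sqnorm_def row_def\<close>)

lemma ip_geo_sums:
  assumes "a \<in> ell2" "norm w < 1"
  shows "(\<lambda>j. a j * w ^ j) sums ip a (geo w)"
  using has_sum_imp_sums[OF has_sum_infsum[OF ell2_summable_ip[OF assms(1) geo_ell2[OF assms(2)]]]]
  by (simp add: ip_def geo_def)

text \<open>On the line with fixed \<open>w\<close> the function is a power series in \<open>z\<close>, whose coefficients are power series in \<open>w\<close>.\<close>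
lemma of_seq_row_sums:
  assumes a: "a \<in> ell2" and p: "(z, w) \<in> hartogs_triangle"
  shows "(\<lambda>i. ip (row a i) (geo w) * (z / w) ^ i) sums (w * of_seq a (z, w))"
proof -
  note d = hartogs_triangleD[OF p]
  have l: "tensor (geo (z / w)) (geo w) \<in> ell2" by (intro ell2_tensor geo_ell2 d)
  have "of_seq a (z, w) = 1 / w * ip a (tensor (geo (z / w)) (geo w))"
    using p by (simp only: of_seq_def hartogs_kernel_def prod.case ip_scale_right if_True complex_cnj_cnj)
  hence e: "w * of_seq a (z, w) = ip a (tensor (geo (z / w)) (geo w))" using d(1) by simp
  show ?thesis unfolding e
  proof (rule has_sum_imp_sums, rule has_sum_SigmaD)
    show "((\<lambda>q. a q * cnj (tensor (geo (z / w)) (geo w) q)) has_sum ip a (tensor (geo (z / w)) (geo w))) (UNIV \<times> UNIV)"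
      using ell2_summable_ip[OF a l] by (simp add: ip_def)
    fix i :: nat
    have "((\<lambda>j. row a i j * cnj (geo w j)) has_sum ip (row a i) (geo w)) UNIV"
      using ell2_summable_ip[OF ell2_row[OF a] geo_ell2[OF d(3)]] by (simp add: ip_def)
    from has_sum_cmult_left[OF this, of "(z / w) ^ i"]
    show "((\<lambda>j. a (i, j) * cnj (tensor (geo (z / w)) (geo w) (i, j))) has_sum
           ip (row a i) (geo w) * (z / w) ^ i) UNIV"
      by (simp add: row_def tensor_def geo_def mult_ac)
  qed
qed

text \<open>The coefficients of \<open>(u, w) \<mapsto> F(s u, t w)\<close>.\<close>
definition dilate :: "real \<Rightarrow> real \<Rightarrow> (nat \<times> nat \<Rightarrow> complex) \<Rightarrow> nat \<times> nat \<Rightarrow> complex" where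
  "dilate s t a = (\<lambda>(i, j). a (i, j) * s ^ i * t ^ j)"

lemma norm_dilate_le:
  assumes "0 < s" "s < 1" "0 < t" "t < 1"
  shows "norm (dilate s t a q) \<le> norm (a q)"
proof -
  obtain i j where q: "q = (i, j)" by (cases q)
  have "s ^ i * t ^ j \<le> 1 * 1" using assms by (intro mult_mono power_le_one) auto
  thus ?thesis using assms mult_left_mono[of "s ^ i * t ^ j" 1 "norm (a q)"]
    by (simp add: q dilate_def norm_mult norm_power mult.assoc)
qed

lemma dilate_ell2:
  assumes "0 < s" "s < 1" "0 < t" "t < 1" "a \<in> ell2"
  shows "dilate s t a \<in> ell2" "sqnorm (dilate s t a) \<le> sqnorm a"
proof -
  have *: "(\<Sum>q\<in>F. (norm (dilate s t a q))\<^sup>2) \<le> sqnorm a" if "finite F" for F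
  proof -
    have "(\<Sum>q\<in>F. (norm (dilate s t a q))\<^sup>2) \<le> (\<Sum>q\<in>F. (norm (a q))\<^sup>2)"
      by (intro sum_mono power_mono norm_dilate_le assms norm_ge_zero)
    also have "\<dots> \<le> sqnorm a" by (rule ell2_finite_le[OF assms(5) that])
    finally show ?thesis .
  qed
  show "dilate s t a \<in> ell2" by (rule ell2_I_bounded[OF *])
  show "sqnorm (dilate s t a) \<le> sqnorm a" by (rule sqnorm_le_bounded[OF *])
qed

lemma sqnorm_geo: "norm w = t \<Longrightarrow> sqnorm (geo w) = sqnorm (geo (of_real t))"
  by (auto simp: sqnorm_def geo_def norm_power)

text \<open>Parseval's identity is applied in the first variable for fixed \<open>w = t cis \<gamma>\<close>, where the radius \<open>s t\<close> for \<open>z\<close> is the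
radius \<open>s\<close> for \<open>u\<close>, and then to each coefficient as a function of \<open>w\<close>. The weight \<open>s t\<^sup>2\<close> of the mean cancels the factor
\<open>1/w\<close> and leaves \<open>s\<close>, which is harmless in the supremum.\<close>
lemma torus_mean_of_seq:
  assumes a: "a \<in> ell2" and s: "0 < s" "s < 1" and t: "0 < t" "t < 1"
  shows "torus_mean (of_seq a) s t = s * sqnorm (dilate s t a)"
proof -
  define A where "A i w = ip (row a i) (geo w)" for i w
  define K where "K = sqnorm a * sqnorm (geo (of_real t))"
  have nw: "norm (t * cis \<gamma>) = t" for \<gamma> using t by (simp add: norm_mult)
  have K: "(norm (A i (t * cis \<gamma>)))\<^sup>2 \<le> K" for i \<gamma>
  proof -
    have "(norm (A i (t * cis \<gamma>)))\<^sup>2 \<le> sqnorm (row a i) * sqnorm (geo (t * cis \<gamma>))"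
      unfolding A_def by (rule ip_Cauchy_Schwarz[OF ell2_row[OF a] geo_ell2]) (use nw t in simp)
    also have "\<dots> \<le> K" unfolding K_def sqnorm_geo[OF nw]
      by (intro mult_right_mono sqnorm_row_le a sqnorm_nonneg)
    finally show ?thesis .
  qed
  have gs: "summable (\<lambda>i. c * s ^ i)" "summable (\<lambda>i. c * s ^ (2 * i))" for c
    using s by (auto simp: power_mult power_less_one_iff intro!: summable_mult summable_geometric)
  have inner: "((\<lambda>\<theta>. (norm (of_seq a (of_real (s * t) * cis \<theta>, of_real t * cis \<gamma>)))\<^sup>2 * (s * t\<^sup>2))
      has_integral (2 * pi * s * (\<Sum>i. (norm (A i (t * cis \<gamma>)))\<^sup>2 * s ^ (2 * i)))) {0..2*pi}" for \<gamma>
  proof -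
    define w where "w = t * cis \<gamma>"
    have w: "norm w = t" "w \<noteq> 0" using nw[of \<gamma>] t by (auto simp: w_def)
    \<comment> \<open>The coefficients in powers of \<open>z\<close>, as \<open>u\<^sup>i / w = z\<^sup>i / w\<^bsup>i + 1\<^esup>\<close>.\<close>
    define b where "b i = A i w / w ^ (i + 1)" for i
    have nb: "norm (b i) * (s * t) ^ i = norm (A i w) * s ^ i / t" for i
      using w t by (simp add: b_def norm_divide norm_mult norm_power power_mult_distrib field_simps)
    have sb: "summable (\<lambda>i. norm (b i) * (s * t) ^ i)"
    proof (rule summable_comparison_test'[OF gs(1)])
      fix i
      have "norm (A i w) \<le> sqrt K" using K[of i \<gamma>] unfolding w_def by (rule real_le_rsqrt)
      hence "norm (A i w) * s ^ i / t \<le> sqrt K * s ^ i / t" using s t by (intro divide_right_mono mult_right_mono) auto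
      thus "norm (norm (b i) * (s * t) ^ i) \<le> (sqrt K / t) * s ^ i"
        unfolding nb using s t by simp
    qed
    have v: "(\<Sum>i. b i * (of_real (s * t) * cis \<theta>) ^ i) = of_seq a (of_real (s * t) * cis \<theta>, w)" for \<theta>
    proof -
      define z where "z = of_real (s * t) * cis \<theta>"
      have "norm z = s * t" using s t by (simp add: z_def norm_mult)
      hence p: "(z, w) \<in> hartogs_triangle" using w s t by (simp add: hartogs_triangle_def)
      have "(\<lambda>i. A i w * (z / w) ^ i / w) sums (w * of_seq a (z, w) / w)"
        using of_seq_row_sums[OF a p] unfolding A_def by (rule sums_divide)
      moreover have "A i w * (z / w) ^ i / w = b i * z ^ i" for i
        using w by (simp add: b_def power_divide)
      ultimately show ?thesis using w by (simp add: sums_iff z_def)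
    qed
    have "((\<lambda>\<theta>. (norm (of_seq a (of_real (s * t) * cis \<theta>, w)))\<^sup>2 * (s * t\<^sup>2))
      has_integral (2 * pi * (\<Sum>i. (norm (b i))\<^sup>2 * (s * t) ^ (2 * i)) * (s * t\<^sup>2))) {0..2*pi}"
      using has_integral_parseval_self(1)[OF _ sb] s t unfolding v by (intro has_integral_mult_left) simp
    moreover have "(norm (b i))\<^sup>2 * (s * t) ^ (2 * i) = (norm (A i w))\<^sup>2 * s ^ (2 * i) / t\<^sup>2" for i
    proof -
      have "(norm (b i))\<^sup>2 * (s * t) ^ (2 * i) = (norm (b i) * (s * t) ^ i)\<^sup>2"
        by (simp only: power_mult_distrib power_even_eq)
      thus ?thesis unfolding nb by (simp only: power_mult_distrib power_even_eq power_divide)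
    qed
    moreover have "summable (\<lambda>i. (norm (A i w))\<^sup>2 * s ^ (2 * i))"
      by (rule summable_comparison_test'[OF gs(2)[of K]])
         (use K[of _ \<gamma>] s in \<open>auto simp: w_def intro!: mult_right_mono\<close>)
    ultimately show ?thesis using t
      by (simp add: suminf_divide w_def mult_ac)
  qed
  have Aj: "((\<lambda>\<gamma>. (norm (A i (t * cis \<gamma>)))\<^sup>2 * s ^ (2 * i)) has_integral (2 * pi * sqnorm (row (dilate s t a) i))) {0..2*pi}" for i
  proof -
    have g: "(\<lambda>j. row a i j * w ^ j) sums A i w" if "norm w < 1" for w
      unfolding A_def by (rule ip_geo_sums[OF ell2_row[OF a] that])
    have v: "(\<Sum>j. row a i j * (of_real t * cis \<gamma>) ^ j) = A i (t * cis \<gamma>)" for \<gamma>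
      using g[of "t * cis \<gamma>"] nw t by (simp add: sums_iff)
    have st: "summable (\<lambda>j. norm (row a i j) * t ^ j)"
      by (rule disc_series_abs_summable[OF g]) (use t in auto)
    have t0: "0 \<le> t" using t by simp
    have "((\<lambda>\<gamma>. (norm (A i (t * cis \<gamma>)))\<^sup>2 * s ^ (2 * i)) has_integral
        (2 * pi * (\<Sum>j. (norm (row a i j))\<^sup>2 * t ^ (2 * j)) * s ^ (2 * i))) {0..2*pi}"
      using has_integral_mult_left[OF has_integral_parseval_self(1)[OF t0 st], of "s ^ (2 * i)"] unfolding v .
    moreover have "(\<Sum>j. (norm (row a i j))\<^sup>2 * t ^ (2 * j)) * s ^ (2 * i) = sqnorm (row (dilate s t a) i)"
    proof -
      have "(norm (row (dilate s t a) i j))\<^sup>2 = (norm (row a i j))\<^sup>2 * t ^ (2 * j) * s ^ (2 * i)" for j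
        using s t by (simp add: row_def dilate_def norm_mult norm_power power_mult_distrib power_even_eq)
      thus ?thesis
        using sqnorm_sums[OF ell2_row[OF dilate_ell2(1)[OF s t a]], of i]
          suminf_mult2[OF has_integral_parseval_self(2)[OF t0 st], of "s ^ (2 * i)"]
        by (simp add: sums_iff)
    qed
    ultimately show ?thesis by (simp add: mult.assoc)
  qed
  have contA: "continuous_on {0..2*pi} (\<lambda>\<gamma>. (norm (A i (t * cis \<gamma>)))\<^sup>2 * s ^ (2 * i))" for i
  proof -
    have "(\<lambda>w. A i w) holomorphic_on ball 0 1"
      using power_series_holomorphic[of 0 1 "\<lambda>j. row a i j" "A i"] ip_geo_sums[OF ell2_row[OF a]]
      by (simp add: A_def[abs_def])
    hence "continuous_on (ball 0 1) (A i)" by (rule holomorphic_on_imp_continuous_on)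
    hence "continuous_on {0..2*pi} (\<lambda>\<gamma>. A i (t * cis \<gamma>))"
      by (rule continuous_on_compose2) (use nw t in \<open>auto intro!: continuous_intros\<close>)
    thus ?thesis by (intro continuous_intros)
  qed
  have "((\<lambda>\<gamma>. \<Sum>i. (norm (A i (t * cis \<gamma>)))\<^sup>2 * s ^ (2 * i)) has_integral (\<Sum>i. 2 * pi * sqnorm (row (dilate s t a) i))) {0..2*pi}"
    by (rule has_integral_suminf(1)[OF contA _ gs(2)[of K] Aj])
       (use K s in \<open>auto intro!: mult_right_mono\<close>)
  moreover have "(\<Sum>i. 2 * pi * sqnorm (row (dilate s t a) i)) = 2 * pi * sqnorm (dilate s t a)"
    using sums_mult[OF sqnorm_rows[OF dilate_ell2(1)[OF s t a]], of "2 * pi"] by (simp add: sums_iff)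
  ultimately have "((\<lambda>\<gamma>. 2 * pi * s * (\<Sum>i. (norm (A i (t * cis \<gamma>)))\<^sup>2 * s ^ (2 * i))) has_integral (2 * pi * s * (2 * pi * sqnorm (dilate s t a)))) {0..2*pi}"
    by (intro has_integral_mult_right) simp
  hence X: "integral {0..2*pi} (\<lambda>\<gamma>. 2 * pi * s * (\<Sum>i. (norm (A i (t * cis \<gamma>)))\<^sup>2 * s ^ (2 * i))) = 4 * pi\<^sup>2 * (s * sqnorm (dilate s t a))"
    by (auto dest!: integral_unique simp: power2_eq_square)
  show ?thesis unfolding torus_mean_def integral_unique[OF inner] X by simp
qed

lemma torus_mean_of_seq_le:
  assumes "a \<in> ell2" "0 < s" "s < 1" "0 < t" "t < 1"
  shows "torus_mean (of_seq a) s t \<le> sqnorm a"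
proof -
  have "s * sqnorm (dilate s t a) \<le> 1 * sqnorm a"
    using assms by (intro mult_mono dilate_ell2 sqnorm_nonneg) auto
  thus ?thesis using assms by (simp add: torus_mean_of_seq)
qed

lemma of_seq_in_hardy:
  assumes "a \<in> ell2" shows "of_seq a \<in> hardy"
  unfolding hardy_def
  using of_seq_holomorphic[OF assms] torus_mean_of_seq_le[OF assms]
  by (auto simp: of_seq_def intro!: bdd_aboveI2[of _ _ "sqnorm a"])

lemma hardy_norm_of_seq:
  assumes a: "a \<in> ell2" shows "hardy_norm (of_seq a) = sqrt (sqnorm a)"
proof -
  have "(SUP (s, t)\<in>{0<..<1} \<times> {0<..<1}. torus_mean (of_seq a) s t) = sqnorm a"
  proof (rule cSup_eq_non_empty)
    fix x assume "x \<in> (\<lambda>(s, t). torus_mean (of_seq a) s t) ` ({0<..<1} \<times> {0<..<1})"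
    thus "x \<le> sqnorm a" using torus_mean_of_seq_le[OF a] by auto
  next
    fix y assume y: "\<And>x. x \<in> (\<lambda>(s, t). torus_mean (of_seq a) s t) ` ({0<..<1} \<times> {0<..<1}) \<Longrightarrow> x \<le> y"
    show "sqnorm a \<le> y"
    proof (rule sqnorm_le_bounded)
      fix F :: "(nat \<times> nat) set" assume F: "finite F"
      show "(\<Sum>q\<in>F. (norm (a q))\<^sup>2) \<le> y"
      proof (rule tendsto_upperbound)
        have "((\<lambda>s. s * (\<Sum>q\<in>F. (norm (dilate s s a q))\<^sup>2)) \<longlongrightarrow> 1 * (\<Sum>q\<in>F. (norm (dilate 1 1 a q))\<^sup>2)) (at_left (1::real))"
          unfolding dilate_def case_prod_unfold by (intro tendsto_intros)
        thus "((\<lambda>s. s * (\<Sum>q\<in>F. (norm (dilate s s a q))\<^sup>2)) \<longlongrightarrow> (\<Sum>q\<in>F. (norm (a q))\<^sup>2)) (at_left (1::real))"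
          by (simp add: dilate_def case_prod_unfold)
        have "s * (\<Sum>q\<in>F. (norm (dilate s s a q))\<^sup>2) \<le> y" if s: "0 < s" "s < 1" for s
        proof -
          have "s * (\<Sum>q\<in>F. (norm (dilate s s a q))\<^sup>2) \<le> s * sqnorm (dilate s s a)"
            using s by (intro mult_left_mono ell2_finite_le dilate_ell2 a F) auto
          also have "\<dots> = torus_mean (of_seq a) s s" using torus_mean_of_seq[OF a s s] ..
          also have "\<dots> \<le> y" by (rule y) (use s in \<open>auto intro!: image_eqI[of _ _ "(s, s)"]\<close>)
          finally show ?thesis .
        qed
        thus "eventually (\<lambda>s. s * (\<Sum>q\<in>F. (norm (dilate s s a q))\<^sup>2) \<le> y) (at_left 1)"
          using eventually_at_left_real[of 0 1] by (auto elim!: eventually_mono)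
      qed simp
    qed
  qed simp
  thus ?thesis by (simp add: hardy_norm_def)
qed

section \<open>Every Hardy function is a square-summable series\<close>

lemma holomorphic_on_Cauchy_transform:
  assumes contf: "continuous_on (sphere z r) f" and r: "r > 0"
    and int: "\<And>w. w \<in> ball z r \<Longrightarrow> ((\<lambda>u. f u / (u - w)) has_contour_integral g w) (circlepath z r)"
  shows "g holomorphic_on ball z r"
proof (rule holomorphic_onI)
  fix w assume w: "w \<in> ball z r"
  have "(g has_field_derivative (of_nat 1 * contour_integral (circlepath z r) (\<lambda>u. f u / (u - w) ^ Suc 1))) (at w)"
    by (rule Cauchy_next_derivative_circlepath(2)) (use contf int w r in \<open>auto simp: less_imp_le\<close>)
  thus "g field_differentiable at w within ball z r"
    using field_differentiable_at_within field_differentiable_def by blast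
qed

lemma contour_integral_circlepath_eq_integral:
  "contour_integral (circlepath z r) f = integral {0..2*pi} (\<lambda>t. f (z + r * cis t) * r * \<i> * cis t)"
  unfolding circlepath_def by (rule contour_integral_part_circlepath_eq) simp

text \<open>Cauchy's formula in \<open>w\<close> and Fubini's theorem express the parameter integral as the Cauchy transform of its own boundary
values.\<close>
lemma holomorphic_on_integral_param:
  fixes \<phi> :: "complex \<Rightarrow> real \<Rightarrow> complex"
  assumes U: "open U" and cont: "continuous_on (U \<times> {a..b}) (\<lambda>(w, t). \<phi> w t)"
    and hol: "\<And>t. t \<in> {a..b} \<Longrightarrow> (\<lambda>w. \<phi> w t) holomorphic_on U"
  shows "(\<lambda>w. integral {a..b} (\<phi> w)) holomorphic_on U"
proof -
  define \<Phi> where "\<Phi> w = integral {a..b} (\<phi> w)" for w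
  have cont\<Phi>: "continuous_on U \<Phi>"
    unfolding \<Phi>_def cbox_interval[symmetric]
    by (rule integral_continuous_on_param) (use cont in \<open>simp add: cbox_interval\<close>)
  have "\<exists>s>0. \<Phi> holomorphic_on ball w0 s" if w0: "w0 \<in> U" for w0
  proof -
    obtain r where r: "r > 0" "cball w0 r \<subseteq> U" using U w0 open_contains_cball by blast
    have sp: "sphere w0 r \<subseteq> U" "ball w0 r \<subseteq> U" using r(2) sphere_cball ball_subset_cball by blast+
    have "(\<lambda>w. 2 * of_real pi * \<i> * \<Phi> w) holomorphic_on ball w0 r"
    proof (rule holomorphic_on_Cauchy_transform[OF _ r(1)])
      show "continuous_on (sphere w0 r) \<Phi>" by (rule continuous_on_subset[OF cont\<Phi> sp(1)])
      fix w assume w: "w \<in> ball w0 r"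
      have nz: "u - w \<noteq> 0" if "u \<in> sphere w0 r" for u using that w by auto
      have int: "(\<lambda>u. \<Phi> u / (u - w)) contour_integrable_on circlepath w0 r"
        by (rule contour_integrable_continuous_circlepath)
           (use r nz in \<open>auto intro!: continuous_intros continuous_on_subset[OF cont\<Phi> sp(1)]\<close>)
      have on: "w0 + r * cis t \<in> sphere w0 r" for t using r(1) by (simp add: dist_norm norm_mult)
      define K where "K t = r * \<i> * cis t / (w0 + r * cis t - w)" for t
      have "contour_integral (circlepath w0 r) (\<lambda>u. \<Phi> u / (u - w))
          = integral {0..2*pi} (\<lambda>t. integral {a..b} (\<lambda>x. \<phi> (w0 + r * cis t) x * K t))"
        unfolding contour_integral_circlepath_eq_integral \<Phi>_def integral_mult_left[symmetric]
        by (simp add: K_def mult.assoc)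
      also have "\<dots> = integral {a..b} (\<lambda>x. integral {0..2*pi} (\<lambda>t. \<phi> (w0 + r * cis t) x * K t))"
        unfolding cbox_interval[symmetric]
      proof (rule integral_swap_continuous)
        have "continuous_on ({0..2*pi} \<times> {a..b}) (\<lambda>p. (\<lambda>(w, t). \<phi> w t) (w0 + r * cis (fst p), snd p))"
          by (rule continuous_on_compose2[OF cont]) (use on sp(1) in \<open>auto intro!: continuous_intros\<close>)
        hence "continuous_on ({0..2*pi} \<times> {a..b}) (\<lambda>p. \<phi> (w0 + r * cis (fst p)) (snd p) * K (fst p))"
          unfolding K_def case_prod_unfold fst_conv snd_conv
          by (intro continuous_intros ballI nz[OF on])
        thus "continuous_on (cbox (0, a) (2 * pi, b)) (\<lambda>(t, x). \<phi> (w0 + r * cis t) x * K t)"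
          unfolding cbox_Pair_eq unfolding cbox_interval case_prod_unfold .
      qed
      also have "\<dots> = integral {a..b} (\<lambda>x. 2 * of_real pi * \<i> * \<phi> w x)"
      proof (rule integral_cong)
        fix x assume x: "x \<in> {a..b}"
        have h: "(\<lambda>w. \<phi> w x) holomorphic_on cball w0 r" using hol[OF x] r(2) holomorphic_on_subset by blast
        have "((\<lambda>u. \<phi> u x / (u - w)) has_contour_integral (2 * of_real pi * \<i> * \<phi> w x)) (circlepath w0 r)"
          by (rule Cauchy_integral_circlepath_simple[OF h]) (use w in \<open>simp add: dist_norm norm_minus_commute\<close>)
        hence "contour_integral (circlepath w0 r) (\<lambda>u. \<phi> u x / (u - w)) = 2 * of_real pi * \<i> * \<phi> w x"
          by (rule contour_integral_unique)
        thus "integral {0..2*pi} (\<lambda>t. \<phi> (w0 + r * cis t) x * K t) = 2 * of_real pi * \<i> * \<phi> w x"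
          unfolding contour_integral_circlepath_eq_integral by (simp add: K_def mult.assoc)
      qed
      also have "\<dots> = 2 * of_real pi * \<i> * \<Phi> w" unfolding \<Phi>_def by (rule integral_mult_right)
      finally show "((\<lambda>u. \<Phi> u / (u - w)) has_contour_integral 2 * of_real pi * \<i> * \<Phi> w) (circlepath w0 r)"
        using has_contour_integral_integral[OF int] by simp
    qed
    from holomorphic_on_divide[OF this holomorphic_on_const, of "2 * of_real pi * \<i>"]
    have "\<Phi> holomorphic_on ball w0 r" by simp
    thus ?thesis using r(1) by auto
  qed
  hence "\<Phi> analytic_on U" unfolding analytic_on_def by blast
  thus ?thesis unfolding \<Phi>_def[abs_def] by (rule analytic_imp_holomorphic)
qed

abbreviation circle_energy :: "(complex \<Rightarrow> complex) \<Rightarrow> real \<Rightarrow> real" where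
  "circle_energy g t \<equiv> integral {0..2*pi} (\<lambda>\<gamma>. (norm (g (of_real t * cis \<gamma>)))\<^sup>2)"

text \<open>The function \<open>(g z - g w)/(z - w)\<close> is holomorphic in \<open>z\<close> on the punctured disc, so its integrals over the circles of
radius \<open>r\<close> and \<open>\<epsilon>\<close> agree. The bound on the quadratic means makes the integral of \<open>g z/(z - w)\<close> over the small
circle \<open>O(\<epsilon>)\<close>, and that of \<open>1/(z - w)\<close> vanishes for \<open>\<epsilon> < |w|\<close>. Thus the singularity at \<open>0\<close> does not contribute.\<close>
lemma punctured_disc_Cauchy_formula:
  assumes hol: "g holomorphic_on ball 0 1 - {0}"
    and M: "\<And>t. 0 < t \<Longrightarrow> t < 1 \<Longrightarrow> circle_energy g t \<le> M"
    and w: "w \<noteq> 0" "norm w < r" and r: "r < 1"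
  shows "contour_integral (circlepath 0 r) (\<lambda>u. g u / (u - w)) = 2 * of_real pi * \<i> * g w"
proof -
  define S where "S = ball (0::complex) 1 - {0}"
  have S: "open S" by (auto simp: S_def)
  have hS: "g holomorphic_on S" using hol by (simp add: S_def)
  have r0: "0 < r" using w norm_ge_zero[of w] by linarith
  define k where "k z = (if z = w then deriv g w else (g z - g w) / (z - w))" for z
  have hk: "k holomorphic_on S" unfolding k_def[abs_def] by (rule pole_lemma_open[OF hS S])
  have sph: "sphere 0 \<rho> \<subseteq> S" if "0 < \<rho>" "\<rho> < 1" for \<rho> using that by (auto simp: S_def)
  have circ: "contour_integral (circlepath 0 \<rho>) k =
      contour_integral (circlepath 0 \<rho>) (\<lambda>u. g u / (u - w)) - g w * contour_integral (circlepath 0 \<rho>) (\<lambda>u. 1 / (u - w))"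
      if \<rho>: "0 < \<rho>" "\<rho> < 1" "norm w \<noteq> \<rho>" for \<rho>
  proof -
    have nz: "u - w \<noteq> 0" if "u \<in> sphere 0 \<rho>" for u using that \<rho> by auto
    have cg: "continuous_on (sphere 0 \<rho>) g"
      using holomorphic_on_imp_continuous_on[OF hS] sph[OF \<rho>(1,2)] continuous_on_subset by blast
    have i: "(\<lambda>u. g u / (u - w)) contour_integrable_on circlepath 0 \<rho>"
            "(\<lambda>u. 1 / (u - w)) contour_integrable_on circlepath 0 \<rho>"
      by (rule contour_integrable_continuous_circlepath; use \<rho> nz in \<open>auto intro!: continuous_intros cg\<close>)+
    have "contour_integral (circlepath 0 \<rho>) k = contour_integral (circlepath 0 \<rho>) (\<lambda>u. g u / (u - w) - g w * (1 / (u - w)))"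
      by (rule contour_integral_cong) (use \<rho> in \<open>auto simp: k_def diff_divide_distrib\<close>)
    thus ?thesis using i by (simp add: contour_integral_diff contour_integral_lmul contour_integrable_lmul del: times_divide_eq_right)
  qed
  have one_in: "contour_integral (circlepath 0 r) (\<lambda>u. 1 / (u - w)) = 2 * of_real pi * \<i>"
    using contour_integral_unique[OF Cauchy_integral_circlepath_simple[of "\<lambda>_. 1" 0 r w]] w by simp
  have one_out: "contour_integral (circlepath 0 \<epsilon>) (\<lambda>u. 1 / (u - w)) = 0" if \<epsilon>: "0 < \<epsilon>" "\<epsilon> < norm w" for \<epsilon>
  proof (rule contour_integral_unique, rule Cauchy_theorem_convex_simple[of _ "ball 0 (norm w)"])
    show "(\<lambda>u. 1 / (u - w)) holomorphic_on ball 0 (norm w)" by (auto intro!: holomorphic_intros)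
  qed (use \<epsilon> in auto)
  have homot: "contour_integral (circlepath 0 r) k = contour_integral (circlepath 0 \<epsilon>) k" if \<epsilon>: "0 < \<epsilon>" "\<epsilon> < r" for \<epsilon>
  proof (rule Cauchy_theorem_homotopic_loops[OF _ S hk])
    show "homotopic_loops S (circlepath 0 r) (circlepath 0 \<epsilon>)"
    proof (rule homotopic_loops_linear)
      fix t :: real
      define e where "e = exp (2 * of_real pi * \<i> * of_real t)"
      have ne: "norm e = 1" by (simp add: e_def norm_exp_eq_Re)
      show "closed_segment (circlepath 0 r t) (circlepath 0 \<epsilon> t) \<subseteq> S"
      proof
        fix x assume "x \<in> closed_segment (circlepath 0 r t) (circlepath 0 \<epsilon> t)"
        then obtain u where u: "0 \<le> u" "u \<le> 1" "x = (1 - u) *\<^sub>R (r * e) + u *\<^sub>R (\<epsilon> * e)"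
          unfolding closed_segment_def circlepath e_def by auto
        \<comment> \<open>Corresponding points of the two circles lie on a common ray, so the homotopy avoids \<open>0\<close>.\<close>
        define q where "q = (1 - u) * r + u * \<epsilon>"
        have x: "x = of_real q * e" unfolding u(3) q_def by (simp add: scaleR_conv_of_real algebra_simps)
        have "\<epsilon> \<le> q" "q \<le> r"
          using u(1,2) \<epsilon> mult_left_mono[of \<epsilon> r "1 - u"] mult_left_mono[of \<epsilon> r u] by (auto simp: q_def algebra_simps)
        hence "0 < norm x" "norm x < 1" using \<epsilon> r ne by (auto simp: x norm_mult)
        thus "x \<in> S" by (auto simp: S_def)
      qed
    qed auto
  qed auto
  define L where "L = contour_integral (circlepath 0 r) (\<lambda>u. g u / (u - w)) - g w * (2 * of_real pi * \<i>)"
  have L: "L = contour_integral (circlepath 0 \<epsilon>) (\<lambda>u. g u / (u - w))" if \<epsilon>: "0 < \<epsilon>" "\<epsilon> < norm w" for \<epsilon>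
    using homot[of \<epsilon>] circ[of r] circ[of \<epsilon>] one_in one_out[OF \<epsilon>] \<epsilon> w r r0 by (simp add: L_def)
  have bound: "norm L \<le> \<epsilon> * ((2 * pi + M) / (norm w - \<epsilon>))" if \<epsilon>: "0 < \<epsilon>" "\<epsilon> < norm w" for \<epsilon>
  proof -
    have \<epsilon>1: "\<epsilon> < 1" using \<epsilon> w r by simp
    have cg: "continuous_on {0..2*pi} (\<lambda>t. g (of_real \<epsilon> * cis t))"
      by (rule continuous_on_compose2[OF holomorphic_on_imp_continuous_on[OF hS]])
         (use \<epsilon> \<epsilon>1 in \<open>auto intro!: continuous_intros simp: S_def norm_mult\<close>)
    have "norm L \<le> integral {0..2*pi} (\<lambda>t. (1 + (norm (g (of_real \<epsilon> * cis t)))\<^sup>2) * (\<epsilon> / (norm w - \<epsilon>)))"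
      unfolding L[OF \<epsilon>] contour_integral_circlepath_eq_integral
    proof (rule integral_norm_bound_integral)
      have nz: "of_real \<epsilon> * cis t - w \<noteq> 0" for t
      proof
        assume "of_real \<epsilon> * cis t - w = 0"
        hence "norm w = norm (of_real \<epsilon> * cis t)" by simp
        thus False using \<epsilon> by (simp add: norm_mult)
      qed
      show "(\<lambda>t. g (0 + of_real \<epsilon> * cis t) / (0 + of_real \<epsilon> * cis t - w) * of_real \<epsilon> * \<i> * cis t) integrable_on {0..2 * pi}"
        by (rule integrable_continuous_real) (use nz cg in \<open>auto intro!: continuous_intros\<close>)
      show "(\<lambda>t. (1 + (norm (g (of_real \<epsilon> * cis t)))\<^sup>2) * (\<epsilon> / (norm w - \<epsilon>))) integrable_on {0..2 * pi}"
        by (rule integrable_continuous_real) (intro continuous_intros cg)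
      fix t :: real
      define y where "y = norm (g (of_real \<epsilon> * cis t))"
      have "norm w - \<epsilon> \<le> norm (of_real \<epsilon> * cis t - w)"
        using norm_triangle_ineq2[of w "of_real \<epsilon> * cis t"] \<epsilon> by (simp add: norm_mult norm_minus_commute)
      hence 1: "\<epsilon> / norm (of_real \<epsilon> * cis t - w) \<le> \<epsilon> / (norm w - \<epsilon>)" using \<epsilon> by (intro divide_left_mono mult_pos_pos) auto
      \<comment> \<open>The elementary bound \<open>y \<le> 1 + y\<^sup>2\<close> passes from the linear to the quadratic mean.\<close>
      have "0 \<le> (y - 1)\<^sup>2" "0 \<le> y" by (simp_all add: y_def)
      hence 2: "y \<le> 1 + y\<^sup>2" by (simp only: power2_diff power_one mult_1_right)
      have "y * (\<epsilon> / norm (of_real \<epsilon> * cis t - w)) \<le> (1 + y\<^sup>2) * (\<epsilon> / (norm w - \<epsilon>))"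
        using \<epsilon> by (intro mult_mono 1 2) (auto simp: y_def)
      thus "norm (g (0 + of_real \<epsilon> * cis t) / (0 + of_real \<epsilon> * cis t - w) * of_real \<epsilon> * \<i> * cis t)
         \<le> (1 + (norm (g (of_real \<epsilon> * cis t)))\<^sup>2) * (\<epsilon> / (norm w - \<epsilon>))"
        using \<epsilon> by (simp add: norm_mult norm_divide y_def)
    qed
    also have "\<dots> = (2 * pi + integral {0..2*pi} (\<lambda>t. (norm (g (of_real \<epsilon> * cis t)))\<^sup>2)) * (\<epsilon> / (norm w - \<epsilon>))"
      unfolding integral_mult_left
      by (subst Henstock_Kurzweil_Integration.integral_add) (auto intro!: integrable_continuous_real continuous_intros cg)
    also have "\<dots> \<le> (2 * pi + M) * (\<epsilon> / (norm w - \<epsilon>))"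
      using M[OF \<epsilon>(1) \<epsilon>1] \<epsilon> by (intro mult_right_mono add_left_mono) auto
    finally show ?thesis by (simp add: mult.commute)
  qed
  have "norm L \<le> 0"
  proof (rule tendsto_lowerbound)
    have "((\<lambda>\<epsilon>. \<epsilon> * ((2 * pi + M) / (norm w - \<epsilon>))) \<longlongrightarrow> 0 * ((2 * pi + M) / (norm w - 0))) (at_right 0)"
      by (intro tendsto_intros) (use w in auto)
    thus "((\<lambda>\<epsilon>. \<epsilon> * ((2 * pi + M) / (norm w - \<epsilon>))) \<longlongrightarrow> 0) (at_right 0)" by simp
    show "eventually (\<lambda>\<epsilon>. norm L \<le> \<epsilon> * ((2 * pi + M) / (norm w - \<epsilon>))) (at_right 0)"
      by (rule eventually_mono[OF eventually_at_right_real[of 0 "norm w"]]) (use w bound in simp_all)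
  qed simp
  thus ?thesis by (simp add: L_def mult.commute)
qed

text \<open>By the preceding formula \<open>g\<close> coincides near \<open>0\<close> with a Cauchy transform, which is holomorphic at \<open>0\<close> too.\<close>
lemma punctured_disc_power_series:
  assumes hol: "g holomorphic_on ball 0 1 - {0}"
    and M: "\<And>t. 0 < t \<Longrightarrow> t < 1 \<Longrightarrow> circle_energy g t \<le> M"
  obtains c where "\<And>w. w \<noteq> 0 \<Longrightarrow> norm w < 1 \<Longrightarrow> (\<lambda>j. c j * w ^ j) sums g w"
proof -
  define G where "G w = contour_integral (circlepath 0 (1/2)) (\<lambda>u. g u / (u - w))" for w
  have cg: "continuous_on (sphere 0 (1/2)) g"
    by (rule continuous_on_subset[OF holomorphic_on_imp_continuous_on[OF hol]]) auto
  have hG: "G holomorphic_on ball 0 (1/2)"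
  proof (rule holomorphic_on_Cauchy_transform[OF cg])
    fix w :: complex assume w: "w \<in> ball 0 (1/2)"
    have "(\<lambda>u. g u / (u - w)) contour_integrable_on circlepath 0 (1/2)"
      by (rule contour_integrable_continuous_circlepath) (use w cg in \<open>auto intro!: continuous_intros\<close>)
    thus "((\<lambda>u. g u / (u - w)) has_contour_integral G w) (circlepath 0 (1/2))"
      unfolding G_def by (rule has_contour_integral_integral)
  qed simp
  define h where "h w = (if w = 0 then G 0 / (2 * of_real pi * \<i>) else g w)" for w
  have "(\<lambda>w. G w / (2 * of_real pi * \<i>)) holomorphic_on ball 0 (1/2)"
    by (intro holomorphic_intros hG) auto
  hence 1: "h holomorphic_on ball 0 (1/2)"
    by (rule holomorphic_transform)
       (auto simp: h_def G_def punctured_disc_Cauchy_formula[OF hol M])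
  have 2: "h holomorphic_on ball 0 1 - {0}"
    by (rule holomorphic_transform[OF hol]) (auto simp: h_def)
  have "h holomorphic_on ball 0 (1/2) \<union> (ball 0 1 - {0})"
    by (rule holomorphic_on_Un[OF 1 2]) auto
  moreover have "ball 0 (1/2) \<union> (ball 0 1 - {0}) = ball (0::complex) 1" by auto
  ultimately have h: "h holomorphic_on ball 0 1" by simp
  show thesis
  proof (rule that)
    fix w :: complex assume "w \<noteq> 0" "norm w < 1"
    thus "(\<lambda>j. taylor_seq h j * w ^ j) sums g w" using taylor_seq_sums[OF h, of w] by (simp add: h_def)
  qed
qed


lemma hardy_holomorphic_z:
  assumes f: "f \<in> hardy" and w: "norm w < 1"
  shows "(\<lambda>z. f (z, w)) holomorphic_on ball 0 (norm w)"
proof (rule holomorphic_onI)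
  fix z :: complex assume "z \<in> ball 0 (norm w)"
  hence "(z, w) \<in> hartogs_triangle" using w by (simp add: hartogs_triangle_def)
  then obtain a b where ab: "(f has_derivative (\<lambda>(h, k). a * h + b * k)) (at (z, w))"
    using f by (auto simp: hardy_def holomorphic2_on_def)
  have "((\<lambda>z. (z, w)) has_derivative (\<lambda>h. (h, 0))) (at z)"
    by (auto intro!: derivative_eq_intros)
  from has_derivative_compose[OF this ab]
  have "((\<lambda>z. f (z, w)) has_derivative (\<lambda>h. a * h)) (at z)" by simp
  hence "((\<lambda>z. f (z, w)) has_field_derivative a) (at z)" by (simp add: has_field_derivative_def)
  thus "(\<lambda>z. f (z, w)) field_differentiable at z within ball 0 (norm w)"
    using field_differentiable_at_within field_differentiable_def by blast
qed

lemma hardy_holomorphic_w: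
  fixes z :: complex
  assumes f: "f \<in> hardy"
  shows "(\<lambda>w. f (z, w)) holomorphic_on {w. norm z < norm w \<and> norm w < 1}"
proof (rule holomorphic_onI)
  fix w :: complex assume "w \<in> {w. norm z < norm w \<and> norm w < 1}"
  hence "(z, w) \<in> hartogs_triangle" by (simp add: hartogs_triangle_def)
  then obtain a b where ab: "(f has_derivative (\<lambda>(h, k). a * h + b * k)) (at (z, w))"
    using f by (auto simp: hardy_def holomorphic2_on_def)
  have "((\<lambda>w. (z, w)) has_derivative (\<lambda>k. (0, k))) (at w)"
    by (auto intro!: derivative_eq_intros)
  from has_derivative_compose[OF this ab]
  have "((\<lambda>w. f (z, w)) has_derivative (\<lambda>k. b * k)) (at w)" by simp
  hence "((\<lambda>w. f (z, w)) has_field_derivative b) (at w)" by (simp add: has_field_derivative_def)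
  thus "(\<lambda>w. f (z, w)) field_differentiable at w within {w. norm z < norm w \<and> norm w < 1}"
    using field_differentiable_at_within field_differentiable_def by blast
qed

lemma hardy_continuous: "f \<in> hardy \<Longrightarrow> continuous_on hartogs_triangle f"
  unfolding hardy_def holomorphic2_on_def
  by (auto intro!: continuous_at_imp_continuous_on dest: has_derivative_continuous)

lemma taylor_seq_integral:
  fixes r R :: real
  assumes g: "g holomorphic_on ball 0 R" and r: "0 \<le> r" "r < R"
  shows "((\<lambda>t. g (r * cis t) * cnj ((r * cis t) ^ n)) has_integral 2 * pi * (taylor_seq g n * r ^ (2 * n))) {0..2*pi}"
proof -
  note gs = taylor_seq_sums[OF g]
  have u: "(\<lambda>k. unit_seq n k * w ^ k) sums (w ^ n)" for w :: complex
    using sums_single[of n "\<lambda>k. w ^ k"] by (simp add: unit_seq_def if_distrib[of "\<lambda>x. x * _"] cong: if_cong)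
  have "summable (\<lambda>k. norm (unit_seq n k) * r ^ k)"
    by (rule summable_finite[of "{n}"]) (auto simp: unit_seq_def)
  from has_integral_parseval[OF r(1) disc_series_abs_summable[OF gs r] this]
  have "((\<lambda>t. g (r * cis t) * cnj ((r * cis t) ^ n)) has_integral
      2 * pi * (\<Sum>k. taylor_seq g k * cnj (unit_seq n k) * r ^ (2 * k))) {0..2*pi}"
    using gs[of "r * cis _"] u[of "r * cis _"] r by (simp add: sums_iff norm_mult)
  moreover have "(\<Sum>k. taylor_seq g k * cnj (unit_seq n k) * of_real (r ^ (2 * k))) = taylor_seq g n * r ^ (2 * n)"
    by (subst suminf_finite[of "{n}"]) (auto simp: unit_seq_def)
  ultimately show ?thesis by simp
qed

text \<open>The coefficient of \<open>u\<^sup>i\<close> in \<open>w f(u w, w)\<close>; the power of \<open>w\<close> comes from \<open>z = u w\<close> and the factor \<open>1/w\<close> of the basis.\<close>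
definition fibre_coeff :: "(complex \<times> complex \<Rightarrow> complex) \<Rightarrow> nat \<Rightarrow> complex \<Rightarrow> complex" where
  "fibre_coeff f i w = w ^ Suc i * taylor_seq (\<lambda>z. f (z, w)) i"

text \<open>Locally in \<open>w\<close> the Taylor coefficient in \<open>z\<close> is given by an integral over a circle whose radius does not depend on
\<open>w\<close>.\<close>
lemma fibre_coeff_holomorphic:
  assumes f: "f \<in> hardy"
  shows "fibre_coeff f i holomorphic_on ball 0 1 - {0}"
proof -
  have "\<exists>s>0. fibre_coeff f i holomorphic_on ball w0 s" if w0: "w0 \<in> ball 0 1 - {0}" for w0
  proof -
    define r where "r = norm w0 / 2"
    define U where "U = {w :: complex. r < norm w \<and> norm w < 1}"
    have r: "0 < r" using w0 by (simp add: r_def)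
    have U: "open U" unfolding U_def by (intro open_Collect_conj open_Collect_less continuous_intros)
    have w0U: "w0 \<in> U" using w0 by (simp add: U_def r_def)
    define \<phi> where "\<phi> w t = f (r * cis t, w) * cnj ((r * cis t) ^ i)" for w t
    have h: "(\<lambda>w. integral {0..2*pi} (\<phi> w)) holomorphic_on U"
    proof (rule holomorphic_on_integral_param[OF U])
      have "continuous_on (U \<times> {0..2*pi}) (\<lambda>p. f (r * cis (snd p), fst p))"
        by (rule continuous_on_compose2[OF hardy_continuous[OF f]])
           (use r in \<open>auto intro!: continuous_intros simp: U_def hartogs_triangle_def norm_mult\<close>)
      thus "continuous_on (U \<times> {0..2*pi}) (\<lambda>(w, t). \<phi> w t)"
        unfolding \<phi>_def case_prod_unfold by (intro continuous_intros)
      fix t :: real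
      have "(\<lambda>w. f (r * cis t, w)) holomorphic_on U"
        using hardy_holomorphic_w[OF f, of "r * cis t"] r by (simp add: U_def norm_mult)
      thus "(\<lambda>w. \<phi> w t) holomorphic_on U" unfolding \<phi>_def by (intro holomorphic_intros)
    qed
    have "(\<lambda>w. w ^ Suc i * (integral {0..2*pi} (\<phi> w) / (2 * pi * r ^ (2 * i)))) holomorphic_on U"
      by (intro holomorphic_intros h) (use r in auto)
    hence "fibre_coeff f i holomorphic_on U"
    proof (rule holomorphic_transform)
      fix w assume w: "w \<in> U"
      have "integral {0..2*pi} (\<phi> w) = 2 * pi * (taylor_seq (\<lambda>z. f (z, w)) i * r ^ (2 * i))"
        unfolding \<phi>_def
        by (rule integral_unique, rule taylor_seq_integral[OF hardy_holomorphic_z[OF f]])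
           (use w r in \<open>auto simp: U_def\<close>)
      thus "w ^ Suc i * (integral {0..2*pi} (\<phi> w) / (2 * pi * r ^ (2 * i))) = fibre_coeff f i w"
        using r by (simp add: fibre_coeff_def)
    qed
    moreover obtain s where "s > 0" "ball w0 s \<subseteq> U" using U w0U open_contains_ball by blast
    ultimately show ?thesis using holomorphic_on_subset by blast
  qed
  hence "fibre_coeff f i analytic_on ball 0 1 - {0}" unfolding analytic_on_def by blast
  thus ?thesis by (rule analytic_imp_holomorphic)
qed

text \<open>Integrates Parseval's identity on the fibre over \<open>w\<close>, truncated to finitely many coefficients, along the circle of radius
\<open>t\<close>.\<close>
lemma fibre_coeff_bessel:
  assumes f: "f \<in> hardy" and s: "0 < s" "s < 1" and t: "0 < t" "t < 1" and I: "finite I"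
  shows "2 * pi * s * (\<Sum>i\<in>I. s ^ (2 * i) * circle_energy (fibre_coeff f i) t)
           \<le> 4 * pi\<^sup>2 * torus_mean f s t"
proof -
  define N where "N \<gamma> \<theta> = (norm (f (of_real (s * t) * cis \<theta>, of_real t * cis \<gamma>)))\<^sup>2 * (s * t\<^sup>2)" for \<gamma> \<theta>
  have st: "0 < s * t" "s * t < t" using s t by auto
  have nw: "norm (t * cis \<gamma>) = t" for \<gamma> using t by (simp add: norm_mult)
  have cA: "continuous_on {0..2*pi} (\<lambda>\<gamma>. fibre_coeff f i (t * cis \<gamma>))" for i
    by (rule continuous_on_compose2[OF holomorphic_on_imp_continuous_on[OF fibre_coeff_holomorphic[OF f]]])
       (use t in \<open>auto intro!: continuous_intros simp: norm_mult\<close>)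
  have "continuous_on ({0..2*pi} \<times> {0..2*pi}) (\<lambda>p. f (of_real (s * t) * cis (snd p), of_real t * cis (fst p)))"
    by (rule continuous_on_compose2[OF hardy_continuous[OF f]])
       (use s t in \<open>auto intro!: continuous_intros simp: hartogs_triangle_def norm_mult\<close>)
  hence "continuous_on ({0..2*pi} \<times> cbox 0 (2*pi)) (\<lambda>(\<gamma>, \<theta>). N \<gamma> \<theta>)"
    unfolding N_def case_prod_unfold cbox_interval by (intro continuous_intros)
  from integral_continuous_on_param[OF this]
  have cN: "continuous_on {0..2*pi} (\<lambda>\<gamma>. integral {0..2*pi} (N \<gamma>))" by (simp add: cbox_interval)
  have le: "2 * pi * s * (\<Sum>i\<in>I. s ^ (2 * i) * (norm (fibre_coeff f i (t * cis \<gamma>)))\<^sup>2) \<le> integral {0..2*pi} (N \<gamma>)" for \<gamma>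
  proof -
    define w where "w = t * cis \<gamma>"
    have w: "norm w = t" by (simp add: w_def nw)
    define B where "B = taylor_seq (\<lambda>z. f (z, w))"
    have Bs: "(\<lambda>i. B i * z ^ i) sums f (z, w)" if "norm z < t" for z
      unfolding B_def by (rule taylor_seq_sums[OF hardy_holomorphic_z[OF f]]) (use w t that in auto)
    have sB: "summable (\<lambda>i. norm (B i) * (s * t) ^ i)"
      by (rule disc_series_abs_summable[OF Bs]) (use st in auto)
    have v: "(\<Sum>i. B i * (of_real (s * t) * cis \<theta>) ^ i) = f (of_real (s * t) * cis \<theta>, w)" for \<theta>
      using Bs[of "of_real (s * t) * cis \<theta>"] st s t by (simp add: sums_iff norm_mult)
    have st0: "0 \<le> s * t" using st by simp
    have "(N \<gamma> has_integral 2 * pi * (\<Sum>i. (norm (B i))\<^sup>2 * (s * t) ^ (2 * i)) * (s * t\<^sup>2)) {0..2*pi}"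
      using has_integral_mult_left[OF has_integral_parseval_self(1)[OF st0 sB], of "s * t\<^sup>2"]
      unfolding v N_def[abs_def] w_def .
    hence N: "integral {0..2*pi} (N \<gamma>) = 2 * pi * (\<Sum>i. (norm (B i))\<^sup>2 * (s * t) ^ (2 * i)) * (s * t\<^sup>2)"
      by (rule integral_unique)
    have e: "(norm (B i))\<^sup>2 * (s * t) ^ (2 * i) * t\<^sup>2 = s ^ (2 * i) * (norm (fibre_coeff f i w))\<^sup>2" for i
    proof -
      have "norm (fibre_coeff f i w) = t * t ^ i * norm (B i)"
        by (simp add: fibre_coeff_def norm_mult norm_power w B_def)
      thus ?thesis by (simp add: power_even_eq power_mult_distrib power2_eq_square)
    qed
    have "(\<Sum>i\<in>I. (norm (B i))\<^sup>2 * (s * t) ^ (2 * i)) \<le> (\<Sum>i. (norm (B i))\<^sup>2 * (s * t) ^ (2 * i))"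
      by (intro sum_le_suminf has_integral_parseval_self(2)[OF st0 sB] I) (use st0 in auto)
    hence "2 * pi * (\<Sum>i\<in>I. (norm (B i))\<^sup>2 * (s * t) ^ (2 * i)) * (s * t\<^sup>2) \<le> integral {0..2*pi} (N \<gamma>)"
      unfolding N using s by (intro mult_right_mono mult_left_mono) auto
    moreover have "2 * pi * (\<Sum>i\<in>I. (norm (B i))\<^sup>2 * (s * t) ^ (2 * i)) * (s * t\<^sup>2) =
        2 * pi * s * (\<Sum>i\<in>I. (norm (B i))\<^sup>2 * (s * t) ^ (2 * i) * t\<^sup>2)"
      by (simp add: sum_distrib_right[symmetric])
    ultimately show ?thesis unfolding e w_def by simp
  qed
  have i: "(\<lambda>\<gamma>. s ^ (2 * i) * (norm (fibre_coeff f i (t * cis \<gamma>)))\<^sup>2) integrable_on {0..2*pi}" for i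
    by (rule integrable_continuous_real) (intro continuous_intros cA)
  have "2 * pi * s * (\<Sum>i\<in>I. s ^ (2 * i) * circle_energy (fibre_coeff f i) t)
    = integral {0..2*pi} (\<lambda>\<gamma>. 2 * pi * s * (\<Sum>i\<in>I. s ^ (2 * i) * (norm (fibre_coeff f i (t * cis \<gamma>)))\<^sup>2))"
    unfolding integral_mult_right by (subst integral_sum[OF I i]) simp
  also have "\<dots> \<le> integral {0..2*pi} (\<lambda>\<gamma>. integral {0..2*pi} (N \<gamma>))"
    by (intro integral_le integrable_continuous_real continuous_intros cA cN le)
  also have "\<dots> = 4 * pi\<^sup>2 * torus_mean f s t"
    unfolding torus_mean_def N_def[abs_def] by simp
  finally show ?thesis .
qed

text \<open>Each fibre coefficient has bounded quadratic means and so extends to a power series in \<open>w\<close>, whose coefficients form the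
rows of \<open>a\<close>. Parseval's identity in \<open>w\<close> bounds the finite sums of \<open>|a(i, j)|\<^sup>2 s\<^bsup>2i + 2j + 1\<^esup>\<close> by the supremum of the torus
means, uniformly in \<open>s < 1\<close>.\<close>
theorem hardy_eq_of_seq:
  assumes f: "f \<in> hardy"
  obtains a where "a \<in> ell2" "f = of_seq a"
proof -
  have "bdd_above ((\<lambda>(s, t). torus_mean f s t) ` ({0<..<1} \<times> {0<..<1}))" using f by (simp add: hardy_def)
  then obtain C where C: "\<And>x. x \<in> (\<lambda>(s, t). torus_mean f s t) ` ({0<..<1} \<times> {0<..<1}) \<Longrightarrow> x \<le> C"
    unfolding bdd_above_def by blast
  have C: "torus_mean f s t \<le> C" if "0 < s" "s < 1" "0 < t" "t < 1" for s t
    by (rule C) (use that in \<open>auto intro!: image_eqI[of _ _ "(s, t)"]\<close>)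
  \<comment> \<open>A bound that is uniform in \<open>t\<close>, as needed to remove the singularity at \<open>w = 0\<close>.\<close>
  have bd: "2 * pi * s * (\<Sum>i\<in>I. s ^ (2 * i) * circle_energy (fibre_coeff f i) t) \<le> 4 * pi\<^sup>2 * C"
    if "0 < s" "s < 1" "0 < t" "t < 1" "finite I" for s t :: real and I
    by (rule order_trans[OF fibre_coeff_bessel[OF f that]]) (intro mult_left_mono C that, simp)
  have "\<exists>c. \<forall>w. w \<noteq> 0 \<longrightarrow> norm w < 1 \<longrightarrow> (\<lambda>j. c j * w ^ j) sums fibre_coeff f i w" for i
  proof (rule punctured_disc_power_series[OF fibre_coeff_holomorphic[OF f]])
    fix t :: real assume t: "0 < t" "t < 1"
    have "pi * ((1/2) ^ (2 * i) * circle_energy (fibre_coeff f i) t) \<le> 4 * pi\<^sup>2 * C"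
      using bd[of "1/2" t "{i}"] t by simp
    thus "circle_energy (fibre_coeff f i) t \<le> 4 * pi\<^sup>2 * C * 2 ^ (2 * i) / pi"
      by (simp add: field_simps)
  qed blast
  then obtain c where c: "\<And>i w. w \<noteq> 0 \<Longrightarrow> norm w < 1 \<Longrightarrow> (\<lambda>j. c i j * w ^ j) sums fibre_coeff f i w"
    by metis
  define a where "a = (\<lambda>(i, j). c i j)"
  have ra: "row a i = c i" for i by (simp add: row_def a_def)
  have fin: "(\<Sum>q\<in>I \<times> J. (norm (a q))\<^sup>2) \<le> C" if I: "finite I" and J: "finite J" for I J
  proof (rule sum_le_if_weighted_sums_le[where g = "\<lambda>(i, j). 2 * i + 2 * j + 1"])
    fix s :: real assume s: "0 < s" "s < 1"
    have ge: "2 * pi * (\<Sum>j\<in>J. (norm (c i j))\<^sup>2 * s ^ (2 * j)) \<le> circle_energy (fibre_coeff f i) s" for i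
    proof -
      have s0: "0 \<le> s" using s by simp
      have sc: "summable (\<lambda>j. norm (c i j) * s ^ j)"
      proof -
        obtain r where r: "s < r" "r < 1" using dense s by blast
        have "summable (\<lambda>j. c i j * of_real r ^ j)" using c[of "of_real r" i] r s by (simp add: sums_iff)
        from powser_insidea[OF this, of "of_real s"] show ?thesis using s r by (simp add: norm_mult norm_power)
      qed
      have "(\<Sum>j. c i j * (of_real s * cis \<gamma>) ^ j) = fibre_coeff f i (s * cis \<gamma>)" for \<gamma>
        using c[of "of_real s * cis \<gamma>" i] s by (simp add: sums_iff norm_mult)
      with has_integral_parseval_self(1)[OF s0 sc]
      have "circle_energy (fibre_coeff f i) s = 2 * pi * (\<Sum>j. (norm (c i j))\<^sup>2 * s ^ (2 * j))"
        by (simp add: integral_unique)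
      moreover have "(\<Sum>j\<in>J. (norm (c i j))\<^sup>2 * s ^ (2 * j)) \<le> (\<Sum>j. (norm (c i j))\<^sup>2 * s ^ (2 * j))"
        by (intro sum_le_suminf has_integral_parseval_self(2)[OF s0 sc] J) auto
      ultimately show ?thesis by simp
    qed
    have "(2 * pi * (2 * pi)) * (\<Sum>q\<in>I \<times> J. (norm (a q))\<^sup>2 * s ^ (case q of (i, j) \<Rightarrow> 2 * i + 2 * j + 1)) =
       2 * pi * s * (\<Sum>i\<in>I. s ^ (2 * i) * (2 * pi * (\<Sum>j\<in>J. (norm (c i j))\<^sup>2 * s ^ (2 * j))))"
    proof -
      have "(\<Sum>q\<in>I \<times> J. (norm (a q))\<^sup>2 * s ^ (case q of (i, j) \<Rightarrow> 2 * i + 2 * j + 1)) =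
          (\<Sum>i\<in>I. \<Sum>j\<in>J. (norm (c i j))\<^sup>2 * s ^ (2 * i + 2 * j + 1))"
        by (subst sum.cartesian_product) (simp add: a_def case_prod_unfold)
      thus ?thesis by (simp add: sum_distrib_left power_add mult_ac)
    qed
    also have "\<dots> \<le> 2 * pi * s * (\<Sum>i\<in>I. s ^ (2 * i) * circle_energy (fibre_coeff f i) s)"
      using s by (intro mult_left_mono sum_mono ge) auto
    also have "\<dots> \<le> (2 * pi * (2 * pi)) * C" using bd[OF s s I] by (simp add: power2_eq_square)
    finally show "(\<Sum>q\<in>I \<times> J. (norm (a q))\<^sup>2 * s ^ (case q of (i, j) \<Rightarrow> 2 * i + 2 * j + 1)) \<le> C"
      by (subst (asm) mult_le_cancel_left_pos) auto
  qed
  have a: "a \<in> ell2" by (rule ell2_I_rectangles[OF fin])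
  have "f p = of_seq a p" for p
  proof (cases "p \<in> hartogs_triangle")
    case True
    obtain z w where p: "p = (z, w)" by (cases p)
    note d = hartogs_triangleD[OF True[unfolded p]]
    have A: "ip (row a i) (geo w) = fibre_coeff f i w" for i
      using sums_unique2[OF ip_geo_sums[OF ell2_row[OF a] d(3), of i]] c[OF d(1,3)] ra by metis
    have "(\<lambda>i. fibre_coeff f i w * (z / w) ^ i) sums (w * of_seq a (z, w))"
      using of_seq_row_sums[OF a True[unfolded p]] by (simp add: A)
    moreover have "(\<lambda>i. w * (taylor_seq (\<lambda>z. f (z, w)) i * z ^ i)) sums (w * f (z, w))"
      by (intro sums_mult taylor_seq_sums[OF hardy_holomorphic_z[OF f d(3)]] d)
    moreover have "fibre_coeff f i w * (z / w) ^ i = w * (taylor_seq (\<lambda>z. f (z, w)) i * z ^ i)" for i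
      using d(1) by (simp add: fibre_coeff_def power_divide)
    ultimately have "w * of_seq a (z, w) = w * f (z, w)" by (simp only: sums_unique2)
    thus ?thesis using d(1) by (simp add: p)
  next
    case False
    thus ?thesis using f by (cases p) (simp add: hardy_def of_seq_def)
  qed
  thus thesis using that a by blast
qed

section \<open>Transfer to the Hartogs triangle\<close>

lemma of_seq_add_scale:
  assumes "x \<in> ell2" "y \<in> ell2"
  shows "of_seq (\<lambda>i. x i + c * y i) = (\<lambda>p. of_seq x p + c * of_seq y p)"
  using assms by (auto simp: of_seq_def fun_eq_iff ip_add_left ip_scale_left ell2_scale hartogs_kernel_ell2)

lemma of_seq_add:
  "x \<in> ell2 \<Longrightarrow> y \<in> ell2 \<Longrightarrow> of_seq (\<lambda>i. x i + y i) = (\<lambda>p. of_seq x p + of_seq y p)"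
  using of_seq_add_scale[of x y 1] by simp

lemma of_seq_diff:
  "x \<in> ell2 \<Longrightarrow> y \<in> ell2 \<Longrightarrow> of_seq (\<lambda>i. x i - y i) = (\<lambda>p. of_seq x p - of_seq y p)"
  using of_seq_add_scale[of x y "-1"] by simp

lemma of_seq_scale: "of_seq (\<lambda>i. c * x i) = (\<lambda>p. c * of_seq x p)"
  by (auto simp: of_seq_def fun_eq_iff ip_scale_left)

lemma of_seq_zero: "of_seq (\<lambda>i. 0) = (\<lambda>p. 0)"
  by (auto simp: of_seq_def)

lemma hardy_inner_of_seq:
  assumes "x \<in> ell2" "y \<in> ell2"
  shows "hardy_inner (of_seq x) (of_seq y) = ip x y"
proof -
  have "(hardy_norm (\<lambda>p. of_seq x p + c * of_seq y p))\<^sup>2 = sqnorm (\<lambda>i. x i + c * y i)" for c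
    unfolding of_seq_add_scale[OF assms, symmetric]
    using assms by (simp add: hardy_norm_of_seq ell2_add ell2_scale sqnorm_nonneg)
  thus ?thesis unfolding hardy_inner_def sqnorm_polarization[OF assms, symmetric] by simp
qed

lemma of_seq_inject:
  assumes "x \<in> ell2" "y \<in> ell2" "of_seq x = of_seq y"
  shows "x = y"
proof -
  have "of_seq (\<lambda>i. x i - y i) = of_seq (\<lambda>i. 0)"
    using assms by (simp add: of_seq_diff of_seq_zero)
  hence "sqrt (sqnorm (\<lambda>i. x i - y i)) = sqrt (sqnorm (\<lambda>i :: nat \<times> nat. 0 :: complex))"
    using hardy_norm_of_seq[OF ell2_diff[OF assms(1,2)]] hardy_norm_of_seq[OF ell2_zero] by simp
  hence "sqnorm (\<lambda>i. x i - y i) = 0" by (simp add: sqnorm_def)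
  hence "(\<lambda>i. x i - y i) = (\<lambda>i. 0)" using sqnorm_zero_iff[OF ell2_diff[OF assms(1,2)]] by simp
  thus ?thesis by (simp add: fun_eq_iff)
qed

lemma hardy_of_seq_image: "hardy = of_seq ` ell2"
  using hardy_eq_of_seq of_seq_in_hardy by blast

lemma of_seq_eq_multiple:
  assumes "\<And>p. p \<in> hartogs_triangle \<Longrightarrow> ip y (hartogs_kernel p) = m p * ip x (hartogs_kernel p)"
  shows "of_seq y = (\<lambda>p. m p * of_seq x p)"
  using assms by (auto simp: of_seq_def)

lemma mult_z_of_seq: "mult_z (of_seq x) = of_seq (zshift x)"
  unfolding mult_z_def
proof (rule of_seq_eq_multiple[symmetric])
  fix p assume p: "p \<in> hartogs_triangle"
  obtain z w where zw: "p = (z, w)" by (cases p)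
  note d = hartogs_triangleD[OF p[unfolded zw]]
  have "zunshift (hartogs_kernel p) = (\<lambda>q. cnj z * hartogs_kernel p q)"
    using d(1) by (auto simp: zw zunshift_def hartogs_kernel_def tensor_def geo_def fun_eq_iff)
  thus "ip (zshift x) (hartogs_kernel p) = fst p * ip x (hartogs_kernel p)"
    by (simp add: ip_zshift ip_scale_right zw)
qed

lemma mult_w_of_seq: "mult_w (of_seq x) = of_seq (wshift x)"
  unfolding mult_w_def
proof (rule of_seq_eq_multiple[symmetric])
  fix p assume p: "p \<in> hartogs_triangle"
  obtain z w where zw: "p = (z, w)" by (cases p)
  have "wunshift (hartogs_kernel p) = (\<lambda>q. cnj w * hartogs_kernel p q)"
    by (auto simp: zw wunshift_def hartogs_kernel_def tensor_def geo_def fun_eq_iff)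
  thus "ip (wshift x) (hartogs_kernel p) = snd p * ip x (hartogs_kernel p)"
    by (simp add: ip_wshift ip_scale_right zw)
qed

text \<open>Uniqueness holds because a difference of two candidates lies in \<open>X\<close> and is orthogonal to itself.\<close>
lemma adjoint_on_of_seq:
  assumes X: "X \<subseteq> ell2" "\<And>x y. x \<in> X \<Longrightarrow> y \<in> X \<Longrightarrow> (\<lambda>i. x i - y i) \<in> X"
    and b: "b \<in> X" and T: "\<And>x. x \<in> X \<Longrightarrow> hardy_inner (T (of_seq x)) g = ip x b"
  shows "adjoint_on (of_seq ` X) T g = of_seq b"
  unfolding adjoint_on_def
proof (rule the_equality)
  show "of_seq b \<in> of_seq ` X \<and> (\<forall>f\<in>of_seq ` X. hardy_inner (T f) g = hardy_inner f (of_seq b))"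
    using X(1) b T by (auto simp: hardy_inner_of_seq subset_iff)
next
  fix h assume h: "h \<in> of_seq ` X \<and> (\<forall>f\<in>of_seq ` X. hardy_inner (T f) g = hardy_inner f h)"
  then obtain c where c: "c \<in> X" "h = of_seq c" by blast
  define d where "d = (\<lambda>i. b i - c i)"
  have d: "d \<in> X" unfolding d_def by (rule X(2)[OF b c(1)])
  have l: "b \<in> ell2" "c \<in> ell2" "d \<in> ell2" using X(1) b c d by auto
  have "ip d b = ip d c" using h d T[OF d] by (auto simp: c(2) hardy_inner_of_seq l)
  hence "ip d (\<lambda>i. b i - c i) = 0" using l by (simp add: ip_diff_right)
  hence "ip d d = 0" by (simp add: d_def)
  hence "d = (\<lambda>i. 0)" using l by (simp add: ip_self sqnorm_zero_iff)
  hence "c = b" by (simp add: d_def fun_eq_iff)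
  thus "h = of_seq b" by (simp add: c(2))
qed

context inner_seq_pair
begin

lemma orth_proj_of_seq:
  assumes y: "y \<in> ell2"
  shows "orth_proj (of_seq ` H.compl) (of_seq y) = of_seq (H.proj_compl y)"
  unfolding orth_proj_def
proof (rule the_equality)
  have P: "H.proj_compl y \<in> H.compl" by (rule H.proj_compl_in[OF y])
  note l = y H.compl_ell2[OF P]
  show "of_seq (H.proj_compl y) \<in> of_seq ` H.compl \<and>
        (\<forall>g\<in>of_seq ` H.compl. hardy_inner (\<lambda>p. of_seq y p - of_seq (H.proj_compl y) p) g = 0)"
    using P H.ip_proj_compl[OF y]
    by (auto simp: of_seq_diff[OF l, symmetric] hardy_inner_of_seq ell2_diff l H.compl_ell2 ip_diff_left)
  fix h assume h: "h \<in> of_seq ` H.compl \<and> (\<forall>g\<in>of_seq ` H.compl. hardy_inner (\<lambda>p. of_seq y p - h p) g = 0)"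
  then obtain c where c: "c \<in> H.compl" "h = of_seq c" by blast
  define d where "d = (\<lambda>i. H.proj_compl y i - c i)"
  have d: "d \<in> H.compl" unfolding d_def by (rule H.compl_diff[OF P c(1)])
  note l' = l H.compl_ell2[OF c(1)] H.compl_ell2[OF d]
  have "hardy_inner (\<lambda>p. of_seq y p - of_seq c p) (of_seq d) = 0" using h d unfolding c(2) by blast
  hence "ip y d = ip c d"
    by (simp add: of_seq_diff[OF l'(1,3), symmetric] hardy_inner_of_seq ell2_diff l' ip_diff_left)
  hence "ip (\<lambda>i. H.proj_compl y i - c i) d = 0"
    using l' H.ip_proj_compl[OF y d] by (simp add: ip_diff_left)
  hence "ip d d = 0" by (simp add: d_def)
  hence "d = (\<lambda>i. 0)" using l' by (simp add: ip_self sqnorm_zero_iff)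
  hence "c = H.proj_compl y" by (simp add: d_def fun_eq_iff)
  thus "h = of_seq (H.proj_compl y)" by (simp add: c(2))
qed

lemma adjoint_mult_z:
  assumes y: "y \<in> ell2" shows "adjoint_on hardy mult_z (of_seq y) = of_seq (zunshift y)"
  unfolding hardy_of_seq_image
  by (rule adjoint_on_of_seq)
     (auto simp: y mult_z_of_seq hardy_inner_of_seq ell2_zshift ip_zshift intro: ell2_diff ell2_zunshift)

lemma adjoint_mult_w:
  assumes y: "y \<in> ell2" shows "adjoint_on hardy mult_w (of_seq y) = of_seq (wunshift y)"
  unfolding hardy_of_seq_image
  by (rule adjoint_on_of_seq)
     (auto simp: y mult_w_of_seq hardy_inner_of_seq ell2_wshift ip_wshift intro: ell2_diff ell2_wunshift)

lemma compress_w_of_seq: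
  "x \<in> ell2 \<Longrightarrow> compress_w (of_seq ` H.compl) (of_seq x) = of_seq (H.proj_compl (wshift x))"
  by (simp add: compress_w_def mult_w_of_seq orth_proj_of_seq ell2_wshift)

lemma adjoint_compress_z:
  assumes y: "y \<in> H.compl"
  shows "adjoint_on (of_seq ` H.compl) (compress_z (of_seq ` H.compl)) (of_seq y) = of_seq (zunshift y)"
proof (rule adjoint_on_of_seq)
  fix x assume x: "x \<in> H.compl"
  have "compress_z (of_seq ` H.compl) (of_seq x) = of_seq (H.proj_compl (zshift x))"
    using H.compl_ell2[OF x] by (simp add: compress_z_def mult_z_of_seq orth_proj_of_seq ell2_zshift)
  moreover have "hardy_inner (of_seq (H.proj_compl (zshift x))) (of_seq y) = ip (zshift x) y"
    using H.ip_proj_compl[OF ell2_zshift[OF H.compl_ell2[OF x]] y]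
    by (simp add: hardy_inner_of_seq H.compl_ell2 y H.proj_compl_in ell2_zshift x)
  ultimately show "hardy_inner (compress_z (of_seq ` H.compl) (of_seq x)) (of_seq y) = ip x (zunshift y)"
    by (simp add: ip_zshift)
qed (use y in \<open>auto intro: H.compl_diff H.compl_ell2 compl_zunshift\<close>)

lemma quotient_module_of_seq: "quotient_module (of_seq ` H.compl)"
proof -
  have zero: "(\<lambda>i. 0) \<in> H.compl" by (simp add: H.compl_def ell2_zero)
  have "closed_subspace (of_seq ` H.compl)"
    unfolding closed_subspace_def
  proof (intro conjI ballI allI impI)
    show "of_seq ` H.compl \<subseteq> hardy" using of_seq_in_hardy H.compl_ell2 by blast
    show "(\<lambda>p. 0) \<in> of_seq ` H.compl" using zero of_seq_zero by (metis image_eqI)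
  next
    fix f g assume "f \<in> of_seq ` H.compl" "g \<in> of_seq ` H.compl"
    then obtain x y where "x \<in> H.compl" "y \<in> H.compl" "f = of_seq x" "g = of_seq y" by blast
    thus "(\<lambda>p. f p + g p) \<in> of_seq ` H.compl"
      by (auto simp: of_seq_add[symmetric] H.compl_ell2 intro: H.compl_add)
  next
    fix c f assume "f \<in> of_seq ` H.compl"
    thus "(\<lambda>p. c * f p) \<in> of_seq ` H.compl"
      by (auto simp: of_seq_scale[symmetric] intro: H.compl_scale)
  next
    fix F g assume g: "g \<in> hardy"
      and F: "(\<forall>n. F n \<in> of_seq ` H.compl) \<and> (\<lambda>n. hardy_norm (\<lambda>p. F n p - g p)) \<longlonglongrightarrow> 0"
    obtain y where y: "y \<in> ell2" "g = of_seq y" using g hardy_eq_of_seq by blast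
    have "\<exists>x. x \<in> H.compl \<and> F n = of_seq x" for n using F by blast
    then obtain x where x: "\<And>n. x n \<in> H.compl" "\<And>n. F n = of_seq (x n)" by metis
    have "hardy_norm (\<lambda>p. F n p - g p) = sqrt (sqnorm (\<lambda>i. x n i - y i))" for n
      unfolding x(2) y(2) of_seq_diff[OF H.compl_ell2[OF x(1)] y(1), symmetric]
      by (intro hardy_norm_of_seq ell2_diff H.compl_ell2 x y)
    hence "y \<in> H.compl" using F by (intro H.compl_closed[of x, OF x(1) y(1)]) simp
    thus "g \<in> of_seq ` H.compl" using y by blast
  qed
  thus ?thesis unfolding quotient_module_def
    using H.compl_ell2 compl_zunshift compl_wunshift by (auto simp: adjoint_mult_z adjoint_mult_w)
qed

lemma doubly_commuting_of_seq: "doubly_commuting (of_seq ` H.compl) \<longleftrightarrow> seq_doubly_commuting"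
proof -
  have "adjoint_on (of_seq ` H.compl) (compress_z (of_seq ` H.compl)) (compress_w (of_seq ` H.compl) (of_seq x)) =
        compress_w (of_seq ` H.compl) (adjoint_on (of_seq ` H.compl) (compress_z (of_seq ` H.compl)) (of_seq x)) \<longleftrightarrow>
        zunshift (H.proj_compl (wshift x)) = H.proj_compl (wshift (zunshift x))" if x: "x \<in> H.compl" for x
  proof -
    have P: "H.proj_compl (wshift x) \<in> H.compl" "H.proj_compl (wshift (zunshift x)) \<in> H.compl"
      by (intro H.proj_compl_in ell2_wshift ell2_zunshift H.compl_ell2 x)+
    show ?thesis
      using of_seq_inject[OF H.compl_ell2[OF compl_zunshift[OF P(1)]] H.compl_ell2[OF P(2)]]
      by (auto simp: compress_w_of_seq adjoint_compress_z H.compl_ell2 x P(1) compl_zunshift)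
  qed
  thus ?thesis by (simp add: doubly_commuting_def seq_doubly_commuting_def)
qed

text \<open>Multiplication by \<open>\<theta>1(z/w) \<theta>2(w)\<close> is \<open>synth\<close>. Instead of multiplying double series one evaluates the adjoint at the
reproducing kernel: \<open>analysis\<close> of the kernel at \<open>p\<close> is the conjugate of the multiplier at \<open>p\<close> times the kernel, by the product
formula for inner products of tensors.\<close>
lemma of_seq_synth:
  assumes x: "x \<in> ell2"
    and \<theta>1: "\<And>w. norm w < 1 \<Longrightarrow> (\<lambda>n. c1 n * w ^ n) sums \<theta>1 w"
    and \<theta>2: "\<And>w. norm w < 1 \<Longrightarrow> (\<lambda>n. c2 n * w ^ n) sums \<theta>2 w"
  shows "of_seq (H.synth x) = (\<lambda>(z, w). \<theta>1 (z / w) * \<theta>2 w * of_seq x (z, w))"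
proof -
  have sh: "ip (shift m c) (geo u) = u ^ m * \<theta> u"
    if "c \<in> ell2" "norm u < 1" "\<And>w. norm w < 1 \<Longrightarrow> (\<lambda>n. c n * w ^ n) sums \<theta> w" for m c u \<theta>
    by (rule sums_unique2[OF ip_geo_sums[OF ell2_shift[OF that(1)] that(2)] sums_shift[OF that(3)[OF that(2)]]])
  have "of_seq (H.synth x) = (\<lambda>p. (case p of (z, w) \<Rightarrow> \<theta>1 (z / w) * \<theta>2 w) * of_seq x p)"
  proof (rule of_seq_eq_multiple)
    fix p assume p: "p \<in> hartogs_triangle"
    obtain z w where zw: "p = (z, w)" by (cases p)
    note d = hartogs_triangleD[OF p[unfolded zw]]
    have "H.analysis (hartogs_kernel p) q = cnj (\<theta>1 (z / w) * \<theta>2 w) * hartogs_kernel p q" for q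
    proof -
      obtain m n where q: "q = (m, n)" by (cases q)
      have pv: "pair_shifts c1 c2 q = tensor (shift m c1) (shift n c2)"
        by (simp add: pair_shifts_def q)
      have hk: "hartogs_kernel p = (\<lambda>q. cnj (1 / w) * tensor (geo (z / w)) (geo w) q)"
        by (simp add: hartogs_kernel_def zw)
      have "H.analysis (hartogs_kernel p) q = cnj (1 / w) * ip (tensor (geo (z / w)) (geo w)) (tensor (shift m c1) (shift n c2))"
        unfolding H.analysis_def pv hk by (rule ip_scale_left)
      also have "ip (tensor (geo (z / w)) (geo w)) (tensor (shift m c1) (shift n c2)) =
          ip (geo (z / w)) (shift m c1) * ip (geo w) (shift n c2)"
        by (intro ip_tensor geo_ell2 ell2_shift c_ell2 d)
      also have "ip (geo (z / w)) (shift m c1) = cnj ((z / w) ^ m * \<theta>1 (z / w))"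
        by (subst ip_commute) (simp only: sh[OF c_ell2(1) d(2) \<theta>1])
      also have "ip (geo w) (shift n c2) = cnj (w ^ n * \<theta>2 w)"
        by (subst ip_commute) (simp only: sh[OF c_ell2(2) d(3) \<theta>2])
      finally show ?thesis by (simp add: q zw hartogs_kernel_def tensor_def geo_def mult_ac)
    qed
    hence "H.analysis (hartogs_kernel p) = (\<lambda>q. cnj (\<theta>1 (z / w) * \<theta>2 w) * hartogs_kernel p q)" ..
    hence "ip (H.synth x) (hartogs_kernel p) = \<theta>1 (z / w) * \<theta>2 w * ip x (hartogs_kernel p)"
      unfolding H.ip_synth[OF x hartogs_kernel_ell2[OF p]] by (simp only: ip_scale_right complex_cnj_cnj)
    thus "ip (H.synth x) (hartogs_kernel p) = (case p of (z, w) \<Rightarrow> \<theta>1 (z / w) * \<theta>2 w) * ip x (hartogs_kernel p)"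
      by (simp add: zw)
  qed
  thus ?thesis by (simp add: case_prod_unfold)
qed

lemma orth_compl_product_submodule:
  assumes \<theta>1: "\<And>w. norm w < 1 \<Longrightarrow> (\<lambda>n. c1 n * w ^ n) sums \<theta>1 w"
    and \<theta>2: "\<And>w. norm w < 1 \<Longrightarrow> (\<lambda>n. c2 n * w ^ n) sums \<theta>2 w"
  shows "orth_compl (product_submodule \<theta>1 \<theta>2) = of_seq ` H.compl"
proof -
  have S: "product_submodule \<theta>1 \<theta>2 = (\<lambda>x. of_seq (H.synth x)) ` ell2"
    unfolding product_submodule_def hardy_of_seq_image image_image
    by (rule image_cong[OF refl]) (simp add: of_seq_synth[OF _ \<theta>1 \<theta>2])
  show ?thesis
    unfolding orth_compl_def S hardy_of_seq_image
    by (auto simp: H.compl_iff_synth hardy_inner_of_seq H.synth_ell2)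
qed

end

section \<open>The conditions in terms of the inner functions\<close>

lemma const_seq_iff_constant_on:
  assumes c: "\<And>w. norm w < 1 \<Longrightarrow> (\<lambda>n. c n * w ^ n) sums \<theta> w"
  shows "const_seq c \<longleftrightarrow> \<theta> constant_on ball 0 1"
proof
  assume k: "const_seq c"
  have "\<theta> w = c 0" if "norm w < 1" for w
  proof -
    have "(\<lambda>n. c n * w ^ n) = (\<lambda>n. if n = 0 then c 0 * w ^ 0 else 0)"
      using k by (auto simp: const_seq_def fun_eq_iff gr0_conv_Suc)
    thus ?thesis using c[OF that] sums_single[of 0 "\<lambda>n. c 0 * w ^ 0"] by (simp add: sums_unique2)
  qed
  thus "\<theta> constant_on ball 0 1" by (auto simp: constant_on_def)
next
  assume "\<theta> constant_on ball 0 1"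
  then obtain k where k: "\<And>w. norm w < 1 \<Longrightarrow> \<theta> w = k" by (auto simp: constant_on_def)
  have "c = (\<lambda>n. k * unit_seq 0 n)"
  proof (rule powser_coeff_unique[OF c])
    fix w :: complex assume "norm w < 1"
    have "(\<lambda>n. k * unit_seq 0 n * w ^ n) = (\<lambda>n. if n = 0 then k else 0)" by (auto simp: unit_seq_def)
    thus "(\<lambda>n. k * unit_seq 0 n * w ^ n) sums \<theta> w"
      using k[OF \<open>norm w < 1\<close>] sums_single[of 0 "\<lambda>n. k"] by simp
  qed
  thus "const_seq c" by (simp add: const_seq_def unit_seq_def)
qed

lemma affine_sums: "(\<lambda>n. (g * unit_seq 1 n + k * unit_seq 0 n) * w ^ n) sums (g * w + k)" for g k w :: complex
proof -
  have e: "(g * unit_seq 1 n + k * unit_seq 0 n) * w ^ n =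
      (if n = 1 then g * w ^ 1 else 0) + (if n = 0 then k * w ^ 0 else 0)" for n
    by (auto simp: unit_seq_def)
  show ?thesis unfolding e
    using sums_add[OF sums_single[of 1 "\<lambda>n. g * w ^ 1"] sums_single[of 0 "\<lambda>n. k * w ^ 0"]] by simp
qed

lemma rotation_seq_iff_rotation:
  assumes c: "\<And>w. norm w < 1 \<Longrightarrow> (\<lambda>n. c n * w ^ n) sums \<theta> w"
  shows "rotation_seq c \<longleftrightarrow> (\<exists>g\<in>sphere 0 1. \<forall>w\<in>ball 0 1. \<theta> w = g * w)"
proof
  assume "rotation_seq c"
  then obtain g where g: "norm g = 1" "c = (\<lambda>n. g * unit_seq 1 n)" by (auto simp: rotation_seq_def)
  have "\<theta> w = g * w" if "norm w < 1" for w
    using sums_unique2[OF c[OF that]] affine_sums[of g 0 w] by (simp add: g(2))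
  thus "\<exists>g\<in>sphere 0 1. \<forall>w\<in>ball 0 1. \<theta> w = g * w" using g(1) by (intro bexI[of _ g]) auto
next
  assume "\<exists>g\<in>sphere 0 1. \<forall>w\<in>ball 0 1. \<theta> w = g * w"
  then obtain g where g: "norm g = 1" "\<And>w. norm w < 1 \<Longrightarrow> \<theta> w = g * w" by auto
  have "c = (\<lambda>n. g * unit_seq 1 n)"
    by (rule powser_coeff_unique[OF c]) (use affine_sums[of g 0] g(2) in auto)
  thus "rotation_seq c" using g(1) by (auto simp: rotation_seq_def)
qed

lemma inner_seq_norm_0_less_1:
  assumes "inner_seq c" "\<not> const_seq c" shows "norm (c 0) < 1"
proof -
  obtain n where n: "c (Suc n) \<noteq> 0" using assms(2) by (auto simp: const_seq_def)
  have "(norm (c 0))\<^sup>2 + (norm (c (Suc n)))\<^sup>2 \<le> 1"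
    using ell2_finite_le[of c "{0, Suc n}"] assms(1) inner_seq_sqnorm[OF assms(1)] by (simp add: inner_seq_def)
  moreover have "(norm (c (Suc n)))\<^sup>2 > 0" using n by simp
  ultimately have "(norm (c 0))\<^sup>2 < 1" by linarith
  thus ?thesis by (simp add: power_less_one_iff)
qed

text \<open>In the forward direction \<open>b = - \<theta>(0) cnj g\<close>, which lies in the disc only because \<open>\<theta>\<close> is not constant; therefore the
constant case is a separate disjunct on both sides.\<close>
lemma moebius_seq_iff_moebius:
  assumes c: "\<And>w. norm w < 1 \<Longrightarrow> (\<lambda>n. c n * w ^ n) sums \<theta> w" and inner: "inner_seq c"
  shows "const_seq c \<or> moebius_seq c \<longleftrightarrow> const_seq c \<or>
    (\<exists>b\<in>ball 0 1. \<exists>g\<in>sphere 0 1. \<forall>w\<in>ball 0 1. \<theta> w = g * ((w - b) / (1 - cnj b * w)))"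
proof (rule disj_cong[OF refl])
  have nz: "1 - cnj b * w \<noteq> 0" if "norm b < 1" "norm w < 1" for b w :: complex
  proof
    assume "1 - cnj b * w = 0"
    hence "norm (cnj b * w) = 1" by simp
    moreover have "norm (cnj b * w) < 1 * 1" unfolding norm_mult using that by (intro mult_strict_mono) auto
    ultimately show False by simp
  qed
  assume nc: "\<not> const_seq c"
  show "moebius_seq c \<longleftrightarrow> (\<exists>b\<in>ball 0 1. \<exists>g\<in>sphere 0 1. \<forall>w\<in>ball 0 1. \<theta> w = g * ((w - b) / (1 - cnj b * w)))"
  proof
    assume "moebius_seq c"
    then obtain g where g: "norm g = 1" "\<And>n. c (Suc n) = g * (unit_seq 0 n - cnj (c 0) * c n)"
      by (auto simp: moebius_seq_def)
    have gg: "g * cnj g = 1" using g(1) by (rule unimodular_cnj)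
    define b where "b = - c 0 * cnj g"
    have b: "norm b < 1" using inner_seq_norm_0_less_1[OF inner nc] g(1) by (simp add: b_def norm_mult)
    have "\<theta> w = g * ((w - b) / (1 - cnj b * w))" if w: "norm w < 1" for w
    proof -
      \<comment> \<open>Two ways of summing \<open>\<Sum>n. c (Suc n) * w\<^bsup>Suc n\<^esup>\<close>, the second one by the recursion.\<close>
      have 1: "(\<lambda>n. c (Suc n) * w ^ Suc n) sums (\<theta> w - c 0)"
        using c[OF w] by (subst sums_Suc_iff) simp
      have "(\<lambda>n. unit_seq 0 n * w ^ n - cnj (c 0) * (c n * w ^ n)) sums (1 - cnj (c 0) * \<theta> w)"
        using affine_sums[of 0 1 w] by (intro sums_diff sums_mult c[OF w]) simp
      from sums_mult[OF this, of "w * g"]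
      have "(\<lambda>n. c (Suc n) * w ^ Suc n) sums (w * g * (1 - cnj (c 0) * \<theta> w))"
        by (simp add: g(2) algebra_simps)
      with 1 have "\<theta> w - c 0 = w * g * (1 - cnj (c 0) * \<theta> w)" by (rule sums_unique2)
      hence "\<theta> w * (1 + g * cnj (c 0) * w) = g * w + c 0" by (simp add: algebra_simps)
      moreover have "1 + g * cnj (c 0) * w = 1 - cnj b * w" by (simp add: b_def mult_ac)
      moreover have "g * w + c 0 = g * (w - b)" using gg by (simp add: b_def algebra_simps)
      ultimately have "\<theta> w * (1 - cnj b * w) = g * (w - b)" by simp
      thus ?thesis using nz[OF b w] by (simp add: field_simps)
    qed
    thus "\<exists>b\<in>ball 0 1. \<exists>g\<in>sphere 0 1. \<forall>w\<in>ball 0 1. \<theta> w = g * ((w - b) / (1 - cnj b * w))"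
      using b g(1) by (intro bexI[of _ b] bexI[of _ g]) auto
  next
    assume "\<exists>b\<in>ball 0 1. \<exists>g\<in>sphere 0 1. \<forall>w\<in>ball 0 1. \<theta> w = g * ((w - b) / (1 - cnj b * w))"
    then obtain b g where b: "norm b < 1" and g: "norm g = 1"
      and \<theta>: "\<And>w. norm w < 1 \<Longrightarrow> \<theta> w = g * ((w - b) / (1 - cnj b * w))" by auto
    have gg: "g * cnj g = 1" using g by (rule unimodular_cnj)
    \<comment> \<open>Compare the Taylor coefficients in \<open>\<theta> w * (1 - cnj b * w) = g * (w - b)\<close>.\<close>
    have e: "(\<lambda>n. c n - cnj b * shift 1 c n) = (\<lambda>n. g * unit_seq 1 n + (- g * b) * unit_seq 0 n)"
    proof (rule powser_coeff_unique)
      fix w :: complex assume w: "norm w < 1"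
      have "(\<lambda>n. c n * w ^ n - cnj b * (shift 1 c n * w ^ n)) sums (\<theta> w - cnj b * (w ^ 1 * \<theta> w))"
        by (intro sums_diff sums_mult sums_shift c[OF w])
      also have "\<theta> w - cnj b * (w ^ 1 * \<theta> w) = \<theta> w * (1 - cnj b * w)" by (simp add: algebra_simps)
      also have "\<dots> = g * (w - b)" unfolding \<theta>[OF w] using nz[OF b w] by simp
      also have "\<dots> = g * w + - g * b" by (simp add: algebra_simps)
      finally show "(\<lambda>n. (c n - cnj b * shift 1 c n) * w ^ n) sums (g * w + - g * b)"
        by (simp add: algebra_simps)
      show "(\<lambda>n. (g * unit_seq 1 n + (- g * b) * unit_seq 0 n) * w ^ n) sums (g * w + - g * b)"
        by (rule affine_sums)
    qed
    have c0: "c 0 = - g * b" using fun_cong[OF e, of 0] by (simp add: shift_def unit_seq_def)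
    have "c (Suc n) = g * (unit_seq 0 n - cnj (c 0) * c n)" for n
    proof -
      have "c (Suc n) = g * unit_seq 0 n + cnj b * c n"
        using fun_cong[OF e, of "Suc n"] by (simp add: shift_def unit_seq_def algebra_simps)
      moreover have "g * cnj (c 0) = - cnj b" using gg by (simp add: c0 mult.assoc[symmetric])
      ultimately show ?thesis by (simp add: right_diff_distrib mult.assoc[symmetric])
    qed
    thus "moebius_seq c" using g by (auto simp: moebius_seq_def)
  qed
qed

theorem theorem1p3:
  fixes \<theta>1 \<theta>2 :: "complex \<Rightarrow> complex"
  assumes "inner_function \<theta>1" and "inner_function \<theta>2"
  shows "quotient_module (orth_compl (product_submodule \<theta>1 \<theta>2)) \<and>
    (doubly_commuting (orth_compl (product_submodule \<theta>1 \<theta>2)) \<longleftrightarrow>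
      (\<theta>1 constant_on ball 0 1 \<and> \<theta>2 constant_on ball 0 1) \<or>
      (\<theta>1 constant_on ball 0 1 \<and>
        (\<exists>b\<in>ball 0 1. \<exists>c\<in>sphere 0 1. \<forall>w\<in>ball 0 1. \<theta>2 w = c * ((w - b) / (1 - cnj b * w)))) \<or>
      (\<theta>2 constant_on ball 0 1 \<and>
        (\<exists>c1\<in>sphere 0 1. \<forall>z\<in>ball 0 1. \<theta>1 z = c1 * z)) \<or>
      (\<exists>c1\<in>sphere 0 1. \<exists>c2\<in>sphere 0 1.
        (\<forall>z\<in>ball 0 1. \<theta>1 z = c1 * z) \<and> (\<forall>w\<in>ball 0 1. \<theta>2 w = c2 * w)))"
proof -
  interpret inner_seq_pair "taylor_seq \<theta>1" "taylor_seq \<theta>2"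
    by unfold_locales (intro inner_function_inner_seq assms)+
  have s: "(\<lambda>n. taylor_seq \<theta>1 n * w ^ n) sums \<theta>1 w" "(\<lambda>n. taylor_seq \<theta>2 n * w ^ n) sums \<theta>2 w"
    if "norm w < 1" for w
    using assms that by (auto simp: inner_function_def intro: taylor_seq_sums)
  note const_seq_iff_constant_on[of "taylor_seq \<theta>1" \<theta>1, OF s(1)] const_seq_iff_constant_on[of "taylor_seq \<theta>2" \<theta>2, OF s(2)]
    rotation_seq_iff_rotation[of "taylor_seq \<theta>1" \<theta>1, OF s(1)] rotation_seq_iff_rotation[of "taylor_seq \<theta>2" \<theta>2, OF s(2)]
    moebius_seq_iff_moebius[of "taylor_seq \<theta>2" \<theta>2, OF s(2) inner2]
  moreover have Q: "orth_compl (product_submodule \<theta>1 \<theta>2) = of_seq ` H.compl"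
    by (rule orth_compl_product_submodule[OF s])
  moreover have "doubly_commuting (orth_compl (product_submodule \<theta>1 \<theta>2)) \<longleftrightarrow>
      const_seq (taylor_seq \<theta>1) \<and> (const_seq (taylor_seq \<theta>2) \<or> moebius_seq (taylor_seq \<theta>2)) \<or>
      rotation_seq (taylor_seq \<theta>1) \<and> (const_seq (taylor_seq \<theta>2) \<or> rotation_seq (taylor_seq \<theta>2))"
    unfolding Q doubly_commuting_of_seq by (rule seq_doubly_commuting_iff)
  moreover have "quotient_module (orth_compl (product_submodule \<theta>1 \<theta>2))"
    unfolding Q by (rule quotient_module_of_seq)
  ultimately show ?thesis by blast
qed

end
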